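(* Let $d,e,r\ge 1$ be integers. For every irreducible complex representation $\rho_1$ of $G(de,e,r+1)$ and every irreducible complex representation $\rho_2$ of its maximal parabolic subgroup $G(de,e,r)$, the multiplicity of $\rho_2$ in the restriction of $\rho_1$ to $G(de,e,r)$ is at most $2$ (equivalently, all entries of the induction table between $G(de,e,r)$ and $G(de,e,r+1)$ are at most $2$).
   Context: Let $\mu_k\subset\mathbb{C}^\times$ be the group of $k$-th roots of unity. A matrix is monomial if it has exactly one non-zero entry in each row and in each column. $G(de,e,r)$ is the subgroup of $\mathrm{GL}_r(\mathbb{C})$ of all monomial matrices whose non-zero entries lie in $\mu_{de}$ and such that the product of these non-zero entries lies in $\mu_d$. The subgroup $G(de,e,r)\subset G(de,e,r+1)$ is the subgroup of elements leaving the $(r+1)$-th coordinate unchanged, i.e. block matrices $\mathrm{diag}(g,1)$ with $g\in G(de,e,r)$. Representations are finite-dimensional over $\mathbb{C}$. *)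

theory Defs
  imports "Jordan_Normal_Form.VS_Connect" Complex_Main
begin

section \<open>The groups \<open>G(de,e,r)\<close>\<close>

definition GL :: "nat \<Rightarrow> complex mat monoid" where
  "GL n = units_of (ring_mat TYPE(complex) n ())"

definition monomial_mat :: "'a::zero mat \<Rightarrow> bool" where
  "monomial_mat A \<longleftrightarrow>
     (\<forall>i<dim_row A. \<exists>!j. j < dim_col A \<and> A $$ (i, j) \<noteq> 0) \<and>
     (\<forall>j<dim_col A. \<exists>!i. i < dim_row A \<and> A $$ (i, j) \<noteq> 0)"

definition nonzero_positions :: "'a::zero mat \<Rightarrow> (nat \<times> nat) set" where
  "nonzero_positions A = {(i, j). i < dim_row A \<and> j < dim_col A \<and> A $$ (i, j) \<noteq> 0}"

definition root_group :: "nat \<Rightarrow> complex set" where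
  "root_group k = {z. z ^ k = 1}"

text \<open>\<open>G_group d e r\<close> is \<open>G(de,e,r)\<close>: the first argument is \<open>d\<close>, not the product \<open>de\<close>.\<close>

definition G_group :: "nat \<Rightarrow> nat \<Rightarrow> nat \<Rightarrow> complex mat monoid" where
  "G_group d e r = (GL r)\<lparr>carrier :=
     {A \<in> carrier (GL r). monomial_mat A \<and>
        (\<forall>p\<in>nonzero_positions A. A $$ p \<in> root_group (d * e)) \<and>
        (\<Prod>p\<in>nonzero_positions A. A $$ p) \<in> root_group d}\<rparr>"

definition fix_last :: "nat \<Rightarrow> complex mat \<Rightarrow> complex mat" where
  "fix_last r A = four_block_mat A (0\<^sub>m r 1) (0\<^sub>m 1 r) (1\<^sub>m 1)"

section \<open>Finite-dimensional complex representations\<close>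

text \<open>
  A representation is given in coordinates, as its degree \<open>n\<close> together with a homomorphism
  to \<open>GL n\<close>. Only the values of the homomorphism on the carrier of the group are relevant.
\<close>

type_synonym 'g rep = "nat \<times> ('g \<Rightarrow> complex mat)"

definition representation :: "('g, 'b) monoid_scheme \<Rightarrow> 'g rep \<Rightarrow> bool" where
  "representation G R \<longleftrightarrow> snd R \<in> hom G (GL (fst R))"

definition invariant_subspace ::
  "('g, 'b) monoid_scheme \<Rightarrow> 'g rep \<Rightarrow> complex vec set \<Rightarrow> bool" where
  "invariant_subspace G R W \<longleftrightarrow>
     subspace class_ring W (module_vec TYPE(complex) (fst R)) \<and>
     (\<forall>g\<in>carrier G. \<forall>w\<in>W. snd R g *\<^sub>v w \<in> W)"

definition irreducible_rep :: "('g, 'b) monoid_scheme \<Rightarrow> 'g rep \<Rightarrow> bool" where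
  "irreducible_rep G R \<longleftrightarrow>
     representation G R \<and> fst R > 0 \<and>
     (\<forall>W. invariant_subspace G R W \<longrightarrow> W = {0\<^sub>v (fst R)} \<or> W = carrier_vec (fst R))"

definition equivalent_reps :: "('g, 'b) monoid_scheme \<Rightarrow> 'g rep \<Rightarrow> 'g rep \<Rightarrow> bool" where
  "equivalent_reps G R S \<longleftrightarrow>
     fst R = fst S \<and>
     (\<exists>P\<in>carrier (GL (fst R)). \<forall>g\<in>carrier G. P * snd R g = snd S g * P)"

definition direct_sum_rep :: "'g rep list \<Rightarrow> 'g rep" where
  "direct_sum_rep Rs =
     (sum_list (map fst Rs), \<lambda>g. diag_block_mat (map (\<lambda>R. snd R g) Rs))"

definition irreducible_decomposition ::
  "('g, 'b) monoid_scheme \<Rightarrow> 'g rep \<Rightarrow> 'g rep list \<Rightarrow> bool" where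
  "irreducible_decomposition G R Rs \<longleftrightarrow>
     (\<forall>S\<in>set Rs. irreducible_rep G S) \<and> equivalent_reps G R (direct_sum_rep Rs)"

text \<open>
  For a finite group, every representation has a decomposition into irreducibles and the
  number of summands equivalent to a given irreducible \<open>S\<close> is the same in all of them, so that
  the description below determines a number; it is not meant to be used otherwise.
\<close>

definition multiplicity_in :: "('g, 'b) monoid_scheme \<Rightarrow> 'g rep \<Rightarrow> 'g rep \<Rightarrow> nat" where
  "multiplicity_in G S R =
     (THE m. \<exists>Rs. irreducible_decomposition G R Rs \<and>
        m = length (filter (equivalent_reps G S) Rs))"

text \<open>Restriction along \<open>G(de,e,r) \<subseteq> G(de,e,r+1)\<close>, where \<open>g\<close> is identified with \<open>diag(g,1)\<close>.\<close>

definition restrict_rep :: "nat \<Rightarrow> complex mat rep \<Rightarrow> complex mat rep" where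
  "restrict_rep r R = (fst R, \<lambda>g. snd R (fix_last r g))"

end

theory Submission
  imports Defs "Jordan_Normal_Form.Spectral_Radius" "HOL-Library.Poly_Mapping"
    "HOL-Number_Theory.Cong" "HOL-Combinatorics.Cycles"
begin

text \<open>
  Put \<open>n = r + 1\<close> and \<open>m = de\<close>. If \<open>p\<close> and \<open>q\<close> are primitive idempotents of the group algebras of
  \<open>G(de,e,r)\<close> and \<open>G(de,e,n)\<close> belonging to \<open>\<rho>\<^sub>2\<close> and \<open>\<rho>\<^sub>1\<close>, then the multiplicity is the dimension of
  \<open>p A q\<close>, where \<open>A\<close> is the group algebra of \<open>G(de,e,n)\<close>. In the larger groups \<open>G(m,1,r)\<close> and
  \<open>G(m,1,n)\<close> both idempotents split into primitive ones, which form a single orbit under the twist \<open>\<theta>\<close>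
  by the linear character \<open>(product of the entries)\<^sup>d\<close>. Fix a constituent \<open>q\<^sub>1\<close> of \<open>q\<close>: then \<open>p A q\<close> embeds into
  \<open>p A q\<^sub>1\<close>, and each constituent \<open>f\<close> of \<open>p\<close> contributes at most one dimension to it, because restriction
  from \<open>G(m,1,n)\<close> to \<open>G(m,1,r)\<close> is multiplicity free (Gelfand's trick).

  Eigenvalues of central elements attach to every primitive idempotent a function on the residues
  modulo \<open>m\<close> that determines its irreducible representation; it records the components of a
  multipartition, and \<open>\<theta>\<close> rotates it by \<open>d\<close>. If \<open>f\<close> contributes, then its function arises from the function
  of \<open>q\<^sub>1\<close> by a change at a single residue, where one box is lost. All these functions are rotations of each
  other, and comparing three of them shows that two coincide or differ by a rotation that fixes the
  function of \<open>q\<^sub>1\<close>, hence by a power of \<open>\<theta>\<close> that fixes \<open>q\<^sub>1\<close>. Such a power acts trivially on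
  \<open>p A q\<^sub>1\<close>, so constituents of \<open>p\<close> related by it contribute only once in total.
\<close>

text \<open>The number of constituents of \<open>p\<close> that contribute is not bounded by two: if
  a power of \<theta> fixes \<open>q1\<close>, it permutes them, and all rotations of one function
  may occur. Only classes modulo the stabiliser of \<open>q1\<close> can be counted, which is why
  three contributions are compared at a time and the outcome is either equality or equivalence under
  that stabiliser. The comparison rests on the fact that rotations commute: two rotations applied in
  either order must change the number of boxes by the same amount. No classification of irreducible
  representations enters. What survives of multipartitions is that certain central elements separate
  primitive idempotents, that the twist shifts their index, and that restriction changes their
  eigenvalues at a single residue. These facts are the hypotheses of the locale
  \<open>branching\<close>. A dimension is bounded by showing that any three elements are linearly
  dependent, and it becomes a multiplicity because the trace of an idempotent matrix is its
  rank.\<close>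

section \<open>Group algebras and primitive idempotents\<close>

subsection \<open>Arithmetic in the group algebra\<close>

text \<open>The product of finitely supported functions is convolution over an additive index type.
  Every group is therefore an instance of the non-commutative class \<open>group_add\<close>, with
  composition written as \<open>+\<close>.\<close>

type_synonym 'g galg = "'g \<Rightarrow>\<^sub>0 complex"

abbreviation "lookup \<equiv> Poly_Mapping.lookup"
abbreviation "keys \<equiv> Poly_Mapping.keys"

text \<open>Scalars are multiples of the unit, so most module laws are instances of ring laws; that
  they commute with the whole algebra still needs an argument (\<open>mult_smul\<close>).\<close>

definition smul :: "complex \<Rightarrow> 'g::group_add galg \<Rightarrow> 'g galg" (infixr "\<cdot>" 75) where
  "c \<cdot> x = Poly_Mapping.single 0 c * x"

definition gr :: "'g \<Rightarrow> 'g::group_add galg" where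
  "gr g = Poly_Mapping.single g 1"

text \<open>The symmetrising trace of the group algebra. It is symmetric and nondegenerate, and
  takes the place of dimension and character arguments.\<close>

definition tr :: "'g::group_add galg \<Rightarrow> complex" where
  "tr x = lookup x 0"

definition lin_ext :: "('g \<Rightarrow> 'h::group_add galg) \<Rightarrow> 'g galg \<Rightarrow> 'h galg" where
  "lin_ext \<phi> x = (\<Sum>g\<in>keys x. lookup x g \<cdot> \<phi> g)"

lemma smul_single: "c \<cdot> Poly_Mapping.single g b = Poly_Mapping.single g (c * b)"
  by (simp add: smul_def mult_single)

lemma single_eq_smul_gr: "Poly_Mapping.single g c = c \<cdot> gr g"
  by (simp add: gr_def smul_single)

lemma galg_expand: "(x :: 'g::group_add galg) = (\<Sum>g\<in>keys x. lookup x g \<cdot> gr g)"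
  by (rule poly_mapping_eqI)
    (simp add: lookup_sum single_eq_smul_gr[symmetric] lookup_single when_def not_in_keys_iff_lookup_eq_zero)

lemma galg_expand_superset:
  assumes "finite K" "keys (x :: 'g::group_add galg) \<subseteq> K"
  shows "x = (\<Sum>g\<in>K. lookup x g \<cdot> gr g)"
proof -
  have "x = (\<Sum>g\<in>keys x. lookup x g \<cdot> gr g)" by (rule galg_expand)
  also have "\<dots> = (\<Sum>g\<in>K. lookup x g \<cdot> gr g)"
    using assms by (intro sum.mono_neutral_left) (auto simp: not_in_keys_iff_lookup_eq_zero smul_def)
  finally show ?thesis .
qed

lemma galg_induct [case_names zero single add]:
  assumes "P 0" "\<And>g c. P (c \<cdot> gr g)" "\<And>x y. P x \<Longrightarrow> P y \<Longrightarrow> P (x + y)"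
  shows "P (x :: 'g::group_add galg)"
proof -
  have "P (\<Sum>g\<in>A. lookup x g \<cdot> gr g)" if "finite A" for A
    using that by induction (auto intro: assms)
  then show ?thesis by (subst galg_expand) simp
qed

lemma smul_simps [simp]:
  fixes x y :: "'g::group_add galg"
  shows "0 \<cdot> x = 0" "c \<cdot> (0 :: 'g galg) = 0" "1 \<cdot> x = x"
    "c \<cdot> (b \<cdot> x) = (c * b) \<cdot> x" "(c \<cdot> x) * y = c \<cdot> (x * y)"
  by (simp_all add: smul_def mult_single flip: mult.assoc)

lemma smul_add: "c \<cdot> ((x :: 'g::group_add galg) + y) = c \<cdot> x + c \<cdot> y"
  and smul_add_left: "(c + b) \<cdot> x = c \<cdot> x + b \<cdot> x"
  and smul_diff_left: "(c - b) \<cdot> x = c \<cdot> x - b \<cdot> x"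
  by (simp_all add: smul_def single_add single_diff algebra_simps)

lemma smul_sum: "c \<cdot> (\<Sum>i\<in>A. f i :: 'g::group_add galg) = (\<Sum>i\<in>A. c \<cdot> f i)"
  by (simp add: smul_def sum_distrib_left)

lemma sum_smul: "(\<Sum>i\<in>A. f i) \<cdot> (x :: 'g::group_add galg) = (\<Sum>i\<in>A. f i \<cdot> x)"
  by (induction A rule: infinite_finite_induct) (auto simp: smul_add_left)

lemma mult_smul [simp]: "x * (c \<cdot> y) = c \<cdot> (x * (y :: 'g::group_add galg))"
proof (induction x rule: galg_induct)
  case (single g b)
  have "Poly_Mapping.single g b * Poly_Mapping.single 0 c
      = Poly_Mapping.single 0 c * Poly_Mapping.single g (b::complex)"
    by (simp add: mult_single mult.commute)
  then have "Poly_Mapping.single g b * (Poly_Mapping.single 0 c * y)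
      = Poly_Mapping.single 0 c * (Poly_Mapping.single g b * y)"
    by (metis mult.assoc)
  then show ?case by (simp add: smul_def gr_def mult_single)
qed (auto simp: smul_add distrib_right)

lemma lookup_smul: "lookup (c \<cdot> x) g = c * lookup (x :: 'g::group_add galg) g"
proof (induction x rule: galg_induct)
  case (single h b)
  show ?case by (simp add: gr_def smul_single lookup_single when_def)
qed (auto simp: smul_add lookup_add distrib_left)

lemma smul_eq_0_iff: "c \<cdot> (x :: 'g::group_add galg) = 0 \<longleftrightarrow> c = 0 \<or> x = 0"
  by (auto simp: poly_mapping_eq_iff fun_eq_iff lookup_smul)

lemma smul_cancel_right: "b \<cdot> x = c \<cdot> x \<longleftrightarrow> b = c \<or> (x :: 'g::group_add galg) = 0"
  by (metis smul_eq_0_iff smul_diff_left eq_iff_diff_eq_0)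

lemma gr_mult: "gr g * gr h = gr (g + h)"
  by (simp add: gr_def mult_single)

lemma gr_0 [simp]: "gr 0 = 1"
  by (simp add: gr_def)

lemma gr_inverse [simp]: "gr g * gr (- g) = 1" "gr (- g) * gr g = 1"
  by (simp_all add: gr_mult)

lemma gr_inverse_left [simp]: "gr g * (gr (- g) * x) = x" "gr (- g) * (gr g * x) = x"
  by (simp_all flip: mult.assoc)

lemma tr_linear [simp]:
  "tr 0 = 0" "tr (x + y) = tr x + tr y" "tr (x - y) = tr x - tr y" "tr (c \<cdot> x) = c * tr x"
  by (simp_all add: tr_def lookup_add lookup_minus lookup_smul)

lemma tr_sum: "tr (\<Sum>i\<in>A. f i) = (\<Sum>i\<in>A. tr (f i))"
  by (simp add: tr_def lookup_sum)

lemma tr_gr: "tr (gr g) = (if g = 0 then 1 else 0)"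
  by (simp add: tr_def gr_def lookup_single when_def)

lemma add_eq_0_swap: "g + h = 0 \<longleftrightarrow> h + g = (0 :: 'g::group_add)"
  by (simp only: eq_neg_iff_add_eq_0[symmetric, of h g] neg_eq_iff_add_eq_0[symmetric, of g h] eq_commute[of "- g"])

lemma tr_commute: "tr (x * y) = tr (y * x)"
proof (induction x rule: galg_induct)
  case (single g c)
  show ?case
  proof (induction y rule: galg_induct)
    case (single h b)
    show ?case by (simp add: gr_mult tr_gr add_eq_0_swap[of g h])
  qed (auto simp: distrib_left distrib_right)
qed (auto simp: distrib_left distrib_right)

lemma tr_cycle: "tr (x * y * z) = tr (y * z * x)"
  by (simp add: tr_commute[of x] mult.assoc)

lemma lookup_gr: "lookup (gr h) g = (if h = g then 1 else 0)"
  by (simp add: gr_def lookup_single when_def)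

lemma gr_minus_add: "gr (- (g + h)) = gr (- h) * gr (- g)"
  by (simp add: gr_mult minus_add)

lemma lookup_eq_tr: "lookup x g = tr (x * gr (- g))"
proof (induction x rule: galg_induct)
  case (single h c)
  show ?case
    by (simp add: gr_mult tr_gr lookup_smul lookup_gr)
qed (auto simp: lookup_add distrib_right)

subsection \<open>Linear extensions\<close>

lemma lin_ext_superset:
  assumes "finite A" "keys x \<subseteq> A"
  shows "lin_ext \<phi> x = (\<Sum>g\<in>A. lookup x g \<cdot> \<phi> g)"
  unfolding lin_ext_def using assms
  by (intro sum.mono_neutral_left) (auto simp: not_in_keys_iff_lookup_eq_zero)

lemma lin_ext_add: "lin_ext \<phi> (x + y) = lin_ext \<phi> x + lin_ext \<phi> (y :: 'g::group_add galg)"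
  using keys_add[of x y]
  by (subst (1 2 3) lin_ext_superset[where A = "keys x \<union> keys y"])
    (auto simp: lookup_add smul_add_left sum.distrib)

lemma lin_ext_smul: "lin_ext \<phi> (c \<cdot> x) = c \<cdot> lin_ext \<phi> (x :: 'g::group_add galg)"
proof -
  have "keys (c \<cdot> x) \<subseteq> keys x" by (auto simp: in_keys_iff lookup_smul)
  then show ?thesis
    by (subst (1 2) lin_ext_superset[where A = "keys x"]) (auto simp: lookup_smul smul_sum)
qed

lemma lin_ext_gr [simp]: "lin_ext \<phi> (gr g) = \<phi> (g :: 'g::group_add)"
  by (simp add: lin_ext_def gr_def)

lemma lin_ext_0 [simp]: "lin_ext \<phi> 0 = 0"
  by (simp add: lin_ext_def)

lemma lin_ext_sum: "lin_ext \<phi> (\<Sum>i\<in>A. f i) = (\<Sum>i\<in>A. lin_ext \<phi> (f i :: 'g::group_add galg))"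
  by (induction A rule: infinite_finite_induct) (auto simp: lin_ext_add)

lemma lin_ext_mult:
  fixes \<phi> :: "'g::group_add \<Rightarrow> 'h::group_add galg"
  assumes "\<And>g h. \<phi> (g + h) = \<phi> g * \<phi> h"
  shows "lin_ext \<phi> (x * y) = lin_ext \<phi> x * lin_ext \<phi> y"
proof (induction x rule: galg_induct)
  case (single g c)
  show ?case
  proof (induction y rule: galg_induct)
    case (single h b)
    show ?case by (simp add: gr_mult lin_ext_smul assms)
  qed (auto simp: distrib_left lin_ext_add)
qed (auto simp: distrib_right lin_ext_add)

lemma lin_ext_antimult:
  fixes \<phi> :: "'g::group_add \<Rightarrow> 'h::group_add galg"
  assumes "\<And>g h. \<phi> (g + h) = \<phi> h * \<phi> g"
  shows "lin_ext \<phi> (x * y) = lin_ext \<phi> y * lin_ext \<phi> x"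
proof (induction x rule: galg_induct)
  case (single g c)
  show ?case
  proof (induction y rule: galg_induct)
    case (single h b)
    show ?case by (simp add: gr_mult lin_ext_smul assms mult.commute)
  qed (auto simp: distrib_left distrib_right lin_ext_add)
qed (auto simp: distrib_right distrib_left lin_ext_add)

subsection \<open>Group algebras of finite subgroups\<close>

definition finite_subgroup :: "'g::group_add set \<Rightarrow> bool" where
  "finite_subgroup K \<longleftrightarrow> finite K \<and> 0 \<in> K \<and> (\<forall>g\<in>K. \<forall>h\<in>K. g + h \<in> K) \<and> (\<forall>g\<in>K. - g \<in> K)"

definition alg :: "'g set \<Rightarrow> 'g::group_add galg set" where
  "alg K = {x. keys x \<subseteq> K}"

lemma alg_expand:
  assumes "finite K" "x \<in> alg K"
  shows "x = (\<Sum>g\<in>K. lookup x g \<cdot> gr g)"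
  using galg_expand_superset assms by (auto simp: alg_def)

lemma alg_mono: "K \<subseteq> L \<Longrightarrow> x \<in> alg K \<Longrightarrow> x \<in> alg L"
  by (auto simp: alg_def)

lemma alg_0 [simp]: "0 \<in> alg K"
  by (simp add: alg_def)

lemma alg_gr [simp]: "gr g \<in> alg K \<longleftrightarrow> g \<in> K"
  by (simp add: alg_def gr_def)

lemma alg_add: "x \<in> alg K \<Longrightarrow> y \<in> alg K \<Longrightarrow> x + y \<in> alg K"
  using keys_add[of x y] by (auto simp: alg_def)

lemma alg_smul: "x \<in> alg K \<Longrightarrow> c \<cdot> x \<in> alg K"
  by (auto simp: alg_def in_keys_iff lookup_smul)

lemma alg_sum: "(\<And>i. i \<in> A \<Longrightarrow> f i \<in> alg K) \<Longrightarrow> (\<Sum>i\<in>A. f i) \<in> alg K"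
  by (induction A rule: infinite_finite_induct) (auto intro: alg_add)

lemma alg_mult:
  assumes "finite_subgroup K" "x \<in> alg K" "y \<in> alg K"
  shows "x * y \<in> alg K"
proof -
  have "keys (x * y) \<subseteq> {g + h | g h. g \<in> keys x \<and> h \<in> keys y}" by (rule keys_mult)
  also have "\<dots> \<subseteq> K" using assms by (auto simp: alg_def finite_subgroup_def)
  finally show ?thesis by (simp add: alg_def)
qed

lemma alg_1 [simp]: "finite_subgroup K \<Longrightarrow> 1 \<in> alg K"
  by (simp add: alg_def finite_subgroup_def)

lemma alg_induct [consumes 2, case_names zero single add]:
  assumes "finite K" "x \<in> alg K"
  assumes "P 0" "\<And>g c. g \<in> K \<Longrightarrow> P (c \<cdot> gr g)" "\<And>x y. P x \<Longrightarrow> P y \<Longrightarrow> P (x + y)"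
  shows "P x"
proof -
  have "P (\<Sum>g\<in>A. lookup x g \<cdot> gr g)" if "finite A" "A \<subseteq> K" for A
    using that by induction (auto intro: assms)
  from this[of K] show ?thesis using assms(1) by (subst alg_expand[OF assms(1,2)]) simp
qed

lemma sum_subgroup_translate:
  assumes "finite_subgroup K" "k \<in> K"
  shows "(\<Sum>g\<in>K. f (k + g)) = (\<Sum>g\<in>K. f g)" "(\<Sum>g\<in>K. f (g + k)) = (\<Sum>g\<in>K. f g)"
proof -
  show "(\<Sum>g\<in>K. f (k + g)) = (\<Sum>g\<in>K. f g)"
    using assms by (intro sum.reindex_bij_witness[where i = "\<lambda>g. - k + g" and j = "\<lambda>g. k + g"])
      (auto simp: finite_subgroup_def simp flip: add.assoc)
  show "(\<Sum>g\<in>K. f (g + k)) = (\<Sum>g\<in>K. f g)"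
    using assms by (intro sum.reindex_bij_witness[where i = "\<lambda>g. g + - k" and j = "\<lambda>g. g + k"])
      (auto simp: finite_subgroup_def add.assoc simp del: add_uminus_conv_diff)
qed

text \<open>Averaging over \<open>K\<close> without the factor \<open>1 / card K\<close>; up to
  scalars it projects onto the commutant of \<open>K\<close>, also when \<open>x\<close> lies in a
  larger group algebra.\<close>

definition conj_sum :: "'g set \<Rightarrow> 'g::group_add galg \<Rightarrow> 'g galg" where
  "conj_sum K x = (\<Sum>k\<in>K. gr k * x * gr (- k))"

lemma conj_sum_alg:
  assumes "finite_subgroup K" "x \<in> alg K"
  shows "conj_sum K x \<in> alg K"
  unfolding conj_sum_def using assms
  by (intro alg_sum alg_mult) (auto simp: finite_subgroup_def)

lemma conj_sum_conj:
  assumes "finite_subgroup K" "k \<in> K"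
  shows "gr k * conj_sum K x * gr (- k) = conj_sum K x"
    and "conj_sum K (gr k * x * gr (- k)) = conj_sum K x"
proof -
  have "gr k * conj_sum K x * gr (- k) = (\<Sum>g\<in>K. gr (k + g) * x * gr (- (k + g)))"
    unfolding conj_sum_def by (simp add: sum_distrib_left sum_distrib_right gr_minus_add mult.assoc flip: gr_mult)
  also have "\<dots> = conj_sum K x"
    unfolding conj_sum_def using assms by (rule sum_subgroup_translate(1)[where f = "\<lambda>g. gr g * x * gr (- g)"])
  finally show "gr k * conj_sum K x * gr (- k) = conj_sum K x" .
  have "conj_sum K (gr k * x * gr (- k)) = (\<Sum>g\<in>K. gr (g + k) * x * gr (- (g + k)))"
    unfolding conj_sum_def by (simp add: sum_distrib_left sum_distrib_right gr_minus_add mult.assoc flip: gr_mult)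
  also have "\<dots> = conj_sum K x"
    unfolding conj_sum_def using assms by (rule sum_subgroup_translate(2)[where f = "\<lambda>g. gr g * x * gr (- g)"])
  finally show "conj_sum K (gr k * x * gr (- k)) = conj_sum K x" .
qed

lemma commute_gr_iff: "gr k * x * gr (- k) = x \<longleftrightarrow> gr k * x = x * gr k"
proof
  assume "gr k * x * gr (- k) = x"
  then have "gr k * x * gr (- k) * gr k = x * gr k" by simp
  then show "gr k * x = x * gr k" by (simp add: mult.assoc)
qed (simp add: mult.assoc)

definition commutant :: "'g set \<Rightarrow> 'g::group_add galg set" where
  "commutant K = {x. \<forall>k\<in>K. gr k * x = x * gr k}"

lemma commutantD: "x \<in> commutant K \<Longrightarrow> k \<in> K \<Longrightarrow> gr k * x = x * gr k"
  by (simp add: commutant_def)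

lemma commutant_alg:
  assumes "x \<in> commutant K" "finite K" "y \<in> alg K"
  shows "x * y = y * x"
  using assms(2,3)
  by (induction rule: alg_induct) (use assms(1) in \<open>auto simp: commutant_def distrib_left distrib_right\<close>)

lemma conj_sum_commutant: "finite_subgroup K \<Longrightarrow> conj_sum K x \<in> commutant K"
  using conj_sum_conj(1) by (auto simp: commutant_def commute_gr_iff[symmetric])

lemma conj_sum_of_commutant: "x \<in> commutant K \<Longrightarrow> conj_sum K x = of_nat (card K) \<cdot> x"
proof -
  assume "x \<in> commutant K"
  then have "conj_sum K x = (\<Sum>k\<in>K. 1 \<cdot> x)"
    unfolding conj_sum_def by (intro sum.cong) (auto simp: commutant_def mult.assoc)
  also have "\<dots> = of_nat (card K) \<cdot> x"
    by (simp only: sum_smul[symmetric]) simp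
  finally show ?thesis .
qed

lemma conj_sum_add: "conj_sum K (x + y) = conj_sum K x + conj_sum K y"
  and conj_sum_smul: "conj_sum K (c \<cdot> x) = c \<cdot> conj_sum K x"
  and conj_sum_0: "conj_sum K 0 = 0"
  by (auto simp: conj_sum_def sum.distrib algebra_simps smul_sum)

lemma conj_sum_sum: "conj_sum K (\<Sum>i\<in>A. f i) = (\<Sum>i\<in>A. conj_sum K (f i))"
  by (induction A rule: infinite_finite_induct) (auto simp: conj_sum_add conj_sum_0)

subsection \<open>Primitive idempotents\<close>

text \<open>The corner of \<open>p\<close> consists of scalars. Over the complex numbers this
  characterises the idempotents that generate simple left ideals, and it builds Schur's lemma into
  the definition.\<close>

definition primitive :: "'g set \<Rightarrow> 'g::group_add galg \<Rightarrow> bool" where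
  "primitive K p \<longleftrightarrow> p \<in> alg K \<and> p \<noteq> 0 \<and> p * p = p \<and> (\<forall>x\<in>alg K. \<exists>c. p * x * p = c \<cdot> p)"

lemma primitiveD:
  assumes "primitive K p"
  shows "p \<in> alg K" "p \<noteq> 0" "p * p = p" "x \<in> alg K \<Longrightarrow> \<exists>c. p * x * p = c \<cdot> p"
  using assms by (auto simp: primitive_def)

lemma idem_left [simp]: "p * p = p \<Longrightarrow> p * (p * x) = p * (x :: 'a::ring)"
  by (simp flip: mult.assoc)

lemma sandwich:
  assumes "p * p = p" "q * q = q" "p * x * q = (x :: 'a::ring)"
  shows "p * x = x" "x * q = x"
proof -
  have "p * (p * x * q) = p * x * q" using assms(1) by (simp add: mult.assoc)
  then show "p * x = x" by (simp add: assms)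
  have "(p * x * q) * q = p * x * q" using assms(2) by (simp add: mult.assoc)
  then show "x * q = x" by (simp add: assms)
qed

text \<open>Lets an equation between products act inside a right-nested product, the normal form of
  most calculations below.\<close>

lemma assoc_rewrite: "x * y = z \<Longrightarrow> x * (y * w) = z * (w :: 'a::ring)"
  by (simp flip: mult.assoc)

text \<open>Every coefficient of \<open>p\<close> is the trace of an element of its corner, hence a
  multiple of \<open>tr p\<close>.\<close>

lemma primitive_tr_neq_0:
  assumes "finite_subgroup K" "primitive K p"
  shows "tr p \<noteq> 0"
proof
  assume 0: "tr p = 0"
  note p = primitiveD[OF assms(2)]
  have "lookup p g = 0" for g
  proof (cases "g \<in> K")
    case True
    then have "gr (- g) \<in> alg K" using assms(1) by (auto simp: finite_subgroup_def)
    then obtain c where c: "p * gr (- g) * p = c \<cdot> p" using p(4) by blast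
    have "lookup p g = tr (p * p * gr (- g))" by (simp add: lookup_eq_tr p)
    also have "\<dots> = tr (p * gr (- g) * p)" by (rule tr_cycle)
    finally show ?thesis by (simp add: c 0)
  qed (use p(1) in \<open>auto simp: alg_def not_in_keys_iff_lookup_eq_zero\<close>)
  then have "p = 0" by (intro poly_mapping_eqI) simp
  with p(2) show False by simp
qed

lemma galg_nonzero_pairing:
  assumes "finite_subgroup K" "x \<in> alg K" "x \<noteq> 0"
  obtains b where "b \<in> K" "tr (x * gr b) \<noteq> 0"
proof -
  obtain g where g: "lookup x g \<noteq> 0"
    using assms(3) by (metis poly_mapping_eqI lookup_zero)
  then have "g \<in> K" using assms(2) by (auto simp: alg_def in_keys_iff)
  then show ?thesis using that[of "- g"] g assms(1) by (auto simp: finite_subgroup_def lookup_eq_tr)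
qed

text \<open>A nonzero element generates the simple left ideal of \<open>q\<close>. Nondegeneracy
  provides \<open>b\<close> with \<open>tr (x * gr b)\<close> nonzero, and then
  \<open>q * gr b * x\<close> lies in the corner of \<open>q\<close> and has nonzero trace.\<close>

lemma primitive_left_inverse:
  assumes K: "finite_subgroup K" and q: "primitive K q"
    and x: "x \<in> alg K" "x * q = x" "x \<noteq> 0"
  obtains y where "y \<in> alg K" "y * x = q" "q * y = y"
proof -
  note qq = primitiveD[OF q]
  obtain b where b: "b \<in> K" "tr (x * gr b) \<noteq> 0"
    using galg_nonzero_pairing[OF K x(1,3)] .
  have bx: "gr b * x \<in> alg K" using b x K by (intro alg_mult) auto
  then obtain c where c: "q * (gr b * x) * q = c \<cdot> q" using qq(4) by blast
  then have c': "q * gr b * x = c \<cdot> q" by (simp add: mult.assoc x)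
  have "tr (x * gr b) = tr (x * q * gr b)" by (simp add: x)
  also have "\<dots> = tr (q * gr b * x)" by (rule tr_cycle)
  also have "\<dots> = c * tr q" by (simp add: c')
  finally have "c \<noteq> 0" using b by auto
  with c' have "(1 / c) \<cdot> (q * gr b) * x = q" by simp
  moreover have "(1 / c) \<cdot> (q * gr b) \<in> alg K"
    using b qq K by (intro alg_smul alg_mult) auto
  moreover have "q * ((1 / c) \<cdot> (q * gr b)) = (1 / c) \<cdot> (q * gr b)" by (simp add: qq flip: mult.assoc)
  ultimately show ?thesis using that by blast
qed

text \<open>Schur orthogonality in disguise: each \<open>p * gr k * p\<close> is a multiple of
  \<open>p\<close>, and the products of these scalars for \<open>k\<close> and \<open>- k\<close>
  add up to \<open>1 / tr p\<close>. Since \<open>a\<close> may lie in a larger algebra, averaging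
  embeds the whole corner of \<open>p\<close> there into the commutant of \<open>K\<close>.\<close>

lemma primitive_conj_sum:
  assumes K: "finite_subgroup K" and p: "primitive K p" and a: "p * a * p = a"
  shows "p * conj_sum K a = (1 / tr p) \<cdot> a" "conj_sum K a * p = (1 / tr p) \<cdot> a"
proof -
  note pp = primitiveD[OF p]
  have t: "tr p \<noteq> 0" by (rule primitive_tr_neq_0[OF K p])
  have pap: "p * a = a" "a * p = a" using sandwich[OF pp(3,3) a] by auto
  have pgp: "p * gr k * p = (lookup p (- k) / tr p) \<cdot> p" if "k \<in> K" for k
  proof -
    obtain c where c: "p * gr k * p = c \<cdot> p" using pp(4)[of "gr k"] \<open>k \<in> K\<close> by auto
    have "lookup p (- k) = tr (p * p * gr k)" by (simp add: lookup_eq_tr pp)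
    also have "\<dots> = tr (p * gr k * p)" by (rule tr_cycle)
    also have "\<dots> = c * tr p" by (simp add: c)
    finally show ?thesis using c t by simp
  qed
  have comm: "conj_sum K a * p = p * conj_sum K a"
    using commutant_alg[OF conj_sum_commutant[OF K]] pp(1) K by (auto simp: finite_subgroup_def)
  have "p * conj_sum K a = p * (conj_sum K a * p)" using comm pp(3) by simp
  also have "\<dots> = (\<Sum>k\<in>K. (p * gr k * p) * a * (p * gr (- k) * p))"
    unfolding conj_sum_def sum_distrib_left sum_distrib_right
    by (intro sum.cong refl) (simp add: mult.assoc pap assoc_rewrite[OF pap(1)] assoc_rewrite[OF pap(2)])
  also have "\<dots> = (\<Sum>k\<in>K. (lookup p (- k) * lookup p k / (tr p)\<^sup>2) \<cdot> a)"
    using K by (intro sum.cong refl)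
      (simp add: pgp finite_subgroup_def pap power2_eq_square mult.commute)
  also have "\<dots> = ((\<Sum>k\<in>K. lookup p (- k) * lookup p k) / (tr p)\<^sup>2) \<cdot> a"
    by (simp add: sum_smul sum_divide_distrib)
  also have "(\<Sum>k\<in>K. lookup p (- k) * lookup p k) = tr (p * p)"
  proof -
    have "tr (p * p) = tr (p * (\<Sum>k\<in>K. lookup p k \<cdot> gr k))"
      using alg_expand[OF _ pp(1)] K by (auto simp: finite_subgroup_def)
    then show ?thesis by (simp add: sum_distrib_left tr_sum lookup_eq_tr mult.commute)
  qed
  also have "tr (p * p) / (tr p)\<^sup>2 = 1 / tr p" using t by (simp add: pp power2_eq_square)
  finally show "p * conj_sum K a = (1 / tr p) \<cdot> a" .
  with comm show "conj_sum K a * p = (1 / tr p) \<cdot> a" by simp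
qed

text \<open>If all products \<open>p * x * p'\<close> vanished, the central element
  \<open>conj_sum K p\<close> would annihilate \<open>p'\<close>. It acts on \<open>p\<close> by the
  nonzero scalar \<open>1 / tr p\<close>, and by assumption it acts on \<open>p'\<close> by the same
  scalar.\<close>

lemma primitive_separation:
  assumes K: "finite_subgroup K" and p: "primitive K p" and p': "primitive K p'"
    and z: "\<And>z. z \<in> alg K \<Longrightarrow> z \<in> commutant K \<Longrightarrow> \<exists>c. z * p = c \<cdot> p \<and> z * p' = c \<cdot> p'"
  obtains x where "x \<in> alg K" "p * x * p' \<noteq> 0"
proof (rule ccontr)
  assume "\<not> thesis"
  with that have *: "p * x * p' = 0" if "x \<in> alg K" for x using \<open>x \<in> alg K\<close> by blast
  note pp = primitiveD[OF p] and pp' = primitiveD[OF p']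
  have "conj_sum K p * p' = (\<Sum>k\<in>K. gr k * (p * gr (- k) * p'))"
    by (simp add: conj_sum_def sum_distrib_right mult.assoc)
  also have "\<dots> = 0" using K by (intro sum.neutral) (auto simp: * finite_subgroup_def)
  finally have 0: "conj_sum K p * p' = 0" .
  obtain c where c: "conj_sum K p * p = c \<cdot> p" "conj_sum K p * p' = c \<cdot> p'"
    using z[OF conj_sum_alg[OF K pp(1)] conj_sum_commutant[OF K]] by blast
  with 0 pp' have "c = 0" by (simp add: smul_eq_0_iff)
  with c primitive_conj_sum(2)[OF K p, of p] have "(1 / tr p) \<cdot> p = 0" by (simp add: pp)
  with primitive_tr_neq_0[OF K p] pp(2) show False by (simp add: smul_eq_0_iff)
qed

text \<open>By \<open>primitive_conj_sum\<close>, commutativity passes from the commutant of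
  \<open>K'\<close> to the corner of \<open>p\<close>. With \<open>y * x = q\<close>, both
  \<open>x * y\<close> and \<open>x' * y\<close> lie in this corner; interchanging them in
  \<open>x' = (x' * y) * (x * y) * x\<close> gives \<open>x * (y * x') * (y * x)\<close>, a multiple
  of \<open>x\<close>.\<close>

lemma gelfand_multiplicity_one:
  assumes K: "finite_subgroup K" and K': "finite_subgroup K'" "K' \<subseteq> K"
    and comm: "\<And>x y. x \<in> alg K \<Longrightarrow> x \<in> commutant K' \<Longrightarrow> y \<in> alg K \<Longrightarrow> y \<in> commutant K' \<Longrightarrow> x * y = y * x"
    and p: "primitive K' p" and q: "primitive K q"
    and x: "x \<in> alg K" "p * x * q = x" "x \<noteq> 0"
    and x': "x' \<in> alg K" "p * x' * q = x'"
  shows "\<exists>c. x' = c \<cdot> x"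
proof -
  note pp = primitiveD[OF p] and qq = primitiveD[OF q]
  have t: "tr p \<noteq> 0" by (rule primitive_tr_neq_0[OF K'(1) p])
  have pK: "p \<in> alg K" using pp(1) K'(2) by (rule alg_mono[rotated])
  have xs: "p * x = x" "x * q = x" "p * x' = x'" "x' * q = x'"
    using sandwich[OF pp(3) qq(3) x(2)] sandwich[OF pp(3) qq(3) x'(2)] by auto
  obtain y0 where y0: "y0 \<in> alg K" "y0 * x = q" "q * y0 = y0"
    using primitive_left_inverse[OF K q x(1) xs(2) x(3)] .
  define y where "y = y0 * p"
  have y: "y \<in> alg K" "y * x = q" "q * y = y" "y * p = y"
    using y0 pK K pp(3) xs by (auto simp: y_def alg_mult mult.assoc simp flip: mult.assoc[of q])
  have commp: "a * b = b * a" if a: "a \<in> alg K" "p * a * p = a" and b: "b \<in> alg K" "p * b * p = b" for a b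
  proof -
    have invK: "conj_sum K' a \<in> alg K" if "a \<in> alg K" for a
      unfolding conj_sum_def using K'(1) K'(2) that K
      by (intro alg_sum alg_mult) (auto simp: finite_subgroup_def)
    have ab: "conj_sum K' a * conj_sum K' b = conj_sum K' b * conj_sum K' a"
      using a(1) b(1) by (intro comm invK conj_sum_commutant[OF K'(1)]) auto
    have *: "(conj_sum K' a * p) * (p * conj_sum K' b) = p * (conj_sum K' a * conj_sum K' b)" for a b
    proof -
      have cp: "conj_sum K' u * p = p * conj_sum K' u" for u
        using commutant_alg[OF conj_sum_commutant[OF K'(1)]] pp(1) K' by (auto simp: finite_subgroup_def)
      have "(conj_sum K' a * p) * (p * conj_sum K' b) = conj_sum K' a * (p * conj_sum K' b)"
        by (simp add: mult.assoc pp(3))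
      also have "\<dots> = (p * conj_sum K' a) * conj_sum K' b"
        by (simp add: cp flip: mult.assoc)
      finally show ?thesis by (simp add: mult.assoc)
    qed
    have "(1 / tr p) \<cdot> a * (1 / tr p) \<cdot> b = (1 / tr p) \<cdot> b * (1 / tr p) \<cdot> a"
      using *[of a b] *[of b a] ab
        primitive_conj_sum[OF K'(1) p a(2)] primitive_conj_sum[OF K'(1) p b(2)] by simp
    then have "(1 / tr p * (1 / tr p)) \<cdot> (a * b) = (1 / tr p * (1 / tr p)) \<cdot> (b * a)" by simp
    then have "(tr p * tr p) \<cdot> ((1 / tr p * (1 / tr p)) \<cdot> (a * b)) = (tr p * tr p) \<cdot> ((1 / tr p * (1 / tr p)) \<cdot> (b * a))"
      by simp
    then show ?thesis using t by simp
  qed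
  obtain c where c: "y * x' = c \<cdot> q"
    using qq(4)[OF alg_mult[OF K y(1) x'(1)]]
    by (auto simp: mult.assoc xs assoc_rewrite[OF y(3)])
  have "x' = x' * q" by (simp add: xs)
  also have "\<dots> = (x' * y) * (x * y) * x" by (simp add: y mult.assoc xs)
  also have "\<dots> = (x * y) * (x' * y) * x"
    using K x x' y pp(3) xs by (subst commp) (auto simp: alg_mult mult.assoc y simp flip: mult.assoc[of p])
  also have "\<dots> = x * (y * x') * (y * x)" by (simp add: mult.assoc)
  also have "\<dots> = c \<cdot> x" by (simp add: c y xs qq mult.assoc)
  finally show ?thesis by blast
qed

section \<open>Clifford theory for a cyclic quotient, and the count of contributing
  constituents\<close>

section \<open>Branching between graded groups\<close>

subsection \<open>Twisting by a linear character\<close>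

definition twist :: "('g \<Rightarrow> complex) \<Rightarrow> 'g::group_add galg \<Rightarrow> 'g galg" where
  "twist \<omega> = lin_ext (\<lambda>g. \<omega> g \<cdot> gr g)"

lemma lookup_twist: "lookup (twist \<omega> x) g = \<omega> g * lookup x g"
proof (induction x rule: galg_induct)
  case (single h c)
  then show ?case by (simp add: twist_def lin_ext_smul lookup_smul lookup_gr)
qed (auto simp: twist_def lin_ext_add lookup_add distrib_left)

lemma lookup_twist_pow: "lookup ((twist \<omega> ^^ j) x) g = \<omega> g ^ j * lookup x g"
  by (induction j) (auto simp: lookup_twist)

lemma twist_add: "twist \<omega> (x + y) = twist \<omega> x + twist \<omega> y"
  and twist_smul: "twist \<omega> (c \<cdot> x) = c \<cdot> twist \<omega> x"
  and twist_sum: "twist \<omega> (\<Sum>i\<in>A. f i) = (\<Sum>i\<in>A. twist \<omega> (f i))"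
  by (simp_all add: twist_def lin_ext_add lin_ext_smul lin_ext_sum)

lemma twist_gr: "twist \<omega> (gr g) = \<omega> g \<cdot> gr g"
  by (simp add: twist_def)

lemma twist_alg: "x \<in> alg K \<Longrightarrow> (twist \<omega> ^^ j) x \<in> alg K"
  by (auto simp: alg_def in_keys_iff lookup_twist_pow)

lemma sum_roots_unity:
  fixes z :: complex
  assumes "z ^ n = 1" "z \<noteq> 1"
  shows "(\<Sum>k<n. z ^ k) = 0"
  using assms by (simp add: sum_gp_strict)

text \<open>The character is multiplicative on the whole type, so that twisting respects all
  products and not only those in \<open>alg K\<close>. The exponent condition on \<open>K\<close>
  makes \<open>K / H\<close> cyclic of order dividing \<open>e\<close>.\<close>

locale graded_group =
  fixes K :: "'g::group_add set" and \<omega> :: "'g \<Rightarrow> complex" and e :: nat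
  assumes fin: "finite_subgroup K"
    and hom: "\<omega> (g + h) = \<omega> g * \<omega> h"
    and pow: "g \<in> K \<Longrightarrow> \<omega> g ^ e = 1"
    and e: "e > 0"
begin

abbreviation \<theta> where "\<theta> \<equiv> twist \<omega>"

abbreviation "H \<equiv> {g\<in>K. \<omega> g = 1}"

lemma finK: "finite K" using fin by (simp add: finite_subgroup_def)

lemma \<omega>_0: "\<omega> 0 = 1"
proof -
  have "\<omega> 0 ^ e = 1" using pow fin by (auto simp: finite_subgroup_def)
  then have "\<omega> 0 \<noteq> 0" using e by (metis power_0_left zero_neq_one neq0_conv)
  then show ?thesis using hom[of 0 0] by simp
qed

lemma finH: "finite_subgroup H"
proof -
  have "\<omega> (- g) = 1" if "\<omega> g = 1" for g
    using hom[of g "- g"] \<omega>_0 that by simp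
  then show ?thesis using fin hom \<omega>_0 by (auto simp: finite_subgroup_def)
qed

lemma twist_mult: "\<theta> (x * y) = \<theta> x * \<theta> y"
  unfolding twist_def by (rule lin_ext_mult) (simp add: hom gr_mult mult.commute)

lemma twist_pow_mult: "(\<theta> ^^ j) (x * y) = (\<theta> ^^ j) x * (\<theta> ^^ j) y"
  by (induction j) (auto simp: twist_mult)

lemma twist_pow_smul: "(\<theta> ^^ j) (c \<cdot> x) = c \<cdot> (\<theta> ^^ j) x"
  by (induction j) (auto simp: twist_smul)

lemma twist_pow_cong:
  assumes "x \<in> alg K" "i mod e = j mod e"
  shows "(\<theta> ^^ i) x = (\<theta> ^^ j) x"
proof (intro poly_mapping_eqI)
  fix g
  show "lookup ((\<theta> ^^ i) x) g = lookup ((\<theta> ^^ j) x) g"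
  proof (cases "g \<in> K")
    case True
    have *: "\<omega> g ^ i = \<omega> g ^ (i mod e)" for i
    proof -
      have "\<omega> g ^ i = \<omega> g ^ (e * (i div e) + i mod e)" by simp
      also have "\<dots> = \<omega> g ^ (i mod e)" by (simp only: power_add power_mult pow[OF True]) simp
      finally show ?thesis .
    qed
    show ?thesis using *[of i] *[of j] assms(2) by (simp add: lookup_twist_pow)
  qed (use assms(1) in \<open>auto simp: lookup_twist_pow alg_def not_in_keys_iff_lookup_eq_zero\<close>)
qed

lemma twist_pow_eq_0:
  assumes "x \<in> alg K" "(\<theta> ^^ j) x = 0"
  shows "x = 0"
proof (rule poly_mapping_eqI)
  fix g
  show "lookup x g = lookup 0 g"
  proof (cases "g \<in> K")
    case True
    then have "\<omega> g \<noteq> 0" using pow[OF True] e by (metis power_0_left zero_neq_one neq0_conv)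
    moreover have "\<omega> g ^ j * lookup x g = 0"
      using assms(2) by (metis lookup_twist_pow lookup_zero)
    ultimately show ?thesis by simp
  qed (use assms(1) in \<open>auto simp: alg_def not_in_keys_iff_lookup_eq_zero\<close>)
qed

lemma alg_H_iff: "x \<in> alg H \<longleftrightarrow> x \<in> alg K \<and> \<theta> x = x"
proof
  assume x: "x \<in> alg H"
  show "x \<in> alg K \<and> \<theta> x = x"
  proof
    show "x \<in> alg K" using x by (auto simp: alg_def)
    show "\<theta> x = x"
    proof (intro poly_mapping_eqI)
      fix g show "lookup (\<theta> x) g = lookup x g"
        by (cases "g \<in> H") (use x in \<open>auto simp: lookup_twist alg_def not_in_keys_iff_lookup_eq_zero\<close>)
    qed
  qed
next
  assume x: "x \<in> alg K \<and> \<theta> x = x"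
  have "\<omega> g = 1" if "g \<in> keys x" for g
  proof -
    have "\<omega> g * lookup x g = lookup x g" using x lookup_twist by metis
    then show ?thesis using that by (simp add: in_keys_iff)
  qed
  then show "x \<in> alg H" using x by (auto simp: alg_def)
qed

lemma twist_pow_H: "x \<in> alg H \<Longrightarrow> (\<theta> ^^ j) x = x"
  by (induction j) (auto simp: alg_H_iff)

lemma alg_HK: "x \<in> alg H \<Longrightarrow> x \<in> alg K" by (simp add: alg_H_iff)

lemma tr_twist_pow: "tr ((\<theta> ^^ j) x) = tr x"
  by (simp add: tr_def lookup_twist_pow \<omega>_0)

lemma twist_pow_primitive:
  assumes "primitive K p"
  shows "primitive K ((\<theta> ^^ j) p)"
  unfolding primitive_def
proof (intro conjI ballI)
  note pp = primitiveD[OF assms]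
  show "(\<theta> ^^ j) p \<in> alg K" using pp by (simp add: twist_alg)
  show "(\<theta> ^^ j) p \<noteq> 0" using pp twist_pow_eq_0 by blast
  show "(\<theta> ^^ j) p * (\<theta> ^^ j) p = (\<theta> ^^ j) p" by (simp add: pp flip: twist_pow_mult)
  fix x assume x: "x \<in> alg K"
  \<comment> \<open>The twist has order dividing \<open>e\<close> on \<open>alg K\<close>, so this
    power of it inverts the \<open>j\<close>-th one.\<close>
  define x' where "x' = (\<theta> ^^ ((e - 1) * j)) x"
  have x': "x' \<in> alg K" using x by (simp add: x'_def twist_alg)
  have "(\<theta> ^^ j) x' = (\<theta> ^^ (j + (e - 1) * j)) x" by (simp add: x'_def funpow_add)
  also have "\<dots> = (\<theta> ^^ 0) x"
    using x e by (intro twist_pow_cong) (auto simp: algebra_simps)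
  finally have xx': "(\<theta> ^^ j) x' = x" by simp
  obtain c where "p * x' * p = c \<cdot> p" using pp(4)[OF x'] by blast
  then have "(\<theta> ^^ j) (p * x' * p) = (\<theta> ^^ j) (c \<cdot> p)" by simp
  then show "\<exists>c. (\<theta> ^^ j) p * x * (\<theta> ^^ j) p = c \<cdot> (\<theta> ^^ j) p"
    by (auto simp: twist_pow_mult twist_pow_smul xx')
qed

text \<open>The algebra \<open>p * alg K * p\<close> is graded by the dual of the cyclic group \<open>K / H\<close> with
  components of dimension at most one, hence consists of polynomials in a homogeneous element
  \<open>y\<close> of least positive degree; its spectral projections are primitive.\<close>

lemma corner_generator:
  assumes p: "primitive H p"
  obtains y where "y \<in> alg K" "p * y = y" "y * p = y" "\<exists>c. c \<noteq> 0 \<and> y ^ e = c \<cdot> p"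
    "\<And>x. x \<in> alg K \<Longrightarrow> \<exists>c l. p * x * p = (\<Sum>j<e. c j \<cdot> (p * y ^ l j))"
proof -
  note pp = primitiveD[OF p]
  have pK: "p \<in> alg K" using pp(1) by (rule alg_HK)
  have \<theta>p: "\<theta> p = p" using pp(1) alg_H_iff by blast
  have trp: "tr p \<noteq> 0" by (rule primitive_tr_neq_0[OF finH p])
  define \<zeta> where "\<zeta> = cis (2 * pi / e)"
  have \<zeta>e: "\<zeta> ^ e = 1" using e by (simp add: \<zeta>_def DeMoivre)
  have \<zeta>0: "\<zeta> \<noteq> 0" by (simp add: \<zeta>_def)
  have roots: "\<exists>j<e. z = \<zeta> ^ j" if "z ^ e = 1" for z
  proof -
    have "bij_betw (\<lambda>k. cis (2 * pi * real k / real e)) {..<e} {z. z ^ e = 1}"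
      using e by (rule bij_betw_roots_unity)
    then have "z \<in> (\<lambda>k. cis (2 * pi * real k / real e)) ` {..<e}"
      using that by (simp add: bij_betw_def)
    then obtain j where "j < e" "z = cis (2 * pi * real j / real e)" by auto
    moreover have "\<zeta> ^ j = cis (2 * pi * real j / real e)"
      by (simp add: \<zeta>_def DeMoivre mult_ac)
    ultimately show ?thesis by auto
  qed
  \<comment> \<open>Homogeneous elements of the corner. The degree matters only modulo
    \<open>e\<close>, but keeping it as a natural number allows a division with remainder.\<close>
  define hg where "hg j x \<longleftrightarrow> x \<in> alg K \<and> p * x = x \<and> x * p = x \<and> \<theta> x = \<zeta> ^ j \<cdot> x" for j x
  have hg0: "\<exists>c. x = c \<cdot> p" if "hg 0 x" for x
  proof -
    have "x \<in> alg H" using that by (simp add: hg_def alg_H_iff)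
    then obtain c where "p * x * p = c \<cdot> p" using pp(4) by blast
    then show ?thesis using that by (auto simp: hg_def)
  qed
  define j0 where "j0 = (LEAST j. j > 0 \<and> (\<exists>x. hg j x \<and> x \<noteq> 0))"
  \<comment> \<open>The unit \<open>p\<close> has degree 0 and also degree \<open>e\<close>, so a
    least positive degree exists even in a one-dimensional corner.\<close>
  have "hg e p" using pK pp \<theta>p \<zeta>e by (simp add: hg_def)
  then have "\<exists>j. j > 0 \<and> (\<exists>x. hg j x \<and> x \<noteq> 0)" using e pp(2) by blast
  from LeastI_ex[OF this] obtain y where j0: "j0 > 0" and y: "hg j0 y" "y \<noteq> 0"
    unfolding j0_def by blast
  have least: "x = 0" if "hg j x" "0 < j" "j < j0" for j x
    using that not_less_Least[of j] unfolding j0_def by blast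
  obtain b where b: "b \<in> K" "tr (y * gr b) \<noteq> 0"
    using galg_nonzero_pairing[OF fin _ y(2)] y(1) by (auto simp: hg_def)
  \<comment> \<open>Up to a scalar, \<open>y1\<close> is the inverse of \<open>y\<close> in the
    corner: the trace is invariant under the twist and nonzero on \<open>y * y1\<close>, so this
    product has degree 0 and is a multiple of \<open>p\<close>.\<close>
  define y1 where "y1 = p * gr b * p"
  have y1: "y1 \<in> alg K" "p * y1 = y1" "y1 * p = y1" "\<theta> y1 = \<omega> b \<cdot> y1"
    using b pK fin pp \<theta>p by (auto simp: y1_def alg_mult twist_mult twist_gr mult.assoc)
  have tr1: "tr (y * y1) = tr (y * gr b)"
  proof -
    have "tr (y * y1) = tr (p * (y * p) * gr b)"
      by (simp add: y1_def tr_commute[of p] mult.assoc flip: tr_cycle[of p])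
    then show ?thesis using y(1) by (simp add: hg_def)
  qed
  have \<theta>yy1: "\<theta> (y * y1) = (\<zeta> ^ j0 * \<omega> b) \<cdot> (y * y1)"
    using y(1) y1 by (simp add: twist_mult hg_def mult.commute)
  have one: "\<zeta> ^ j0 * \<omega> b = 1"
  proof -
    have "tr (\<theta> (y * y1)) = tr (y * y1)" using tr_twist_pow[of 1 "y * y1"] by simp
    then show ?thesis using \<theta>yy1 tr1 b by simp
  qed
  have hgm: "hg 0 (y * y1)" "hg 0 (y1 * y)"
    using y(1) y1 one fin by (auto simp: hg_def alg_mult twist_mult mult.assoc assoc_rewrite mult.commute)
  obtain c where c: "y * y1 = c \<cdot> p" using hg0[OF hgm(1)] by blast
  obtain c' where c': "y1 * y = c' \<cdot> p" using hg0[OF hgm(2)] by blast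
  have c0: "c \<noteq> 0" using c tr1 b(2) by auto
  have "tr (y * y1) = tr (y1 * y)" by (rule tr_commute)
  then have cc': "c' = c" using c c' trp by simp
  \<comment> \<open>Division with remainder: multiplication by \<open>y1\<close> lowers the degree
    by \<open>j0\<close>, and minimality of \<open>j0\<close> kills every element of degree strictly
    between 0 and \<open>j0\<close>.\<close>
  have poly: "\<exists>c l. x = c \<cdot> (p * y ^ l)" if "hg j x" for j x
    using that
  proof (induction j arbitrary: x rule: less_induct)
    case (less j)
    show ?case
    proof (cases "j < j0")
      case True
      show ?thesis
      proof (cases "j = 0")
        case True
        then obtain a where "x = a \<cdot> p" using hg0[of x] less.prems by blast
        then have "x = a \<cdot> (p * y ^ 0)" by simp
        then show ?thesis by blast
      next
        case False
        then have "x = 0 \<cdot> (p * y ^ 0)" using True least[OF less.prems] by simp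
        then show ?thesis by blast
      qed
    next
      case False
      have "\<theta> (x * y1) = (\<zeta> ^ j * \<omega> b) \<cdot> (x * y1)"
        using less.prems y1 by (simp add: twist_mult hg_def mult.commute)
      also have "\<zeta> ^ j * \<omega> b = \<zeta> ^ (j - j0) * (\<zeta> ^ j0 * \<omega> b)"
        using False by (simp flip: power_add mult.assoc)
      finally have hgx: "hg (j - j0) (x * y1)"
        using less.prems y1 fin by (auto simp: hg_def alg_mult one mult.assoc assoc_rewrite)
      have "j - j0 < j" using False j0 by simp
      then obtain a l where al: "x * y1 = a \<cdot> (p * y ^ l)"
        using less.IH[OF _ hgx] by blast
      have "c \<cdot> x = x * y1 * y" using less.prems c' cc' by (simp add: mult.assoc hg_def)
      also have "\<dots> = a \<cdot> (p * y ^ Suc l)" by (simp add: al mult.assoc power_Suc2 del: power_Suc)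
      finally have "(1 / c) \<cdot> (c \<cdot> x) = (1 / c) \<cdot> (a \<cdot> (p * y ^ Suc l))" by simp
      then have "x = (1 / c * a) \<cdot> (p * y ^ Suc l)" using c0 by simp
      then show ?thesis by blast
    qed
  qed
  show thesis
  proof (rule that)
    show yK: "y \<in> alg K" "p * y = y" "y * p = y" using y(1) by (auto simp: hg_def)
    have ppow: "y ^ Suc k * y1 ^ Suc k = c ^ Suc k \<cdot> p" for k
    proof (induction k)
      case (Suc k)
      have "y ^ Suc (Suc k) * y1 ^ Suc (Suc k) = y ^ Suc k * (y * y1) * y1 ^ Suc k"
        by (simp only: power_Suc2[of y] power_Suc[of y1 "Suc k"] mult.assoc)
      also have "\<dots> = c \<cdot> (y ^ Suc k * y1 ^ Suc k)"
        by (simp add: c y1 flip: mult.assoc) (simp add: mult.assoc y1 assoc_rewrite[OF y1(2)])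
      finally show ?case using Suc by simp
    qed (simp add: c)
    have hgpow: "hg (j0 * Suc k) (y ^ Suc k)" for k
    proof (induction k)
      case (Suc k)
      define z where "z = y ^ Suc k"
      have z: "hg (j0 * Suc k) z" using Suc by (simp only: z_def)
      have "y * z \<in> alg K" "p * (y * z) = y * z" "(y * z) * p = y * z"
        using z y(1) fin unfolding hg_def by (simp_all add: alg_mult flip: mult.assoc) (simp add: mult.assoc)
      moreover have "\<theta> (y * z) = \<zeta> ^ (j0 + j0 * Suc k) \<cdot> (y * z)"
        using z y(1) by (simp add: hg_def twist_mult power_add mult.commute)
      ultimately have "hg (j0 * Suc (Suc k)) (y * z)" by (simp add: hg_def)
      then show ?case by (simp only: z_def power_Suc)
    qed (use y in simp)
    obtain k where k: "e = Suc k" using e by (cases e) auto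
    have "\<zeta> ^ (j0 * e) = 1" by (simp add: mult.commute[of j0] power_mult \<zeta>e)
    then have "hg 0 (y ^ e)" using hgpow[of k] by (simp add: hg_def k del: power_Suc)
    then obtain a where a: "y ^ e = a \<cdot> p" using hg0 by blast
    have "a \<noteq> 0"
    proof
      assume "a = 0"
      then have "c ^ e \<cdot> p = 0" using ppow[of k] a k by simp
      then show False using c0 pp(2) by (simp add: smul_eq_0_iff)
    qed
    with a show "\<exists>c. c \<noteq> 0 \<and> y ^ e = c \<cdot> p" by blast
    fix x assume x: "x \<in> alg K"
    define xc where "xc j = (\<Sum>g | g \<in> K \<and> \<omega> g = \<zeta> ^ j. lookup x g \<cdot> gr g)" for j
    have "hg j (p * xc j * p)" for j
    proof -
      have "xc j \<in> alg K" by (auto simp: xc_def intro!: alg_sum alg_smul)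
      moreover have "\<theta> (xc j) = \<zeta> ^ j \<cdot> xc j"
        unfolding xc_def twist_sum smul_sum by (intro sum.cong) (auto simp: twist_smul twist_gr mult.commute)
      ultimately show ?thesis using pK fin \<theta>p pp
        by (simp add: hg_def alg_mult twist_mult mult.assoc)
    qed
    then have "\<forall>j. \<exists>cl. p * xc j * p = fst cl \<cdot> (p * y ^ snd cl)"
      using poly by (metis fst_conv snd_conv)
    then obtain cl where "\<forall>j. p * xc j * p = fst (cl j) \<cdot> (p * y ^ snd (cl j))"
      by (rule choice[THEN exE])
    then have cl: "p * xc j * p = (fst \<circ> cl) j \<cdot> (p * y ^ (snd \<circ> cl) j)" for j by simp
    have "inj_on (\<lambda>j. \<zeta> ^ j) {..<e}"
    proof -
      have "inj_on (\<lambda>k. cis (2 * pi * real k / real e)) {..<e}"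
        using bij_betw_roots_unity[OF e] by (simp add: bij_betw_def)
      moreover have "\<zeta> ^ j = cis (2 * pi * real j / real e)" for j
        by (simp add: \<zeta>_def DeMoivre mult_ac)
      ultimately show ?thesis by simp
    qed
    then have disj: "\<forall>i\<in>{..<e}. \<forall>j\<in>{..<e}. i \<noteq> j \<longrightarrow> {g\<in>K. \<omega> g = \<zeta> ^ i} \<inter> {g\<in>K. \<omega> g = \<zeta> ^ j} = {}"
      by (auto simp: inj_on_def)
    have "x = (\<Sum>g\<in>K. lookup x g \<cdot> gr g)" by (rule alg_expand[OF finK x])
    also have "K = (\<Union>j<e. {g\<in>K. \<omega> g = \<zeta> ^ j})" using roots pow by auto
    also have "(\<Sum>g\<in>\<dots>. lookup x g \<cdot> gr g) = (\<Sum>j<e. xc j)"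
      unfolding xc_def using disj finK by (intro sum.UNION_disjoint) auto
    finally have "p * x * p = (\<Sum>j<e. p * xc j * p)"
      by (simp add: sum_distrib_left sum_distrib_right)
    then show "\<exists>c l. p * x * p = (\<Sum>j<e. c j \<cdot> (p * y ^ l j))"
      unfolding cl by blast
  qed
qed

text \<open>After rescaling the generator to \<open>y ^ e = p\<close>, the elements
  \<open>f k\<close> are its spectral projections. They add up to \<open>p\<close>, so one of them
  is nonzero; on it \<open>y\<close>, and with \<open>y\<close> the whole corner, acts by scalars.
  As all elements of the corner are polynomials in one element, they commute.\<close>

lemma primitive_refinement:
  assumes p: "primitive H p"
  obtains p1 where "primitive K p1" "p * p1 = p1" "p1 * p = p1"
    "\<And>x y. x \<in> alg K \<Longrightarrow> y \<in> alg K \<Longrightarrow> (p * x * p) * (p * y * p) = (p * y * p) * (p * x * p)"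
proof -
  note pp = primitiveD[OF p]
  have pK: "p \<in> alg K" using pp(1) by (rule alg_HK)
  obtain y0 where y0: "y0 \<in> alg K" "p * y0 = y0" "y0 * p = y0" "\<exists>c. c \<noteq> 0 \<and> y0 ^ e = c \<cdot> p"
    and gen0: "\<And>x. x \<in> alg K \<Longrightarrow> \<exists>c l. p * x * p = (\<Sum>j<e. c j \<cdot> (p * y0 ^ l j))"
    by (rule corner_generator[OF p]) (rule that, assumption+)
  obtain c where c: "c \<noteq> 0" "y0 ^ e = c \<cdot> p" using y0(4) by blast
  obtain s where s: "s ^ e = inverse c"
  proof -
    have "inverse c = rcis (cmod (inverse c)) (Arg (inverse c))" by (simp add: rcis_cmod_Arg)
    also have "\<dots> = exp (of_real (ln (cmod (inverse c))) + \<i> * of_real (Arg (inverse c)))"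
      using c by (simp add: exp_add rcis_def cis_conv_exp exp_of_real)
    finally obtain w where w: "inverse c = exp w" by blast
    have "exp (w / of_nat e) ^ e = exp w" using e by (simp flip: exp_of_nat_mult)
    then show ?thesis using that w by simp
  qed
  define y where "y = s \<cdot> y0"
  have ypow: "y ^ k = s ^ k \<cdot> y0 ^ k" for k by (induction k) (auto simp: y_def mult_ac)
  have y: "y \<in> alg K" "p * y = y" "y * p = y" "y ^ e = p"
    using y0 c s by (auto simp: y_def[symmetric] ypow) (auto simp: y_def alg_smul)
  have ypc: "p * y ^ k = y ^ k * p" for k
  proof (induction k)
    case (Suc k)
    have "p * (y * y ^ k) = y * (p * y ^ k)" by (simp add: y(2,3) flip: mult.assoc)
    then show ?case by (simp add: Suc mult.assoc)
  qed simp
  define \<zeta> where "\<zeta> = cis (2 * pi / e)"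
  have \<zeta>e: "\<zeta> ^ e = 1" using e by (simp add: \<zeta>_def DeMoivre)
  have \<zeta>1: "\<zeta> ^ l \<noteq> 1" if "0 < l" "l < e" for l
  proof
    have "inj_on (\<lambda>k. cis (2 * pi * real k / real e)) {..<e}"
      using bij_betw_roots_unity[OF e] by (simp add: bij_betw_def)
    moreover assume "\<zeta> ^ l = 1"
    then have "cis (2 * pi * real l / real e) = cis (2 * pi * real 0 / real e)"
      by (simp add: \<zeta>_def DeMoivre mult_ac)
    ultimately have "l = 0" using that by (intro inj_onD[of "\<lambda>k. cis (2 * pi * real k / real e)" "{..<e}" l 0]) auto
    then show False using that by simp
  qed
  define f where "f k = (1 / of_nat e) \<cdot> (\<Sum>l<e. (\<zeta> ^ k) ^ l \<cdot> (p * y ^ l))" for k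
  have "(\<Sum>k<e. f k) = (1 / of_nat e) \<cdot> (\<Sum>l<e. (\<Sum>k<e. (\<zeta> ^ l) ^ k) \<cdot> (p * y ^ l))"
    unfolding f_def smul_sum[symmetric] sum_smul
    by (subst sum.swap) (simp flip: power_mult add: mult.commute)
  also have "(\<Sum>l<e. (\<Sum>k<e. (\<zeta> ^ l) ^ k) \<cdot> (p * y ^ l)) = (\<Sum>l<e. if l = 0 then of_nat e \<cdot> p else 0)"
  proof (intro sum.cong refl)
    fix l assume l: "l \<in> {..<e}"
    show "(\<Sum>k<e. (\<zeta> ^ l) ^ k) \<cdot> (p * y ^ l) = (if l = 0 then of_nat e \<cdot> p else 0)"
    proof (cases "l = 0")
      case False
      have "(\<zeta> ^ l) ^ e = 1" using \<zeta>e by (metis mult.commute power_mult power_one)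
      then have "(\<Sum>k<e. (\<zeta> ^ l) ^ k) = 0" using \<zeta>1 l False by (intro sum_roots_unity) auto
      then show ?thesis using False by simp
    qed simp
  qed
  also have "\<dots> = of_nat e \<cdot> p" using e by (simp add: sum.delta)
  finally have "(\<Sum>k<e. f k) = p" using e by simp
  then obtain k where k: "f k \<noteq> 0" using pp(2) by (metis sum.neutral)
  define p1 where "p1 = f k"
  \<comment> \<open>The inverse of \<open>\<zeta> ^ k\<close>, which is the eigenvalue of
    \<open>y\<close> on the projection \<open>f k\<close>.\<close>
  define \<xi> where "\<xi> = \<zeta> ^ (k * (e - 1))"
  have \<xi>: "\<xi> * \<zeta> ^ k = 1"
  proof -
    have "\<xi> * \<zeta> ^ k = \<zeta> ^ (k * (e - 1) + k)" by (simp add: \<xi>_def power_add)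
    also have "k * (e - 1) + k = e * k" using e by (simp add: algebra_simps)
    finally show ?thesis by (simp add: power_mult \<zeta>e)
  qed
  have yp1: "y * p1 = \<xi> \<cdot> p1"
  proof -
    let ?g = "\<lambda>l. (\<zeta> ^ k) ^ l \<cdot> (p * y ^ l)"
    have "\<zeta> ^ k \<cdot> (y * (\<Sum>l<e. ?g l)) = (\<Sum>l<e. ?g (Suc l))"
      by (simp add: sum_distrib_left smul_sum y(2,3) flip: mult.assoc)
    also have "\<dots> = (\<Sum>l<e. ?g l) + ?g e - ?g 0"
      using sum.lessThan_Suc_shift[of ?g e] sum.lessThan_Suc[of ?g e] by (simp add: algebra_simps del: power_Suc)
    also have "?g e = ?g 0"
      using y(4) pp(3) by (simp flip: power_mult) (simp add: mult.commute[of k] power_mult \<zeta>e)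
    finally have "\<zeta> ^ k \<cdot> (y * (\<Sum>l<e. ?g l)) = (\<Sum>l<e. ?g l)" by simp
    from arg_cong[OF this, of "\<lambda>x. (1 / of_nat e) \<cdot> x"]
    have "\<zeta> ^ k \<cdot> (y * p1) = p1" by (simp add: p1_def f_def)
    then have "\<xi> \<cdot> (\<zeta> ^ k \<cdot> (y * p1)) = \<xi> \<cdot> p1" by simp
    then show ?thesis by (simp add: \<xi>)
  qed
  have pp1: "p * p1 = p1" "p1 * p = p1"
    using pp(3) by (auto simp: p1_def f_def sum_distrib_left sum_distrib_right ypc mult.assoc)
      (simp add: pp(3) flip: ypc)
  have ypow1: "y ^ l * p1 = \<xi> ^ l \<cdot> p1" for l
    by (induction l) (simp_all add: mult.assoc yp1 mult.commute)
  have y0p1: "\<exists>c. (p * y0 ^ l) * p1 = c \<cdot> p1" for l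
  proof -
    have "s \<noteq> 0" using s c e by (metis inverse_zero_imp_zero power_0_left neq0_conv)
    then have "y0 ^ l = inverse (s ^ l) \<cdot> y ^ l" by (simp add: ypow)
    then show ?thesis by (auto simp: mult.assoc ypow1 pp1)
  qed
  have lin: "\<exists>c. (p * x * p) * p1 = c \<cdot> p1" if x: "x \<in> alg K" for x
  proof -
    obtain c l where cl: "p * x * p = (\<Sum>j<e. c j \<cdot> (p * y0 ^ l j))" using gen0[OF x] by blast
    obtain a where a: "\<And>l. (p * y0 ^ l) * p1 = a l \<cdot> p1" using y0p1 by metis
    have "(p * x * p) * p1 = (\<Sum>j<e. (c j * a (l j)) \<cdot> p1)"
      by (simp add: cl sum_distrib_right a)
    then show ?thesis by (metis sum_smul)
  qed
  have powK: "y ^ l \<in> alg K" for l using y(1) fin by (induction l) (auto simp: alg_mult)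
  have p1K: "p1 \<in> alg K" unfolding p1_def f_def
    using pK powK fin by (intro alg_smul alg_sum alg_mult) auto
  have idem: "p1 * p1 = p1"
  proof -
    have "p1 * p1 = (1 / of_nat e) \<cdot> (\<Sum>l<e. (\<zeta> ^ k) ^ l \<cdot> (\<xi> ^ l \<cdot> p1))"
      by (subst (1) p1_def) (simp add: f_def sum_distrib_right mult.assoc ypow1 pp1)
    also have "\<dots> = (1 / of_nat e) \<cdot> (\<Sum>l<e. 1 \<cdot> p1)"
      using \<xi> by (simp add: mult.commute flip: power_mult_distrib)
    also have "\<dots> = p1" using e by (simp only: sum_smul[symmetric]) simp
    finally show ?thesis .
  qed
  show thesis
  proof (rule that)
    show "primitive K p1" unfolding primitive_def
    proof (intro conjI ballI p1K idem)
      show "p1 \<noteq> 0" using k by (simp add: p1_def)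
      fix x assume x: "x \<in> alg K"
      obtain c where c: "(p * x * p) * p1 = c \<cdot> p1" using lin[OF x] by blast
      have "p1 * x * p1 = p1 * ((p * x * p) * p1)"
        by (simp add: mult.assoc pp1 assoc_rewrite[OF pp1(2)])
      also have "\<dots> = c \<cdot> p1" by (simp add: c idem)
      finally show "\<exists>c. p1 * x * p1 = c \<cdot> p1" by blast
    qed
    show "p * p1 = p1" "p1 * p = p1" by (rule pp1)+
    fix x z assume "x \<in> alg K" "z \<in> alg K"
    then obtain c l c' l' where "p * x * p = (\<Sum>j<e. c j \<cdot> (p * y0 ^ l j))"
      "p * z * p = (\<Sum>j<e. c' j \<cdot> (p * y0 ^ l' j))" using gen0 by meson
    moreover have "(p * y0 ^ i) * (p * y0 ^ j) = (p * y0 ^ j) * (p * y0 ^ i)" for i j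
    proof -
      have y0pc: "p * y0 ^ k = y0 ^ k * p" for k
      proof (induction k)
        case (Suc k)
        have "p * (y0 * y0 ^ k) = y0 * (p * y0 ^ k)" by (simp add: y0(2,3) flip: mult.assoc)
        then show ?case by (simp add: Suc mult.assoc)
      qed simp
      have "(p * y0 ^ i) * (p * y0 ^ j) = p * y0 ^ (i + j)" for i j
      proof -
        have "(p * y0 ^ i) * (p * y0 ^ j) = p * ((y0 ^ i * p) * y0 ^ j)" by (simp add: mult.assoc)
        also have "\<dots> = p * (p * (y0 ^ i * y0 ^ j))" by (simp only: y0pc[symmetric] mult.assoc)
        also have "\<dots> = p * y0 ^ (i + j)" by (simp add: pp(3) power_add)
        finally show ?thesis .
      qed
      then show ?thesis by (simp add: add.commute)
    qed
    then have "(a \<cdot> (p * y0 ^ i)) * (b \<cdot> (p * y0 ^ j)) = (b \<cdot> (p * y0 ^ j)) * (a \<cdot> (p * y0 ^ i))" for a b i j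
      by (simp only: smul_simps mult_smul mult.commute[of a b])
    ultimately show "(p * x * p) * (p * z * p) = (p * z * p) * (p * x * p)"
      by (simp only: sum_product) (rule sum.swap)
  qed
qed

text \<open>All twists of \<open>p1\<close> lie in the commutative corner of \<open>p\<close>, which
  makes distinct ones orthogonal. Their sum is invariant under the twist, hence a multiple of
  \<open>p\<close>, and multiplication by \<open>p1\<close> shows that the factor is 1. Coinciding
  twists must count once, so the sum runs over the image and not over the exponents.\<close>

lemma primitive_orbit:
  assumes p: "primitive H p"
  obtains p1 where "primitive K p1" "p * p1 = p1" "p1 * p = p1"
    "\<And>i j x. x \<in> alg K \<Longrightarrow> (\<theta> ^^ i) p1 \<noteq> (\<theta> ^^ j) p1 \<Longrightarrow> (\<theta> ^^ i) p1 * x * (\<theta> ^^ j) p1 = 0"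
    "p = \<Sum>((\<lambda>j. (\<theta> ^^ j) p1) ` {..<e})"
proof -
  note pp = primitiveD[OF p]
  obtain p1 where p1: "primitive K p1" "p * p1 = p1" "p1 * p = p1"
    and comm: "\<And>x y. x \<in> alg K \<Longrightarrow> y \<in> alg K \<Longrightarrow> (p * x * p) * (p * y * p) = (p * y * p) * (p * x * p)"
    by (rule primitive_refinement[OF p]) (rule that, assumption+)
  define f where "f j = (\<theta> ^^ j) p1" for j
  have f: "primitive K (f j)" for j unfolding f_def by (rule twist_pow_primitive[OF p1(1)])
  note ff = primitiveD[OF f]
  have pf: "p * f j = f j" "f j * p = f j" for j
    using p1(2,3) twist_pow_H[OF pp(1), of j] by (metis f_def twist_pow_mult)+
  have fcomm: "(p * x * p) * f j = f j * (p * x * p)" if "x \<in> alg K" for x j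
    using comm[OF that ff(1)[of j]] by (simp add: pf)
  have orth: "f i * x * f j = 0" if ne: "f i \<noteq> f j" and x: "x \<in> alg K" for i j x
  proof -
    have cf: "f i * f j = f j * f i" using fcomm[OF ff(1)[of i], of j] by (simp add: pf)
    obtain c where c: "f i * f j * f i = c \<cdot> f i" using ff(4)[OF ff(1)] by blast
    obtain c' where c': "f j * f i * f j = c' \<cdot> f j" using ff(4)[OF ff(1)] by blast
    have 1: "f i * f j = c \<cdot> f i" using c by (simp add: mult.assoc flip: cf) (simp add: ff(3))
    have 2: "f i * f j = c' \<cdot> f j" using c' by (simp add: ff(3) mult.assoc flip: cf)
    have "f i * f j = 0"
    proof (rule ccontr)
      assume nz: "f i * f j \<noteq> 0"
      have "(f i * f j) * f j = f i * f j" by (simp add: ff(3) mult.assoc)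
      then have "c \<cdot> (c \<cdot> f i) = c \<cdot> f i" by (simp add: 1)
      then have "c * c = c" using ff(2)[of i] by (simp add: smul_cancel_right)
      moreover have "c \<noteq> 0" using nz 1 by auto
      ultimately have c1: "c = 1" by simp
      have "f i * (f i * f j) = f i * f j" by (simp add: ff(3))
      then have "c' \<cdot> (c' \<cdot> f j) = c' \<cdot> f j" by (simp add: 2)
      then have "c' * c' = c'" using ff(2)[of j] by (simp add: smul_cancel_right)
      moreover have "c' \<noteq> 0" using nz 2 by auto
      ultimately have "c' = 1" by simp
      with c1 1 2 ne show False by simp
    qed
    moreover have "f i * x * f j = f i * ((p * x * p) * f j)"
      by (simp add: mult.assoc pf assoc_rewrite[OF pf(2)])
    ultimately show ?thesis by (simp add: fcomm[OF x] flip: mult.assoc)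
  qed
  define S where "S = f ` {..<e}"
  have S: "finite S" "S \<noteq> {}" using e by (auto simp: S_def)
  have \<theta>f: "\<theta> (f j) = f (Suc j)" for j by (simp add: f_def)
  have fmod: "f j = f (j mod e)" for j
    unfolding f_def using primitiveD(1)[OF p1(1)] by (intro twist_pow_cong) auto
  have fS: "f j \<in> S" for j using fmod[of j] e by (auto simp: S_def)
  have \<theta>S: "\<theta> ` S = S"
  proof
    show "\<theta> ` S \<subseteq> S" using fS by (auto simp: \<theta>f S_def)
    show "S \<subseteq> \<theta> ` S"
    proof
      fix x assume "x \<in> S"
      then obtain j where j: "x = f j" by (auto simp: S_def)
      have "f j = f (Suc (j + (e - 1)))" using fmod[of j] fmod[of "Suc (j + (e - 1))"] e by simp
      then show "x \<in> \<theta> ` S" using fS j by (metis \<theta>f image_eqI)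
    qed
  qed
  have "inj_on \<theta> S" by (rule eq_card_imp_inj_on) (use S \<theta>S in auto)
  then have "sum (\<lambda>x. x) (\<theta> ` S) = sum \<theta> S"
    by (simp add: sum.reindex)
  then have "\<theta> (\<Sum>S) = \<Sum>S" unfolding \<theta>S twist_sum by (rule sym)
  moreover have "\<Sum>S \<in> alg K" using ff(1) by (intro alg_sum) (auto simp: S_def)
  ultimately have "\<Sum>S \<in> alg H" by (simp add: alg_H_iff)
  then obtain c where "p * \<Sum>S * p = c \<cdot> p" using pp(4) by blast
  moreover have "p * \<Sum>S * p = \<Sum>S"
    unfolding sum_distrib_left sum_distrib_right by (intro sum.cong) (auto simp: S_def pf)
  ultimately have Sc: "\<Sum>S = c \<cdot> p" by simp
  have "f 0 * \<Sum>S = (\<Sum>x\<in>S. if x = f 0 then f 0 else 0)"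
    unfolding sum_distrib_left
  proof (intro sum.cong refl)
    fix x assume "x \<in> S"
    then obtain j where "x = f j" by (auto simp: S_def)
    then show "f 0 * x = (if x = f 0 then f 0 else 0)"
      using orth[of 0 j 1] fin by (auto simp: ff(3))
  qed
  also have "\<dots> = f 0" using S fS[of 0] by simp
  finally have "c \<cdot> f 0 = 1 \<cdot> f 0" by (simp add: Sc pf)
  then have "c = 1" using ff(2)[of 0] unfolding smul_cancel_right by simp
  then have "p = \<Sum>S" using Sc by simp
  with that[of p1] p1 orth show thesis unfolding S_def f_def by blast
qed

end

subsection \<open>Periodic functions differing at one residue\<close>

text \<open>The orbits of the shift modulo \<open>m\<close> are cycles. If \<open>G\<close> is
  constant along every step of a cycle except the one that arrives at \<open>a\<close>, the
  remaining steps already connect all its points.\<close>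

lemma shift_invariant_of_almost:
  fixes G :: "int \<Rightarrow> 'b"
  assumes per: "\<And>x y. [x = y] (mod m) \<Longrightarrow> G x = G y" and m: "m > 0"
    and step: "\<And>x. \<not> [x + s = a] (mod m) \<Longrightarrow> G (x + s) = G x"
  shows "G (x + s) = G x"
proof (cases "[x + s = a] (mod m)")
  case True
  have *: "G (a + int j * s) = G a" for j
  proof (induction j)
    case (Suc j)
    have "G (a + int j * s + s) = G a"
      using step[of "a + int j * s"] per[of "a + int j * s + s" a] Suc by metis
    then show ?case by (simp add: algebra_simps)
  qed simp
  \<comment> \<open>The forbidden step leads from \<open>x\<close> to \<open>a\<close>; the other
    \<open>m - 1\<close> steps lead back from \<open>a\<close> to \<open>x\<close>.\<close>
  have "[x = a + int (nat (m - 1)) * s] (mod m)"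
  proof -
    have "[x + s - s + m * s = a - s + m * s] (mod m)"
      using True by (intro cong_add cong_diff cong_refl)
    moreover have "[x + s - s + m * s = x] (mod m)" by (simp add: cong_def)
    ultimately have "[x = a - s + m * s] (mod m)" using cong_sym cong_trans by blast
    then show ?thesis using m by (simp add: algebra_simps)
  qed
  then have "G x = G a" using per * by metis
  then show ?thesis using per True by metis
qed (rule step)

text \<open>The three functions are obtained from \<open>F\<close> by removing a box at \<open>a\<close>, \<open>b\<close>, \<open>c\<close>; here
  \<open>\<phi>\<close> is the number of boxes at a residue, the only feature of the values that is counted.\<close>

lemma necklace_trichotomy:
  fixes F F1 F2 F3 :: "int \<Rightarrow> 'b" and \<phi> :: "'b \<Rightarrow> complex"
  assumes m: "m > 0"
    and per: "\<And>x y. [x = y] (mod m) \<Longrightarrow> F x = F y" "\<And>x y. [x = y] (mod m) \<Longrightarrow> F1 x = F1 y"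
    and F1: "\<And>x. \<not> [x = a] (mod m) \<Longrightarrow> F1 x = F x" "\<And>x. [x = a] (mod m) \<Longrightarrow> \<phi> (F1 x) = \<phi> (F x) - 1"
    and F2: "\<And>x. \<not> [x = b] (mod m) \<Longrightarrow> F2 x = F x" "\<And>x. [x = b] (mod m) \<Longrightarrow> \<phi> (F2 x) = \<phi> (F x) - 1"
    and F3: "\<And>x. \<not> [x = c] (mod m) \<Longrightarrow> F3 x = F x" "\<And>x. [x = c] (mod m) \<Longrightarrow> \<phi> (F3 x) = \<phi> (F x) - 1"
    and s: "\<And>x. F1 x = F2 (x + s)" and t: "\<And>x. F1 x = F3 (x + t)"
  shows "[s = t] (mod m) \<or> F1 = F2 \<or> (\<forall>x. F (x + t) = F x)"
proof -
  consider "[a = b] (mod m)" | "[c = a + t] (mod m)"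
    | "\<not> [a = b] (mod m)" "\<not> [c = a + t] (mod m)" by blast
  then show ?thesis
  proof cases
    case 1
    then have ab: "[x = a] (mod m) \<longleftrightarrow> [x = b] (mod m)" for x
      using cong_trans cong_sym by blast
    \<comment> \<open>Away from the common residue \<open>F1\<close> and \<open>F2\<close> both
      agree with \<open>F\<close>, so the rotation by \<open>s\<close> turns into an
      almost-invariance of \<open>F1\<close>.\<close>
    have "F1 (x + s) = F1 x" for x
    proof (rule shift_invariant_of_almost[where a = a, OF per(2) m])
      fix x assume "\<not> [x + s = a] (mod m)"
      then show "F1 (x + s) = F1 x" using F1(1) F2(1) s ab by metis
    qed auto
    then have "F1 = F2" using s by (metis diff_add_cancel ext)
    then show ?thesis by simp
  next
    case 2
    \<comment> \<open>The rotation by \<open>t\<close> carries the removed box of \<open>F1\<close>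
      to that of \<open>F3\<close>. At all other residues both functions are \<open>F\<close>
      itself.\<close>
    have "F (x + t) = F x" for x
    proof (rule shift_invariant_of_almost[where a = "a + t", OF per(1) m])
      fix x assume x: "\<not> [x + t = a + t] (mod m)"
      then have "\<not> [x = a] (mod m)" by (simp add: cong_add_rcancel)
      moreover have "\<not> [x + t = c] (mod m)" using x 2 cong_trans by blast
      ultimately show "F (x + t) = F x" using F1(1) F3(1) t by metis
    qed auto
    then show ?thesis by simp
  next
    case 3
    define \<delta> :: "int \<Rightarrow> int \<Rightarrow> complex" where "\<delta> x y = (if [x = y] (mod m) then 1 else 0)" for x y
    define f where "f x = \<phi> (F x)" for x
    have f1: "\<phi> (F1 x) = f x - \<delta> x a" for x using F1[of x] by (auto simp: f_def \<delta>_def)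
    have f2: "\<phi> (F2 x) = f x - \<delta> x b" for x using F2[of x] by (auto simp: f_def \<delta>_def)
    have f3: "\<phi> (F3 x) = f x - \<delta> x c" for x using F3[of x] by (auto simp: f_def \<delta>_def)
    have s': "f x - \<delta> x a = f (x + s) - \<delta> (x + s) b" for x
      using s[of x] f1[of x] f2[of "x + s"] by simp
    have t': "f x - \<delta> x a = f (x + t) - \<delta> (x + t) c" for x
      using t[of x] f1[of x] f3[of "x + t"] by simp
    \<comment> \<open>The points \<open>a - s\<close>, \<open>a\<close>, \<open>a - s + t\<close>
      and \<open>a + t\<close> form a parallelogram. Following \<open>f\<close> from
      \<open>a - s\<close> to \<open>a + t\<close> along its two paths gives an identity in which
      \<open>f\<close> cancels and only positions of boxes remain.\<close>
    have e1: "f (a - s) = \<delta> (a - s) a + (f a - \<delta> a b)"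
      using s'[of "a - s"] by (simp add: algebra_simps)
    have e2: "f a = \<delta> a a + (f (a + t) - \<delta> (a + t) c)"
      using t'[of a] by (simp add: algebra_simps)
    have e3: "f (a - s) = \<delta> (a - s) a + (f (a - s + t) - \<delta> (a - s + t) c)"
      using t'[of "a - s"] by (simp add: algebra_simps)
    have e4: "f (a - s + t) = \<delta> (a - s + t) a + (f (a + t) - \<delta> (a + t) b)"
      using s'[of "a - s + t"] by (simp add: algebra_simps)
    have "\<delta> (a - s) a + (\<delta> a a + (f (a + t) - \<delta> (a + t) c) - \<delta> a b)
        = \<delta> (a - s) a + (\<delta> (a - s + t) a + (f (a + t) - \<delta> (a + t) b) - \<delta> (a - s + t) c)"
      unfolding e2[symmetric] e4[symmetric] using e1 e3 by simp
    then have eq: "\<delta> a a - \<delta> (a + t) c - \<delta> a b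
        = \<delta> (a - s + t) a - \<delta> (a + t) b - \<delta> (a - s + t) c"
      by (simp add: algebra_simps)
    have "\<delta> a b = 0" "\<delta> (a + t) c = 0" "\<delta> a a = 1"
      using 3 by (auto simp: \<delta>_def cong_sym_eq)
    \<comment> \<open>Only the first of the three terms can contribute positively, so it equals 1,
      which means \<open>s\<close> and \<open>t\<close> agree modulo \<open>m\<close>.\<close>
    then have "1 = \<delta> (a - s + t) a - \<delta> (a - s + t) c - \<delta> (a + t) b" using eq by (simp add: algebra_simps)
    then have "[a - s + t = a] (mod m)"
      by (auto simp: \<delta>_def split: if_splits)
    then have "[a - s + t + (s - a) = a + (s - a)] (mod m)" by (rule cong_add) simp
    then show ?thesis by (simp add: cong_sym_eq)
  qed
qed

subsection \<open>The branching argument\<close>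

text \<open>The cross product of the coefficient vectors solves both equations. If it vanishes, they
  are proportional, and a vector orthogonal to a nonzero one of them in the first two coordinates,
  or the first unit vector, takes over.\<close>

lemma two_linear_equations:
  fixes u w :: "nat \<Rightarrow> complex"
  shows "\<exists>c. (\<exists>i<3. c i \<noteq> 0) \<and> (\<Sum>i<3. c i * u i) = 0 \<and> (\<Sum>i<3. c i * w i) = 0"
proof -
  define c1 where "c1 = (\<lambda>i::nat. if i = 0 then u 1 * w 2 - u 2 * w 1
    else if i = 1 then u 2 * w 0 - u 0 * w 2 else u 0 * w 1 - u 1 * w 0)"
  have s3: "(\<Sum>i<3. g i) = g 0 + g 1 + g 2" for g :: "nat \<Rightarrow> complex"
    by (simp add: numeral_3_eq_3 numeral_2_eq_2)
  show ?thesis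
  proof (cases "\<exists>i<3. c1 i \<noteq> 0")
    case True
    then show ?thesis by (intro exI[of _ c1]) (simp add: s3, simp add: c1_def algebra_simps)
  next
    case False
    then have z: "u 1 * w 2 = u 2 * w 1" "u 2 * w 0 = u 0 * w 2" "u 0 * w 1 = u 1 * w 0"
      by (auto simp: c1_def dest: spec[of _ 0] spec[of _ "1::nat"] spec[of _ "2::nat"])
    consider "u 0 \<noteq> 0 \<or> u 1 \<noteq> 0" | "w 0 \<noteq> 0 \<or> w 1 \<noteq> 0" | "u 0 = 0" "u 1 = 0" "w 0 = 0" "w 1 = 0"
      by blast
    then show ?thesis
    proof cases
      case 1
      then show ?thesis using z
        by (intro exI[of _ "\<lambda>i. if i = 0 then u 1 else if i = 1 then - u 0 else 0"])
          (auto simp: s3 mult.commute intro: exI[of _ 0] exI[of _ 1])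
    next
      case 2
      then show ?thesis using z
        by (intro exI[of _ "\<lambda>i. if i = 0 then w 1 else if i = 1 then - w 0 else 0"])
          (auto simp: s3 mult.commute intro: exI[of _ 0] exI[of _ 1])
    next
      case 3
      then show ?thesis by (intro exI[of _ "\<lambda>i. if i = 0 then 1 else 0"]) (auto simp: s3)
    qed
  qed
qed

text \<open>The interface between group and combinatorics. The eigenvalues of the central elements
  \<open>z x c\<close> and \<open>z' x c\<close>, for all \<open>c\<close>, describe the component
  at the residue \<open>x\<close>, and \<open>c0\<close> is the index that counts boxes. The
  elements \<open>E a\<close> decompose the unit by the residue \<open>a\<close> of the box that is
  lost: on this part only the component at \<open>a\<close> changes. Residues are integers, so that
  rotations are plain additions.\<close>

locale branching =
  big: graded_group K \<omega> e + small: graded_group K' \<omega> e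
  for K K' :: "'g::group_add set" and \<omega> e +
  fixes d m :: nat and z z' :: "int \<Rightarrow> 'c \<Rightarrow> 'g galg" and E :: "int \<Rightarrow> 'g galg" and c0 :: 'c
  assumes sub: "K' \<subseteq> K" and m: "m = d * e" and d: "d > 0"
    and gelfand: "\<And>x y. x \<in> alg K \<Longrightarrow> x \<in> commutant K' \<Longrightarrow> y \<in> alg K \<Longrightarrow> y \<in> commutant K' \<Longrightarrow> x * y = y * x"
    and z: "z x c \<in> alg K" "z x c \<in> commutant K" and z': "z' x c \<in> alg K'" "z' x c \<in> commutant K'"
    and E: "E a \<in> alg K" "E a \<in> commutant K'" and E_sum: "(\<Sum>a<m. E (int a)) = 1"
    and per: "[x = y] (mod int m) \<Longrightarrow> z x c = z y c" "[x = y] (mod int m) \<Longrightarrow> z' x c = z' y c"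
    and diff: "\<not> [x = a] (mod int m) \<Longrightarrow> (z x c - z' x c) * E a = 0"
    and diff0: "[x = a] (mod int m) \<Longrightarrow> (z x c0 - z' x c0) * E a = E a"
    and tw: "twist \<omega> (z (x + int d) c) = z x c" "twist \<omega> (z' (x + int d) c) = z' x c"
    and sep: "primitive K q \<Longrightarrow> primitive K q' \<Longrightarrow>
      (\<And>x c. \<exists>s. z x c * q = s \<cdot> q \<and> z x c * q' = s \<cdot> q') \<Longrightarrow> \<exists>x\<in>alg K. q * x * q' \<noteq> 0"
    and sep': "primitive K' p \<Longrightarrow> primitive K' p' \<Longrightarrow>
      (\<And>x c. \<exists>s. z' x c * p = s \<cdot> p \<and> z' x c * p' = s \<cdot> p') \<Longrightarrow> \<exists>x\<in>alg K'. p * x * p' \<noteq> 0"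
begin

lemma central_eigenvalue:
  assumes "finite_subgroup L" "primitive L p" "x \<in> alg L" "x \<in> commutant L"
  shows "\<exists>s. x * p = s \<cdot> p"
proof -
  note pp = primitiveD[OF assms(2)]
  have "x * p = p * x"
    using commutant_alg[OF assms(4)] assms(1) pp(1) by (simp add: finite_subgroup_def)
  then have "p * x * p = x * p" by (simp add: mult.assoc pp(3) flip: \<open>x * p = p * x\<close>) 
  then show ?thesis using pp(4)[OF assms(3)] by metis
qed

lemma twist_pow_z: "(twist \<omega> ^^ j) (z (x + int j * int d) c) = z x c"
proof (induction j arbitrary: x)
  case (Suc j)
  have "(twist \<omega> ^^ Suc j) (z (x + int (Suc j) * int d) c)
      = twist \<omega> ((twist \<omega> ^^ j) (z ((x + int d) + int j * int d) c))"
    by (simp add: algebra_simps)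
  then show ?case by (simp add: Suc tw)
qed simp

lemma twist_pow_z': "(twist \<omega> ^^ j) (z' (x + int j * int d) c) = z' x c"
proof (induction j arbitrary: x)
  case (Suc j)
  have "(twist \<omega> ^^ Suc j) (z' (x + int (Suc j) * int d) c)
      = twist \<omega> ((twist \<omega> ^^ j) (z' ((x + int d) + int j * int d) c))"
    by (simp add: algebra_simps)
  then show ?case by (simp add: Suc tw)
qed simp

text \<open>Two linear conditions leave a nontrivial combination \<open>V\<close> of three elements.
  Each \<open>P j * w i\<close> lies on a line depending on \<open>j\<close> only, so vanishing of
  \<open>P j * (V * q1)\<close> is a single condition. The element \<open>V\<close> is fixed by the
  twist, so the condition for one \<open>j\<close> implies it for every index related to
  \<open>j\<close> by a power of the twist that fixes \<open>q1\<close>. Hence two conditions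
  suffice if two indices represent all contributing classes. Finally \<open>V * q1 = 0\<close>
  forces \<open>V = 0\<close>, since a nonzero \<open>V\<close> has a left inverse relative to
  \<open>q\<close>.\<close>

lemma three_dependent:
  fixes v :: "nat \<Rightarrow> 'g galg"
  assumes p: "primitive small.H p" and q: "primitive big.H q"
    and v: "\<And>i. v i \<in> alg big.H" "\<And>i. p * v i = v i" "\<And>i. v i * q = v i"
  shows "\<exists>c. (\<exists>i<3. c i \<noteq> 0) \<and> (\<Sum>i<3. c i \<cdot> v i) = 0"
proof -
  note \<theta> = big.twist_pow_mult
  let ?t = "\<lambda>j. twist \<omega> ^^ j"
  obtain q1 where q1: "primitive K q1" "q * q1 = q1" "q1 * q = q1"
    "\<And>i j x. x \<in> alg K \<Longrightarrow> ?t i q1 \<noteq> ?t j q1 \<Longrightarrow> ?t i q1 * x * ?t j q1 = 0"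
    "q = \<Sum>((\<lambda>j. ?t j q1) ` {..<e})"
    by (rule big.primitive_orbit[OF q]) (rule that, assumption+)
  obtain p1 where p1: "primitive K' p1" "p * p1 = p1" "p1 * p = p1"
    "\<And>i j x. x \<in> alg K' \<Longrightarrow> ?t i p1 \<noteq> ?t j p1 \<Longrightarrow> ?t i p1 * x * ?t j p1 = 0"
    "p = \<Sum>((\<lambda>j. ?t j p1) ` {..<e})"
    by (rule small.primitive_orbit[OF p]) (rule that, assumption+)
  define P where "P j = ?t j p1" for j
  have P: "primitive K' (P j)" for j unfolding P_def by (rule small.twist_pow_primitive[OF p1(1)])
  note PP = primitiveD[OF P]
  note qq = primitiveD[OF q1(1)]
  have PK: "P j \<in> alg K" for j using PP(1) sub by (rule alg_mono[rotated])
  obtain F where F: "\<And>x c. z x c * q1 = F x c \<cdot> q1"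
    using central_eigenvalue[OF big.fin q1(1) z] by metis
  obtain G where G: "\<And>x c. z' x c * p1 = G x c \<cdot> p1"
    using central_eigenvalue[OF small.fin p1(1) z'] by metis
  have GP: "z' x c * P j = G (x + int j * int d) c \<cdot> P j" for x c j
    using arg_cong[OF G[of "x + int j * int d" c], of "?t j"]
    by (simp add: \<theta> big.twist_pow_smul twist_pow_z' P_def)
  have Fq: "z x c * ?t j q1 = F (x + int j * int d) c \<cdot> ?t j q1" for x c j
    using arg_cong[OF F[of "x + int j * int d" c], of "?t j"]
    by (simp add: \<theta> big.twist_pow_smul twist_pow_z)
  have perF: "F x = F y" if "[x = y] (mod int m)" for x y
  proof
    fix c show "F x c = F y c"
      using F[of x c] F[of y c] per(1)[OF that, of c] qq(2) by (simp add: smul_cancel_right)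
  qed
  have perG: "G x = G y" if "[x = y] (mod int m)" for x y
  proof
    fix c show "G x c = G y c"
      using G[of x c] G[of y c] per(2)[OF that, of c] primitiveD(2)[OF p1(1)] by (simp add: smul_cancel_right)
  qed
  define S where "S = {j. \<exists>x\<in>alg K. P j * x * q1 \<noteq> 0}"
  define FP where "FP j x = G (x + int j * int d)" for j x
  \<comment> \<open>As the \<open>E a\<close> add up to 1, some
    \<open>u = E a * (P j * y * q1)\<close> is nonzero. It is an eigenvector of all
    \<open>z x c\<close> with the eigenvalues of \<open>q1\<close> and of all \<open>z' x c\<close>
    with those of \<open>P j\<close>, so the relations between these elements and \<open>E a\<close>
    become relations between eigenvalues.\<close>
  have removal: "\<exists>a. (\<forall>x. \<not> [x = a] (mod int m) \<longrightarrow> FP j x = F x) \<and>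
      (\<forall>x. [x = a] (mod int m) \<longrightarrow> FP j x c0 = F x c0 - 1)" if "j \<in> S" for j
  proof -
    obtain y where y: "y \<in> alg K" "P j * y * q1 \<noteq> 0" using \<open>j \<in> S\<close> by (auto simp: S_def)
    have "(\<Sum>a<m. E (int a) * (P j * y * q1)) = P j * y * q1"
      by (simp add: E_sum flip: sum_distrib_right)
    then obtain a where a: "E (int a) * (P j * y * q1) \<noteq> 0" using y(2) by (metis sum.neutral)
    define u where "u = E (int a) * (P j * y * q1)"
    have zu: "z x c * u = F x c \<cdot> u" for x c
    proof -
      define W where "W = E (int a) * (P j * y)"
      have uW: "u = W * q1" by (simp add: u_def W_def mult.assoc)
      have "W \<in> alg K" unfolding W_def by (intro alg_mult big.fin E PK y)
      then have "z x c * W = W * z x c" using commutant_alg[OF z(2) big.finK] by blast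
      then have "z x c * u = W * (z x c * q1)" by (simp add: uW flip: mult.assoc)
      then show ?thesis by (simp add: F uW)
    qed
    have z'u: "z' x c * u = FP j x c \<cdot> u" for x c
    proof -
      have "E (int a) * z' x c = z' x c * E (int a)"
        by (rule commutant_alg[OF E(2) small.finK z'(1)])
      then have "z' x c * u = E (int a) * ((z' x c * P j) * y * q1)"
        by (simp add: u_def flip: mult.assoc)
      then show ?thesis by (simp add: GP u_def FP_def)
    qed
    have zE: "(z x c - z' x c) * u = ((z x c - z' x c) * E (int a)) * (P j * y * q1)" for x c
      by (simp add: u_def mult.assoc)
    have zd: "(z x c - z' x c) * u = (F x c - FP j x c) \<cdot> u" for x c
      by (simp add: left_diff_distrib zu z'u smul_diff_left)
    have u: "u \<noteq> 0" using a by (simp add: u_def)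
    show ?thesis
    proof (intro exI[of _ "int a"] conjI allI impI)
      fix x assume "\<not> [x = int a] (mod int m)"
      then have "(F x c - FP j x c) \<cdot> u = 0" for c
        using zE[of x c] zd[of x c] diff by simp
      then show "FP j x = F x" using u by (auto simp: smul_eq_0_iff)
    next
      fix x assume "[x = int a] (mod int m)"
      then have "(F x c0 - FP j x c0) \<cdot> u = 1 \<cdot> u"
        using zE[of x c0] zd[of x c0] diff0 by (simp add: u_def)
      then show "FP j x c0 = F x c0 - 1" using u unfolding smul_cancel_right by (simp add: algebra_simps)
    qed
  qed
  have Pmod: "P i = P j" if "[i = j] (mod e)" for i j
    unfolding P_def using that primitiveD(1)[OF p1(1)] by (intro small.twist_pow_cong) (auto simp: cong_def)
  have FP_eq: "P i = P j" if "FP i = FP j" for i j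
  proof (rule ccontr)
    assume "P i \<noteq> P j"
    then have "P i * x * P j = 0" if "x \<in> alg K'" for x using p1(4)[OF that] by (simp add: P_def)
    moreover have "\<exists>x\<in>alg K'. P i * x * P j \<noteq> 0"
    proof (rule sep'[OF P P])
      fix x c
      show "\<exists>s. z' x c * P i = s \<cdot> P i \<and> z' x c * P j = s \<cdot> P j"
        using GP[of x c i] GP[of x c j] fun_cong[OF that, of x] by (auto simp: FP_def)
    qed
    ultimately show False by blast
  qed
  have F_inv: "?t j q1 = q1" if "\<And>x. F (x + int j * int d) = F x" for j
  proof (rule ccontr)
    assume "?t j q1 \<noteq> q1"
    then have "q1 * x * ?t j q1 = 0" if "x \<in> alg K" for x
      using q1(4)[OF that, of 0 j] by simp
    moreover have "\<exists>x\<in>alg K. q1 * x * ?t j q1 \<noteq> 0"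
    proof (rule sep[OF q1(1) big.twist_pow_primitive[OF q1(1)]])
      fix x c
      show "\<exists>s. z x c * q1 = s \<cdot> q1 \<and> z x c * ?t j q1 = s \<cdot> ?t j q1"
        using F[of x c] Fq[of x c j] that[of x] by auto
    qed
    ultimately show False by blast
  qed
  \<comment> \<open>Equivalence under the powers of the twist that fix \<open>q1\<close>. It is this
    relation, not equality, that has at most two classes on \<open>S\<close>.\<close>
  define rel where "rel i j \<longleftrightarrow> (\<exists>k. ?t k (P i) = P j \<and> ?t k q1 = q1)" for i j
  have tri: "P j = P k \<or> P i = P j \<or> rel k i" if ijk: "i \<in> S" "j \<in> S" "k \<in> S" for i j k
  proof -
    obtain a where a: "\<forall>x. \<not> [x = a] (mod int m) \<longrightarrow> FP i x = F x"
      "\<forall>x. [x = a] (mod int m) \<longrightarrow> FP i x c0 = F x c0 - 1" using removal[OF ijk(1)] by blast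
    obtain b where b: "\<forall>x. \<not> [x = b] (mod int m) \<longrightarrow> FP j x = F x"
      "\<forall>x. [x = b] (mod int m) \<longrightarrow> FP j x c0 = F x c0 - 1" using removal[OF ijk(2)] by blast
    obtain c where c: "\<forall>x. \<not> [x = c] (mod int m) \<longrightarrow> FP k x = F x"
      "\<forall>x. [x = c] (mod int m) \<longrightarrow> FP k x c0 = F x c0 - 1" using removal[OF ijk(3)] by blast
    define s where "s = (int i - int j) * int d"
    define t where "t = (int i - int k) * int d"
    have "[s = t] (mod int m) \<or> FP i = FP j \<or> (\<forall>x. F (x + t) = F x)"
    proof (rule necklace_trichotomy[where \<phi> = "\<lambda>h. h c0" and a = a and b = b and c = c])
      show "int m > 0" using m d big.e by simp
      show "FP i x = FP i y" if "[x = y] (mod int m)" for x y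
        unfolding FP_def using that by (intro perG cong_add) auto
      show "FP i x = FP j (x + s)" "FP i x = FP k (x + t)" for x
        by (simp_all add: FP_def s_def t_def algebra_simps)
    qed (use a b c perF in blast)+
    then consider "[s = t] (mod int m)" | "FP i = FP j" | "\<forall>x. F (x + t) = F x" by blast
    then show ?thesis
    proof cases
      case 1
      then have "int e * int d dvd (int k - int j) * int d"
        by (simp add: cong_iff_dvd_diff m s_def t_def algebra_simps)
      then have "int e dvd int k - int j" using d by (simp add: dvd_times_right_cancel_iff)
      then have "[k = j] (mod e)" by (simp add: cong_iff_dvd_diff flip: cong_int_iff)
      then show ?thesis using Pmod by metis
    next
      case 2
      then show ?thesis using FP_eq by blast
    next
      case 3
      \<comment> \<open>A natural number congruent to \<open>i - k\<close> modulo \<open>e\<close>,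
        since exponents of the twist cannot be negative.\<close>
      define l where "l = i + (e - 1) * k"
      have "int l = (int i - int k) + int e * int k" using big.e by (cases e) (simp_all add: l_def algebra_simps)
      then have "x + int l * int d = (x + t) + int m * int k" for x
        by (simp only: t_def m of_nat_mult) (simp add: algebra_simps)
      then have "F (x + int l * int d) = F (x + t)" for x
        by (intro perF) (simp only: cong_def mod_mult_self2)
      then have "?t l q1 = q1" using 3 by (intro F_inv) simp
      moreover have "?t l (P k) = P i"
      proof -
        have "?t l (P k) = P (l + k)" by (simp add: P_def funpow_add)
        also have "l + k = i + e * k" using big.e by (cases e) (simp_all add: l_def)
        also have "P (i + e * k) = P i" by (intro Pmod) (simp add: cong_def)
        finally show ?thesis .
      qed
      ultimately show ?thesis unfolding rel_def by blast
    qed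
  qed
  have refl_rel: "rel i j" if "P i = P j" for i j
    unfolding rel_def using that by (intro exI[of _ 0]) simp
  \<comment> \<open>If \<open>a\<close> and \<open>b\<close> are unrelated, \<open>tri\<close> for
    \<open>a\<close>, \<open>b\<close>, \<open>j\<close> leaves only that \<open>P j\<close> equals
    \<open>P b\<close> or that \<open>j\<close> is related to \<open>a\<close>. If all indices are
    related, a single one represents them.\<close>
  obtain a b where ab: "\<And>j. j \<in> S \<Longrightarrow> rel j a \<or> rel j b"
  proof (cases "\<exists>a\<in>S. \<exists>b\<in>S. \<not> rel b a")
    case True
    then obtain a b where "a \<in> S" "b \<in> S" "\<not> rel b a" by blast
    then have "rel j a \<or> rel j b" if "j \<in> S" for j
      using tri[of a b j] that refl_rel[of b a] refl_rel[of j b] by metis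
    then show ?thesis using that by blast
  next
    case False
    then show ?thesis using that by (cases "S = {}") blast+
  qed
  define w where "w i = v i * q1" for i
  have vK: "v i \<in> alg K" for i using v(1) by (rule big.alg_HK)
  have wK: "w i \<in> alg K" for i unfolding w_def by (intro alg_mult big.fin vK qq)
  have line: "\<exists>u. \<forall>i. \<exists>c. P j * w i = c \<cdot> u" for j
  proof (cases "\<forall>i. P j * w i = 0")
    case True
    then have "\<forall>i. \<exists>c. P j * w i = c \<cdot> 0" by simp
    then show ?thesis by blast
  next
    case False
    then obtain i0 where i0: "P j * w i0 \<noteq> 0" by blast
    have fixed: "P j * (P j * w i) * q1 = P j * w i" for i
      by (simp add: PP(3) w_def mult.assoc qq(3))
    have PwK: "P j * w i \<in> alg K" for i by (intro alg_mult big.fin PK wK)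
    have "\<exists>c. P j * w i = c \<cdot> (P j * w i0)" for i
      using gelfand by (rule gelfand_multiplicity_one[OF big.fin small.fin sub _ P q1(1) PwK fixed i0 PwK fixed])
    then show ?thesis by blast
  qed
  have "\<forall>j. \<exists>u c. \<forall>i. P j * w i = c i \<cdot> u"
  proof
    fix j
    obtain u where "\<forall>i. \<exists>c. P j * w i = c \<cdot> u" using line by blast
    then have "\<exists>c. \<forall>i. P j * w i = c i \<cdot> u" by (rule choice)
    then show "\<exists>u c. \<forall>i. P j * w i = c i \<cdot> u" by blast
  qed
  then obtain ua ca ub cb where uc: "\<And>i. P a * w i = ca i \<cdot> ua" "\<And>i. P b * w i = cb i \<cdot> ub"
    by (metis (no_types))
  obtain c where c: "\<exists>i<3. c i \<noteq> 0" "(\<Sum>i<3. c i * ca i) = 0" "(\<Sum>i<3. c i * cb i) = 0"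
    using two_linear_equations[of ca cb] by blast
  define V where "V = (\<Sum>i<3. c i \<cdot> v i)"
  have VH: "V \<in> alg big.H" unfolding V_def by (intro alg_sum alg_smul v)
  have Vq: "V * q = V" by (simp add: V_def sum_distrib_right v)
  have pV: "p * V = V" by (simp add: V_def sum_distrib_left v)
  have Vw: "V * q1 = (\<Sum>i<3. c i \<cdot> w i)" by (simp add: V_def w_def sum_distrib_right)
  have "P a * (V * q1) = (\<Sum>i<3. c i * ca i) \<cdot> ua" "P b * (V * q1) = (\<Sum>i<3. c i * cb i) \<cdot> ub"
    by (simp_all add: Vw sum_distrib_left uc sum_smul)
  then have PabV: "P a * (V * q1) = 0" "P b * (V * q1) = 0" by (simp_all only: c smul_simps)
  have relV: "P j * (V * q1) = 0" if ji: "rel j i" "P i * (V * q1) = 0" for i j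
  proof -
    obtain k where k: "?t k (P j) = P i" "?t k q1 = q1" using ji(1) unfolding rel_def by blast
    have "?t k (P j * (V * q1)) = P i * (V * q1)"
      by (simp add: \<theta> k big.twist_pow_H[OF VH])
    then have "?t k (P j * (V * q1)) = 0" using ji(2) by simp
    moreover have "P j * (V * q1) \<in> alg K"
      by (intro alg_mult big.fin PK qq big.alg_HK[OF VH])
    ultimately show ?thesis using big.twist_pow_eq_0 by blast
  qed
  have PV: "P j * (V * q1) = 0" for j
  proof (cases "j \<in> S")
    case True
    then show ?thesis using ab relV PabV by blast
  next
    case False
    then show ?thesis using big.alg_HK[OF VH] by (auto simp: S_def mult.assoc)
  qed
  have "V * q1 = p * (V * q1)" by (simp add: pV flip: mult.assoc)
  also have "\<dots> = 0"
    unfolding p1(5) sum_distrib_right using PV by (intro sum.neutral) (auto simp: P_def)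
  finally have Vq1: "V * q1 = 0" .
  have "V = 0"
  proof (rule ccontr)
    assume "V \<noteq> 0"
    then obtain y where "y * V = q"
      using primitive_left_inverse[OF big.finH q VH Vq] by metis
    then have "q * q1 = y * (V * q1)" by (simp flip: mult.assoc)
    then show False using q1(2) qq(2) Vq1 by simp
  qed
  then show ?thesis using c(1) unfolding V_def by blast
qed

end

section \<open>Permutations labelled by residues, in the group algebra of
  \<open>G(m,1,N)\<close>\<close>

section \<open>The group algebra of the full monomial group\<close>

subsection \<open>Monomial transformations\<close>

abbreviation finv :: "('a \<Rightarrow> 'b) \<Rightarrow> 'b \<Rightarrow> 'a" where
  "finv \<equiv> inv_into UNIV"

text \<open>The pair \<open>(w, t)\<close> stands for the transformation of basis vectors
  \<open>e\<^sub>i \<mapsto> t\<^sub>i e\<^bsub>w(i)\<^esub>\<close>, and addition is composition.\<close>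

typedef gmon = "{(w :: nat \<Rightarrow> nat, t :: nat \<Rightarrow> complex). bij w \<and> (\<forall>i. t i \<noteq> 0) \<and> finite {i. t i \<noteq> 1}}"
  by (rule exI[of _ "(id, \<lambda>_. 1)"]) auto

setup_lifting type_definition_gmon

lift_definition prm :: "gmon \<Rightarrow> nat \<Rightarrow> nat" is fst .
lift_definition cf :: "gmon \<Rightarrow> nat \<Rightarrow> complex" is snd .

lemma bij_prm: "bij (prm g)"
  and cf_nonzero: "cf g i \<noteq> 0"
  and finite_cf: "finite {i. cf g i \<noteq> 1}"
  by (transfer, auto)+

lemma gmon_eqI: "prm g = prm h \<Longrightarrow> cf g = cf h \<Longrightarrow> g = h"
  by transfer (auto simp: prod_eq_iff)

lemma finite_comp_bij:
  assumes "finite {i. t i \<noteq> (1::complex)}" "bij w"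
  shows "finite {i. t (w i) \<noteq> 1}"
proof -
  have "{i. t (w i) \<noteq> 1} = w -` {i. t i \<noteq> 1}" by auto
  then show ?thesis using assms finite_vimageI[of "{i. t i \<noteq> 1}" w] by (simp add: bij_def)
qed

lemma finite_mult_support:
  assumes "finite {i. t i \<noteq> (1::complex)}" "finite {i. s i \<noteq> 1}"
  shows "finite {i. s i * t i \<noteq> 1}"
  by (rule finite_subset[OF _ finite_UnI[OF assms]]) auto

instantiation gmon :: group_add
begin

lift_definition zero_gmon :: gmon is "(id, \<lambda>_. 1)" by auto

lift_definition plus_gmon :: "gmon \<Rightarrow> gmon \<Rightarrow> gmon" is
  "\<lambda>(w, t) (w', t'). (w \<circ> w', \<lambda>i. t' i * t (w' i))"
  by (auto intro: bij_comp finite_comp_bij finite_mult_support)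

lift_definition uminus_gmon :: "gmon \<Rightarrow> gmon" is
  "\<lambda>(w, t). (finv w, \<lambda>i. inverse (t (finv w i)))"
  by (auto intro: bij_imp_bij_inv finite_comp_bij)

definition minus_gmon :: "gmon \<Rightarrow> gmon \<Rightarrow> gmon" where "minus_gmon g h = g + - h"

instance
proof
  fix a b c :: gmon
  show "a + b + c = a + (b + c)" by transfer (auto simp: mult.assoc)
  show "0 + a = a" by transfer auto
  show "a + 0 = a" by transfer auto
  show "- a + a = 0"
    by transfer (auto simp: bij_is_inj bij_is_surj surj_f_inv_f fun_eq_iff)
  show "a + - b = a - b" by (simp add: minus_gmon_def)
qed

end

lemma prm_simps [simp]: "prm 0 = id" "prm (g + h) = prm g \<circ> prm h" "prm (- g) = finv (prm g)"
  by (transfer, auto)+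

lemma cf_simps [simp]: "cf 0 i = 1" "cf (g + h) i = cf h i * cf g (prm h i)"
    "cf (- g) i = inverse (cf g (finv (prm g) i))"
  by (transfer, auto)+

definition Tm :: "(nat \<Rightarrow> complex) \<Rightarrow> gmon" where "Tm t = Abs_gmon (id, t)"
definition Pm :: "(nat \<Rightarrow> nat) \<Rightarrow> gmon" where "Pm w = Abs_gmon (w, \<lambda>_. 1)"

definition diagonal :: "(nat \<Rightarrow> complex) \<Rightarrow> bool" where
  "diagonal t \<longleftrightarrow> (\<forall>i. t i \<noteq> 0) \<and> finite {i. t i \<noteq> 1}"

lemma Tm [simp]: "diagonal t \<Longrightarrow> prm (Tm t) = id" "diagonal t \<Longrightarrow> cf (Tm t) = t"
  by (simp_all add: Tm_def prm.rep_eq cf.rep_eq Abs_gmon_inverse diagonal_def)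

lemma Pm [simp]: "bij w \<Longrightarrow> prm (Pm w) = w" "bij w \<Longrightarrow> cf (Pm w) = (\<lambda>_. 1)"
  by (simp_all add: Pm_def prm.rep_eq cf.rep_eq Abs_gmon_inverse)

lemma diagonal_mult: "diagonal s \<Longrightarrow> diagonal t \<Longrightarrow> diagonal (\<lambda>i. s i * t i)"
  by (auto simp: diagonal_def intro: finite_mult_support)

lemma diagonal_comp: "diagonal t \<Longrightarrow> bij w \<Longrightarrow> diagonal (\<lambda>i. t (w i))"
  by (auto simp: diagonal_def intro: finite_comp_bij)

lemma diagonal_cf: "diagonal (cf g)"
  by (simp add: diagonal_def cf_nonzero finite_cf)

lemma gmon_decompose: "g = Pm (prm g) + Tm (cf g)"
  by (rule gmon_eqI) (auto simp: bij_prm diagonal_cf)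

lemma Tm_add: "diagonal s \<Longrightarrow> diagonal t \<Longrightarrow> Tm s + Tm t = Tm (\<lambda>i. s i * t i)"
  by (rule gmon_eqI) (auto simp: diagonal_mult mult.commute)

lemma Pm_add: "bij v \<Longrightarrow> bij w \<Longrightarrow> Pm v + Pm w = Pm (v \<circ> w)"
  by (rule gmon_eqI) (auto simp: bij_comp)

lemma Pm_uminus: "bij w \<Longrightarrow> - Pm w = Pm (finv w)"
  by (rule gmon_eqI) (auto simp: bij_imp_bij_inv)

lemma Tm_Pm: "diagonal t \<Longrightarrow> bij w \<Longrightarrow> Tm t + Pm w = Pm w + Tm (\<lambda>i. t (w i))"
  by (rule gmon_eqI) (auto simp: diagonal_comp)

lemma Pm_id [simp]: "Pm id = 0"
  by (rule gmon_eqI) auto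

text \<open>For \<open>m = d * e\<close> the kernel of this character on
  \<open>full_group m N\<close> is \<open>G(de,e,N)\<close>: the product of the entries has to be a
  \<open>d\<close>-th root of unity.\<close>

definition omega :: "nat \<Rightarrow> gmon \<Rightarrow> complex" where
  "omega d g = (Prod_any (cf g)) ^ d"

lemma omega_add: "omega d (g + h) = omega d g * omega d h"
proof -
  have "Prod_any (\<lambda>i. cf g (prm h i)) = Prod_any (cf g)"
  proof -
    have "Prod_any (cf g) = (\<Prod>i | cf g i \<noteq> 1. cf g i)" by (simp add: Prod_any.expand_set)
    also have "\<dots> = (\<Prod>i | cf g (prm h i) \<noteq> 1. cf g (prm h i))"
    proof (intro prod.reindex_bij_witness[where i = "prm h" and j = "finv (prm h)"])
    qed (auto simp: bij_prm bij_is_surj bij_is_inj surj_f_inv_f)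
    finally show ?thesis by (simp add: Prod_any.expand_set)
  qed
  moreover have "cf (g + h) = (\<lambda>i. cf h i * cf g (prm h i))" by (simp add: fun_eq_iff)
  ultimately show ?thesis
    using Prod_any.distrib[OF finite_cf[of h] finite_comp_bij[OF finite_cf[of g] bij_prm[of h]]]
    by (simp add: omega_def power_mult_distrib mult.commute)
qed

lemma omega_Pm [simp]: "bij w \<Longrightarrow> omega d (Pm w) = 1"
  by (simp add: omega_def)

text \<open>This is \<open>G(m,1,N)\<close>. For all \<open>N\<close> it lives in one type, so that
  the inclusion of the parabolic subgroup is an inclusion of sets and fixing the last coordinate
  needs no block matrices.\<close>

definition full_group :: "nat \<Rightarrow> nat \<Rightarrow> gmon set" where
  "full_group m N = {g. prm g permutes {..<N} \<and> (\<forall>i<N. cf g i ^ m = 1) \<and> (\<forall>i\<ge>N. cf g i = 1)}"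

definition diag_group :: "nat \<Rightarrow> nat set \<Rightarrow> (nat \<Rightarrow> complex) set" where
  "diag_group m I = {t. (\<forall>i\<in>I. t i ^ m = 1) \<and> (\<forall>i. i \<notin> I \<longrightarrow> t i = 1)}"

lemma finite_roots: "m > 0 \<Longrightarrow> finite {z :: complex. z ^ m = 1}"
  by (rule finite_roots_unity) simp

lemma diag_group_PiE:
  "diag_group m I = (\<lambda>f i. if i \<in> I then f i else 1) ` (I \<rightarrow>\<^sub>E {z. z ^ m = 1})"
proof (intro equalityI subsetI)
  fix t assume "t \<in> diag_group m I"
  then show "t \<in> (\<lambda>f i. if i \<in> I then f i else 1) ` (I \<rightarrow>\<^sub>E {z. z ^ m = 1})"
    by (intro image_eqI[of _ _ "restrict t I"]) (auto simp: diag_group_def fun_eq_iff)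
qed (auto simp: diag_group_def PiE_def Pi_def)

locale mu_group =
  fixes m :: nat
  assumes m: "m > 0"
begin

abbreviation "D \<equiv> diag_group m"

lemma D_finite: "finite I \<Longrightarrow> finite (D I)"
  unfolding diag_group_PiE using m by (intro finite_imageI finite_PiE finite_roots) auto

lemma D_one: "(\<lambda>_. 1) \<in> D I" by (simp add: diag_group_def)

lemma D_card: "finite I \<Longrightarrow> card (D I) > 0"
  using D_finite D_one by (auto simp: card_gt_0_iff)

lemma D_nonzero: "t \<in> D I \<Longrightarrow> t i \<noteq> 0"
  using m by (cases "i \<in> I") (auto simp: diag_group_def, metis power_0_left zero_neq_one neq0_conv)

lemma D_diagonal: "finite I \<Longrightarrow> t \<in> D I \<Longrightarrow> diagonal t"
  unfolding diagonal_def using D_nonzero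
  by (auto simp: diag_group_def intro: finite_subset[of _ I])

lemma D_mult: "s \<in> D I \<Longrightarrow> t \<in> D I \<Longrightarrow> (\<lambda>i. s i * t i) \<in> D I"
  by (auto simp: diag_group_def power_mult_distrib)

lemma D_inverse: "t \<in> D I \<Longrightarrow> (\<lambda>i. inverse (t i)) \<in> D I"
  by (auto simp: diag_group_def power_inverse)

lemma D_mono: "I \<subseteq> J \<Longrightarrow> t \<in> D I \<Longrightarrow> t \<in> D J"
  by (fastforce simp: diag_group_def)

lemma D_comp: "t \<in> D I \<Longrightarrow> bij w \<Longrightarrow> (\<lambda>i. t (w i)) \<in> D (w -` I)"
  by (auto simp: diag_group_def)

lemma full_group_iff: "g \<in> full_group m N \<longleftrightarrow> prm g permutes {..<N} \<and> cf g \<in> D {..<N}"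
  by (auto simp: full_group_def diag_group_def)

lemma Pm_full: "w permutes {..<N} \<Longrightarrow> Pm w \<in> full_group m N"
  by (simp add: full_group_iff permutes_bij D_one)

lemma Tm_full: "t \<in> D I \<Longrightarrow> I \<subseteq> {..<N} \<Longrightarrow> Tm t \<in> full_group m N"
  using D_diagonal[of I t] D_mono[of I "{..<N}" t]
  by (simp add: full_group_iff permutes_id finite_subset)

lemma permutes_D: "w permutes J \<Longrightarrow> t \<in> D J \<Longrightarrow> (\<lambda>i. t (w i)) \<in> D J"
  using D_comp[of t J w] by (simp add: permutes_bij permutes_vimage)

lemma full_group: "finite_subgroup (full_group m N)"
  unfolding finite_subgroup_def
proof (intro conjI ballI)
  have "full_group m N \<subseteq> (\<lambda>(w, t). Pm w + Tm t) ` ({w. w permutes {..<N}} \<times> D {..<N})"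
  proof
    fix g assume "g \<in> full_group m N"
    then show "g \<in> (\<lambda>(w, t). Pm w + Tm t) ` ({w. w permutes {..<N}} \<times> D {..<N})"
      using gmon_decompose[of g] by (intro image_eqI[of _ _ "(prm g, cf g)"]) (auto simp: full_group_iff)
  qed
  moreover have "finite ({w. w permutes {..<N}} \<times> D {..<N})"
    using D_finite finite_permutations by blast
  ultimately show "finite (full_group m N)" using finite_surj by blast
  show "0 \<in> full_group m N" by (auto simp: full_group_def permutes_id)
  fix g assume g: "g \<in> full_group m N"
  then have p: "prm g permutes {..<N}" "cf g \<in> D {..<N}" by (auto simp: full_group_iff)
  have "cf (- g) = (\<lambda>i. inverse (cf g (finv (prm g) i)))" by (simp add: fun_eq_iff)
  then show "- g \<in> full_group m N"
    using p by (simp add: full_group_iff permutes_inv permutes_D D_inverse)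
  fix h assume h: "h \<in> full_group m N"
  have "cf (g + h) = (\<lambda>i. cf h i * cf g (prm h i))" by (simp add: fun_eq_iff)
  then show "g + h \<in> full_group m N"
    using p h by (simp add: full_group_iff permutes_compose permutes_D D_mult)
qed

subsection \<open>Idempotents of the diagonal subgroup\<close>

definition chi :: "nat set \<Rightarrow> (nat \<Rightarrow> nat) \<Rightarrow> (nat \<Rightarrow> complex) \<Rightarrow> complex" where
  "chi I \<chi> t = (\<Prod>i\<in>I. t i ^ \<chi> i)"

text \<open>The idempotent of a linear character of the diagonal group supported on
  \<open>I\<close>. The exponents \<open>\<chi>\<close> are the labels of the coordinates.\<close>

definition Ed :: "nat set \<Rightarrow> (nat \<Rightarrow> nat) \<Rightarrow> gmon galg" where
  "Ed I \<chi> = (1 / of_nat (card (D I))) \<cdot> (\<Sum>t\<in>D I. inverse (chi I \<chi> t) \<cdot> gr (Tm t))"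

lemma chi_mult: "chi I \<chi> (\<lambda>i. s i * t i) = chi I \<chi> s * chi I \<chi> t"
  by (simp add: chi_def power_mult_distrib prod.distrib)

lemma chi_nonzero: "finite I \<Longrightarrow> t \<in> D J \<Longrightarrow> chi I \<chi> t \<noteq> 0"
  by (simp add: chi_def D_nonzero)

lemma Ed_cong: "(\<And>i. i \<in> I \<Longrightarrow> \<chi> i = \<psi> i) \<Longrightarrow> Ed I \<chi> = Ed I \<psi>"
  by (simp add: Ed_def chi_def)

lemma Tm_commute: "diagonal s \<Longrightarrow> diagonal t \<Longrightarrow> gr (Tm s) * gr (Tm t) = gr (Tm t) * gr (Tm s)"
  by (simp add: gr_mult Tm_add mult.commute)

lemma Tm_Ed_commute: "finite I \<Longrightarrow> diagonal s \<Longrightarrow> gr (Tm s) * Ed I \<chi> = Ed I \<chi> * gr (Tm s)"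
  unfolding Ed_def by (simp add: sum_distrib_left sum_distrib_right D_diagonal Tm_commute)

lemma Ed_commute: "finite I \<Longrightarrow> finite J \<Longrightarrow> Ed I \<chi> * Ed J \<psi> = Ed J \<psi> * Ed I \<chi>"
  by (subst (1 3) Ed_def) (simp add: sum_distrib_left sum_distrib_right D_diagonal Tm_Ed_commute)

lemma Tm_Ed:
  assumes I: "finite I" and s: "s \<in> D I"
  shows "gr (Tm s) * Ed I \<chi> = chi I \<chi> s \<cdot> Ed I \<chi>"
proof -
  have "(\<Sum>t\<in>D I. inverse (chi I \<chi> t) \<cdot> (gr (Tm s) * gr (Tm t)))
      = (\<Sum>t\<in>D I. (chi I \<chi> s * inverse (chi I \<chi> t)) \<cdot> gr (Tm t))"
  proof (rule sum.reindex_bij_witness[where i = "\<lambda>t i. inverse (s i) * t i" and j = "\<lambda>t i. s i * t i"])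
    fix t assume t: "t \<in> D I"
    show "(\<lambda>i. inverse (s i) * (s i * t i)) = t" "(\<lambda>i. s i * (inverse (s i) * t i)) = t"
      by (simp_all add: D_nonzero[OF s] fun_eq_iff)
    show "(\<lambda>i. s i * t i) \<in> D I" "(\<lambda>i. inverse (s i) * t i) \<in> D I"
      using D_mult[OF s t] D_mult[OF D_inverse[OF s] t] by auto
    show "(chi I \<chi> s * inverse (chi I \<chi> (\<lambda>i. s i * t i))) \<cdot> gr (Tm (\<lambda>i. s i * t i))
        = inverse (chi I \<chi> t) \<cdot> (gr (Tm s) * gr (Tm t))"
      using chi_nonzero[OF I s, of \<chi>]
      by (simp add: chi_mult gr_mult Tm_add D_diagonal[OF I s] D_diagonal[OF I t] flip: mult.assoc)
  qed
  then have "gr (Tm s) * (\<Sum>t\<in>D I. inverse (chi I \<chi> t) \<cdot> gr (Tm t))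
      = chi I \<chi> s \<cdot> (\<Sum>t\<in>D I. inverse (chi I \<chi> t) \<cdot> gr (Tm t))"
    by (simp add: sum_distrib_left smul_sum)
  then show ?thesis by (simp add: Ed_def)
qed

lemma Ed_absorb:
  assumes J: "finite J" "I \<subseteq> J" and eq: "\<And>i. i \<in> I \<Longrightarrow> \<chi> i = \<psi> i"
  shows "Ed I \<chi> * Ed J \<psi> = Ed J \<psi>" "Ed J \<psi> * Ed I \<chi> = Ed J \<psi>"
proof -
  have I: "finite I" using J by (rule rev_finite_subset)
  have chi: "chi J \<psi> t = chi I \<chi> t" if "t \<in> D I" for t
  proof -
    have "chi J \<psi> t = chi I \<psi> t"
      unfolding chi_def using J that by (intro prod.mono_neutral_right) (auto simp: diag_group_def)
    also have "\<dots> = chi I \<chi> t" using eq by (simp add: chi_def)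
    finally show ?thesis .
  qed
  have "(\<Sum>t\<in>D I. inverse (chi I \<chi> t) \<cdot> gr (Tm t)) * Ed J \<psi> = (\<Sum>t\<in>D I. 1 \<cdot> Ed J \<psi>)"
    unfolding sum_distrib_right
  proof (intro sum.cong refl)
    fix t assume t: "t \<in> D I"
    have "gr (Tm t) * Ed J \<psi> = chi I \<chi> t \<cdot> Ed J \<psi>"
      using Tm_Ed[OF J(1) D_mono[OF J(2) t]] chi[OF t] by simp
    then show "inverse (chi I \<chi> t) \<cdot> gr (Tm t) * Ed J \<psi> = 1 \<cdot> Ed J \<psi>"
      using chi_nonzero[OF I t] by simp
  qed
  also have "\<dots> = of_nat (card (D I)) \<cdot> Ed J \<psi>" by (simp only: sum_smul[symmetric]) simp
  finally show "Ed I \<chi> * Ed J \<psi> = Ed J \<psi>"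
    using D_card[OF I] by (subst Ed_def) simp
  then show "Ed J \<psi> * Ed I \<chi> = Ed J \<psi>" by (simp add: Ed_commute I J)
qed

text \<open>A diagonal element with a primitive root of unity at the single coordinate
  \<open>i\<close> can be moved from one factor to the other, and the two factors turn it into
  different scalars.\<close>

lemma Ed_orthogonal:
  assumes I: "finite I" "finite J" and i: "i \<in> I" "i \<in> J" "\<chi> i \<noteq> \<psi> i" "\<chi> i < m" "\<psi> i < m"
  shows "Ed I \<chi> * Ed J \<psi> = 0"
proof -
  define \<zeta> where "\<zeta> = cis (2 * pi / m)"
  define t where "t = (\<lambda>j. if j = i then \<zeta> else 1)"
  have "\<zeta> ^ m = 1" using m by (simp add: \<zeta>_def DeMoivre)
  then have t: "t \<in> D I" "t \<in> D J" using i by (auto simp: t_def diag_group_def)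
  have c: "chi K \<chi> t = \<zeta> ^ \<chi> i" if "finite K" "i \<in> K" for K \<chi>
    unfolding chi_def t_def using that by (simp add: if_distrib[of "\<lambda>x. x ^ _"] prod.delta cong: if_cong)
  have "chi I \<chi> t \<cdot> (Ed I \<chi> * Ed J \<psi>) = (gr (Tm t) * Ed I \<chi>) * Ed J \<psi>"
    by (simp add: Tm_Ed I t)
  also have "\<dots> = Ed I \<chi> * (gr (Tm t) * Ed J \<psi>)"
    by (simp add: Tm_Ed_commute[OF I(1) D_diagonal[OF I(1) t(1)]] mult.assoc)
  also have "\<dots> = chi J \<psi> t \<cdot> (Ed I \<chi> * Ed J \<psi>)" by (simp add: Tm_Ed I t)
  finally have "\<zeta> ^ \<chi> i = \<zeta> ^ \<psi> i \<or> Ed I \<chi> * Ed J \<psi> = 0"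
    unfolding smul_cancel_right c[OF I(1) i(1)] c[OF I(2) i(2)] .
  moreover have "\<zeta> ^ \<chi> i \<noteq> \<zeta> ^ \<psi> i"
  proof
    have "inj_on (\<lambda>k. cis (2 * pi * real k / real m)) {..<m}"
      using bij_betw_roots_unity[OF m] by (simp add: bij_betw_def)
    moreover assume "\<zeta> ^ \<chi> i = \<zeta> ^ \<psi> i"
    then have "cis (2 * pi * real (\<chi> i) / real m) = cis (2 * pi * real (\<psi> i) / real m)"
      by (simp add: \<zeta>_def DeMoivre mult_ac)
    ultimately have "\<chi> i = \<psi> i"
      using i by (intro inj_onD[of "\<lambda>k. cis (2 * pi * real k / real m)" "{..<m}"]) auto
    then show False using i by simp
  qed
  ultimately show ?thesis by simp
qed

lemma Ed_Un:
  assumes I: "finite I" "finite J" "I \<inter> J = {}"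
  shows "Ed (I \<union> J) \<chi> = Ed I \<chi> * Ed J \<chi>"
proof -
  let ?X = "Ed I \<chi> * Ed J \<chi>"
  have IJ: "finite (I \<union> J)" using I by simp
  have "gr (Tm t) * ?X = chi (I \<union> J) \<chi> t \<cdot> ?X" if t: "t \<in> D (I \<union> J)" for t
  proof -
    define t1 where "t1 = (\<lambda>i. if i \<in> I then t i else 1)"
    define t2 where "t2 = (\<lambda>i. if i \<in> J then t i else 1)"
    have t12: "t1 \<in> D I" "t2 \<in> D J" using t by (auto simp: t1_def t2_def diag_group_def)
    have "t = (\<lambda>i. t1 i * t2 i)" using t I(3) by (auto simp: t1_def t2_def diag_group_def fun_eq_iff)
    then have "Tm t = Tm t1 + Tm t2"
      using Tm_add D_diagonal[OF I(1) t12(1)] D_diagonal[OF I(2) t12(2)] by metis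
    then have "gr (Tm t) * ?X = gr (Tm t1) * (gr (Tm t2) * Ed I \<chi>) * Ed J \<chi>"
      by (simp add: mult.assoc flip: gr_mult)
    also have "\<dots> = (gr (Tm t1) * Ed I \<chi>) * (gr (Tm t2) * Ed J \<chi>)"
      by (simp add: mult.assoc Tm_Ed_commute[OF I(1) D_diagonal[OF I(2) t12(2)]])
    also have "\<dots> = (chi I \<chi> t1 * chi J \<chi> t2) \<cdot> ?X"
      by (simp add: Tm_Ed I t12 mult.commute)
    also have "chi I \<chi> t1 * chi J \<chi> t2 = chi (I \<union> J) \<chi> t"
      using I by (simp add: chi_def t1_def t2_def prod.union_disjoint)
    finally show ?thesis .
  qed
  then have "(\<Sum>t\<in>D (I \<union> J). inverse (chi (I \<union> J) \<chi> t) \<cdot> gr (Tm t)) * ?X = (\<Sum>t\<in>D (I \<union> J). 1 \<cdot> ?X)"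
    unfolding sum_distrib_right by (intro sum.cong refl) (simp add: chi_nonzero[OF IJ])
  also have "\<dots> = of_nat (card (D (I \<union> J))) \<cdot> ?X" by (simp only: sum_smul[symmetric]) simp
  finally have "Ed (I \<union> J) \<chi> * ?X = ?X"
    using D_card[OF IJ] by (subst Ed_def) simp
  moreover have "Ed (I \<union> J) \<chi> * ?X = Ed (I \<union> J) \<chi>"
    using IJ by (simp add: Ed_absorb flip: mult.assoc)
  ultimately show ?thesis by simp
qed

lemma Ed_empty: "Ed {} \<chi> = 1"
proof -
  have "D {} = {\<lambda>_. 1}" by (auto simp: diag_group_def)
  moreover have "Tm (\<lambda>_. 1) = 0" by (rule gmon_eqI) (auto simp: diagonal_def)
  ultimately show ?thesis by (simp add: Ed_def chi_def)
qed

lemma Ed_conj: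
  assumes I: "finite I" and w: "bij w"
  shows "gr (Pm w) * Ed I \<chi> = Ed (w ` I) (\<chi> \<circ> finv w) * gr (Pm w)"
proof -
  have iw: "finv w (w i) = i" "w (finv w i) = i" for i
    using w by (simp_all add: bij_is_inj bij_is_surj surj_f_inv_f)
  have bw: "bij (finv w)" using w by (rule bij_imp_bij_inv)
  have r1: "(\<lambda>i. t (finv w i)) \<in> D (w ` I)" if "t \<in> D I" for t
    using that by (auto simp: diag_group_def iw) (metis iw(2) imageI)
  have r2: "(\<lambda>i. t (w i)) \<in> D I" if "t \<in> D (w ` I)" for t
    using that w by (auto simp: diag_group_def bij_is_inj inj_image_mem_iff)
  have "bij_betw (\<lambda>t i. t (finv w i)) (D I) (D (w ` I))"
    by (rule bij_betw_byWitness[where f' = "\<lambda>t i. t (w i)"]) (auto simp: iw r1 r2)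
  then have card: "card (D (w ` I)) = card (D I)" by (rule bij_betw_same_card[symmetric])
  have "(\<Sum>t\<in>D I. inverse (chi I \<chi> t) \<cdot> (gr (Pm w) * gr (Tm t)))
      = (\<Sum>t\<in>D (w ` I). inverse (chi (w ` I) (\<chi> \<circ> finv w) t) \<cdot> (gr (Tm t) * gr (Pm w)))"
  proof (rule sum.reindex_bij_witness[where j = "\<lambda>t i. t (finv w i)" and i = "\<lambda>t i. t (w i)"])
    fix t assume t: "t \<in> D I"
    have "chi (w ` I) (\<chi> \<circ> finv w) (\<lambda>i. t (finv w i)) = chi I \<chi> t"
      unfolding chi_def using w by (subst prod.reindex) (auto simp: iw bij_is_inj inj_on_subset[of _ UNIV])
    moreover have "diagonal (\<lambda>i. t (finv w i))"
      using D_diagonal[OF I t] bw by (rule diagonal_comp)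
    ultimately show "inverse (chi (w ` I) (\<chi> \<circ> finv w) (\<lambda>i. t (finv w i))) \<cdot> (gr (Tm (\<lambda>i. t (finv w i))) * gr (Pm w))
        = inverse (chi I \<chi> t) \<cdot> (gr (Pm w) * gr (Tm t))"
      using Tm_Pm[of "\<lambda>i. t (finv w i)" w] w by (simp add: gr_mult iw)
  qed (auto simp: iw r1 r2)
  then show ?thesis by (simp add: Ed_def sum_distrib_left sum_distrib_right card)
qed

lemma Ed_conj':
  assumes "finite I" "bij w"
  shows "gr (Pm w) * Ed I \<chi> * gr (- Pm w) = Ed (w ` I) (\<chi> \<circ> finv w)"
  by (simp add: Ed_conj assms mult.assoc)

lemma Ed_single_sum: "(\<Sum>x<m. Ed {i} (\<lambda>_. x)) = 1"
proof -
  have card: "card (D {i}) = m"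
  proof -
    have "bij_betw (\<lambda>t. t i) (D {i}) {z. z ^ m = 1}"
      by (rule bij_betw_byWitness[where f' = "\<lambda>z j. if j = i then z else 1"])
        (auto simp: diag_group_def fun_eq_iff)
    then show ?thesis using bij_betw_same_card card_roots_unity_eq[of m] m by metis
  qed
  have "(\<Sum>x<m. Ed {i} (\<lambda>_. x))
      = (1 / of_nat m) \<cdot> (\<Sum>t\<in>D {i}. (\<Sum>x<m. inverse (t i) ^ x) \<cdot> gr (Tm t))"
    unfolding Ed_def card smul_sum[symmetric] sum_smul
    by (subst sum.swap) (simp add: chi_def power_inverse)
  also have "(\<Sum>t\<in>D {i}. (\<Sum>x<m. inverse (t i) ^ x) \<cdot> gr (Tm t))
      = (\<Sum>t\<in>D {i}. if t = (\<lambda>_. 1) then of_nat m \<cdot> gr (Tm (\<lambda>_. 1)) else 0)"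
  proof (intro sum.cong refl)
    fix t assume t: "t \<in> D {i}"
    show "(\<Sum>x<m. inverse (t i) ^ x) \<cdot> gr (Tm t) = (if t = (\<lambda>_. 1) then of_nat m \<cdot> gr (Tm (\<lambda>_. 1)) else 0)"
    proof (cases "t i = 1")
      case True
      then have "t = (\<lambda>_. 1)" using t by (auto simp: diag_group_def fun_eq_iff)
      then show ?thesis by simp
    next
      case False
      then have "(\<Sum>x<m. inverse (t i) ^ x) = 0"
        using t by (intro sum_roots_unity) (auto simp: diag_group_def power_inverse)
      then show ?thesis using False by auto
    qed
  qed
  also have "\<dots> = of_nat m \<cdot> gr (Tm (\<lambda>_. 1))" using D_finite[of "{i}"] D_one by (simp add: sum.delta)
  also have "Tm (\<lambda>_. 1) = 0" by (rule gmon_eqI) (auto simp: diagonal_def)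
  finally show ?thesis using m by simp
qed

lemma Ed_sum:
  assumes "finite I"
  shows "(\<Sum>\<chi>\<in>I \<rightarrow>\<^sub>E {..<m}. Ed I \<chi>) = 1"
  using assms
proof induction
  case (insert i I)
  have "(\<Sum>\<chi>\<in>insert i I \<rightarrow>\<^sub>E {..<m}. Ed (insert i I) \<chi>)
      = (\<Sum>(x, \<chi>)\<in>{..<m} \<times> (I \<rightarrow>\<^sub>E {..<m}). Ed (insert i I) (\<chi>(i := x)))"
    unfolding PiE_insert_eq
    by (subst sum.reindex) (use inj_combinator[OF insert.hyps(2)] in \<open>auto simp: case_prod_unfold\<close>)
  also have "\<dots> = (\<Sum>(x, \<chi>)\<in>{..<m} \<times> (I \<rightarrow>\<^sub>E {..<m}). Ed {i} (\<lambda>_. x) * Ed I \<chi>)"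
  proof (intro sum.cong refl, clarify)
    fix x \<chi>
    have "Ed (insert i I) (\<chi>(i := x)) = Ed {i} (\<chi>(i := x)) * Ed I (\<chi>(i := x))"
      using Ed_Un[of "{i}" I] insert.hyps by simp
    also have "Ed {i} (\<chi>(i := x)) = Ed {i} (\<lambda>_. x)" by (rule Ed_cong) auto
    also have "Ed I (\<chi>(i := x)) = Ed I \<chi>" using insert.hyps by (intro Ed_cong) auto
    finally show "Ed (insert i I) (\<chi>(i := x)) = Ed {i} (\<lambda>_. x) * Ed I \<chi>" .
  qed
  also have "\<dots> = (\<Sum>x<m. Ed {i} (\<lambda>_. x)) * (\<Sum>\<chi>\<in>I \<rightarrow>\<^sub>E {..<m}. Ed I \<chi>)"
    by (simp add: sum_product sum.cartesian_product)
  also have "\<dots> = 1" by (simp add: Ed_single_sum insert.IH)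
  finally show ?case .
qed (simp add: Ed_empty)

lemma Ed_alg: "I \<subseteq> {..<N} \<Longrightarrow> Ed I \<chi> \<in> alg (full_group m N)"
  unfolding Ed_def by (intro alg_smul alg_sum) (auto intro: Tm_full)

end

subsection \<open>Extending and reflecting permutations\<close>

text \<open>Used to replace an arbitrary bijection by a permutation of \<open>{..<N}\<close> with
  the same values on \<open>I\<close>; conjugation of a permutation of \<open>I\<close> depends on
  these values only.\<close>

lemma permutes_extension:
  assumes A: "finite A" "I \<subseteq> A" and f: "inj_on f I" "f ` I \<subseteq> A"
  obtains g where "g permutes A" "\<And>i. i \<in> I \<Longrightarrow> g i = f i"
proof -
  have fI: "finite I" "finite (f ` I)" using A by (auto intro: finite_subset)
  have "card (A - I) = card (A - f ` I)"
    using A f fI by (simp add: card_Diff_subset card_image)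
  then obtain \<beta> where \<beta>: "bij_betw \<beta> (A - I) (A - f ` I)"
    using A by (metis finite_Diff finite_same_card_bij)
  define g where "g = (\<lambda>i. if i \<in> I then f i else if i \<in> A then \<beta> i else i)"
  have "bij_betw g I (f ` I)"
    using f(1) by (auto simp: bij_betw_def g_def inj_on_def)
  moreover have "bij_betw g (A - I) (A - f ` I)"
    using \<beta> by (rule bij_betw_cong[THEN iffD1, rotated]) (simp add: g_def)
  ultimately have "bij_betw g (I \<union> (A - I)) (f ` I \<union> (A - f ` I))"
    by (rule bij_betw_combine) auto
  moreover have "I \<union> (A - I) = A" "f ` I \<union> (A - f ` I) = A" using A f by auto
  ultimately have "bij_betw g A A" by simp
  then have "g permutes A" using A by (intro bij_imp_permutes) (auto simp: g_def)
  then show ?thesis using that[of g] by (simp add: g_def)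
qed

lemma permutes_restrict:
  assumes w: "w permutes I" and J: "J \<subseteq> I" "finite I" "\<And>i. i \<in> J \<Longrightarrow> w i \<in> J"
  shows "(\<lambda>i. if i \<in> J then w i else i) permutes J"
proof (rule bij_imp_permutes)
  have "inj_on w J" using w by (meson permutes_inj inj_on_subset subset_UNIV)
  then have "bij_betw w J J"
    using J by (metis endo_inj_surj finite_subset bij_betw_def image_subsetI)
  then show "bij_betw (\<lambda>i. if i \<in> J then w i else i) J J"
    by (rule bij_betw_cong[THEN iffD1, rotated]) simp
qed simp

lemma conj_permutes_cong:
  assumes "bij g" "bij h" "w permutes I" "\<And>i. i \<in> I \<Longrightarrow> g i = h i"
  shows "g \<circ> w \<circ> finv g = h \<circ> w \<circ> finv h"
proof
  fix j
  have h: "finv h (h i) = i" "h (finv h j) = j" for i j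
    using assms(2) by (simp_all add: bij_is_inj bij_is_surj surj_f_inv_f)
  have g: "finv g (g i) = i" "g (finv g j) = j" for i j
    using assms(1) by (simp_all add: bij_is_inj bij_is_surj surj_f_inv_f)
  show "(g \<circ> w \<circ> finv g) j = (h \<circ> w \<circ> finv h) j"
  proof (cases "finv g j \<in> I")
    case True
    define i where "i = finv g j"
    have i: "i \<in> I" "w i \<in> I" using True assms(3) by (auto simp: i_def permutes_in_image)
    have "j = g i" by (simp add: i_def g)
    then have "finv g j = i" "finv h j = i" using g(1)[of i] h(1)[of i] assms(4)[OF i(1)] by simp_all
    then show ?thesis using assms(4)[OF i(2)] by simp
  next
    case False
    moreover have "finv h j \<notin> I"
    proof
      assume "finv h j \<in> I"
      then have "g (finv h j) = j" using assms(4) by (simp add: h)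
      then have "finv g j = finv h j" using g(1) by metis
      then show False using False \<open>finv h j \<in> I\<close> by simp
    qed
    ultimately show ?thesis using assms(3) by (simp add: permutes_not_in g h)
  qed
qed

lemma conj_permutes:
  assumes "bij h" "w permutes I"
  shows "(h \<circ> w \<circ> finv h) permutes (h ` I)"
proof -
  have h: "finv h (h i) = i" "h (finv h j) = j" for i j
    using assms(1) by (simp_all add: bij_is_inj bij_is_surj surj_f_inv_f)
  have "bij (h \<circ> w \<circ> finv h)"
    using assms by (intro bij_comp bij_imp_bij_inv) (auto intro: permutes_bij)
  moreover have "(h \<circ> w \<circ> finv h) j = j" if "j \<notin> h ` I" for j
  proof -
    have "finv h j \<notin> I" using that h by (metis imageI)
    then show ?thesis using assms(2) by (simp add: permutes_not_in h)
  qed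
  ultimately show ?thesis unfolding permutes_def by (metis bij_pointE)
qed

text \<open>On every cycle of \<open>w\<close>, a reflection \<open>w\<^sup>k b \<mapsto> w\<^sup>-\<^sup>k b\<close> inverts \<open>w\<close>; base points are chosen so
  that \<open>a\<close> is one of them.\<close>

lemma reflection_exists:
  fixes w :: "nat \<Rightarrow> nat"
  assumes w: "w permutes A" and A: "finite A" "a \<in> A"
  obtains v where "v permutes (A - {a})" "v \<circ> w = finv w \<circ> v"
    "\<forall>\<chi> :: nat \<Rightarrow> nat. (\<forall>i\<in>A. \<chi> (w i) = \<chi> i) \<longrightarrow> (\<forall>i\<in>A. \<chi> (v i) = \<chi> i)"
proof -
  have "permutation w" using w A permutation_permutes by blast
  then obtain p where p: "w ^^ p = id" "p > 0" using permutation_is_nilpotent by blast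
  \<comment> \<open>Now \<open>w ^^ q\<close> is the inverse of \<open>w\<close>, so that
    \<open>w ^^ (q * k)\<close> stands for the negative power with exponent
    \<open>- k\<close>.\<close>
  then obtain q where q: "p = Suc q" by (cases p) auto
  have wp: "(w ^^ (p * k)) i = i" for k i
    by (induction k) (simp_all add: funpow_add p)
  have wadd: "(w ^^ k) ((w ^^ l) i) = (w ^^ (k + l)) i" for k l i by (simp add: funpow_add)
  have invq: "(w ^^ (q * k)) ((w ^^ k) i) = i" for k i
    using wp[of k i] by (simp add: wadd q add.commute)
  have winv: "finv w = w ^^ q"
    by (rule inv_unique_comp) (use invq[of 1] in \<open>simp_all add: fun_eq_iff funpow_swap1\<close>)
  define Or where "Or i = range (\<lambda>k. (w ^^ k) i)" for i
  have Or_self: "i \<in> Or i" for i by (auto simp: Or_def intro: range_eqI[of _ _ 0])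
  have Or_pow: "Or ((w ^^ k) i) = Or i" for i k
  proof
    show "Or ((w ^^ k) i) \<subseteq> Or i" by (auto simp: Or_def wadd)
    show "Or i \<subseteq> Or ((w ^^ k) i)"
    proof
      fix j assume "j \<in> Or i"
      then obtain l where "j = (w ^^ l) i" by (auto simp: Or_def)
      also have "\<dots> = (w ^^ l) ((w ^^ (q * k)) ((w ^^ k) i))" by (simp only: invq)
      finally have "j = (w ^^ (l + q * k)) ((w ^^ k) i)" by (simp only: wadd add.assoc)
      then show "j \<in> Or ((w ^^ k) i)" unfolding Or_def by (rule range_eqI)
    qed
  qed
  have Or_eq: "Or j = Or i" if "j \<in> Or i" for i j
  proof -
    from that obtain k where "j = (w ^^ k) i" by (auto simp: Or_def)
    then show ?thesis by (simp add: Or_pow)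
  qed
  define b where "b i = (if a \<in> Or i then a else LEAST j. j \<in> Or i)" for i
  have b_Or: "b i \<in> Or i" for i unfolding b_def using LeastI[of "\<lambda>j. j \<in> Or i" i, OF Or_self] by simp
  have b_eq: "b j = b i" if "j \<in> Or i" for i j using Or_eq[OF that] by (simp add: b_def)
  have "\<exists>k. (w ^^ k) (b i) = i" for i
  proof -
    have "i \<in> Or (b i)" using Or_self[of i] Or_eq[OF b_Or[of i]] by simp
    then obtain k where "i = (w ^^ k) (b i)" by (auto simp: Or_def)
    from this[symmetric] show ?thesis by (rule exI)
  qed
  then obtain k where k: "\<And>i. (w ^^ k i) (b i) = i" by metis
  define v where "v i = (w ^^ (q * k i)) (b i)" for i
  \<comment> \<open>Every exponent that leads from the base point to \<open>i\<close> gives the same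
    value, so the choice made by \<open>k\<close> is harmless.\<close>
  have v: "v i = (w ^^ (q * l)) (b i)" if "(w ^^ l) (b i) = i" for i l
  proof -
    have "v i = (w ^^ (q * k i)) ((w ^^ (q * l)) ((w ^^ l) (b i)))" by (simp add: v_def invq)
    also have "\<dots> = (w ^^ (q * l)) ((w ^^ (q * k i)) ((w ^^ k i) (b i)))"
      by (simp add: that k) (simp add: wadd add.commute)
    also have "\<dots> = (w ^^ (q * l)) (b i)" by (simp only: invq)
    finally show ?thesis .
  qed
  have vOr: "v i \<in> Or i" for i
  proof -
    have "v i \<in> Or (b i)" by (auto simp: v_def Or_def)
    then show ?thesis using Or_eq[OF b_Or[of i]] by simp
  qed
  have vw: "v (w i) = finv w (v i)" for i
  proof -
    have bw: "b (w i) = b i" using Or_pow[of 1 i] Or_self[of "w i"] by (intro b_eq) simp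
    have "(w ^^ Suc (k i)) (b (w i)) = w i" by (simp add: bw k)
    then have "v (w i) = (w ^^ (q + q * k i)) (b i)" using v[of "Suc (k i)" "w i"] bw by simp
    then show ?thesis by (simp add: winv wadd v_def)
  qed
  have vv: "v (v i) = i" for i
  proof -
    have bv: "b (v i) = b i" using vOr by (rule b_eq)
    have "(w ^^ (q * k i)) (b (v i)) = v i" unfolding bv by (rule v_def[symmetric])
    from v[OF this] have "v (v i) = (w ^^ (q * (q * k i))) (b i)" by (simp only: bv)
    also have "\<dots> = (w ^^ (q * (q * k i))) ((w ^^ (q * k i)) ((w ^^ k i) (b i)))"
      by (simp only: invq[of "k i" "b i"])
    also have "\<dots> = (w ^^ k i) (b i)" by (rule invq)
    finally show ?thesis by (simp add: k)
  qed
  have "b a = a" using Or_self by (simp add: b_def)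
  then have va: "v a = a" using v[of 0 a] by simp
  have vout: "v i = i" if "i \<notin> A" for i
  proof -
    have "(w ^^ l) i = i" for l
      by (induction l) (use w that in \<open>auto simp: permutes_not_in\<close>)
    then have "Or i = {i}" by (auto simp: Or_def)
    then show ?thesis using vOr[of i] by simp
  qed
  show thesis
  proof (rule that)
    show "v permutes (A - {a})" unfolding permutes_def
      using va vout vv by (metis Diff_iff singletonD)
    show "v \<circ> w = finv w \<circ> v" by (auto simp: vw)
    show "\<forall>\<chi> :: nat \<Rightarrow> nat. (\<forall>i\<in>A. \<chi> (w i) = \<chi> i) \<longrightarrow> (\<forall>i\<in>A. \<chi> (v i) = \<chi> i)"
    proof (intro allI impI ballI)
      fix \<chi> :: "nat \<Rightarrow> nat" and i
      assume \<chi>: "\<forall>i\<in>A. \<chi> (w i) = \<chi> i" and i: "i \<in> A"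
      have "(w ^^ l) i \<in> A \<and> \<chi> ((w ^^ l) i) = \<chi> i" for l
        by (induction l) (use w i \<chi> in \<open>auto simp: permutes_in_image\<close>)
      then show "\<chi> (v i) = \<chi> i" using vOr[of i] by (auto simp: Or_def)
    qed
  qed
qed

definition sym_group :: "nat \<Rightarrow> gmon set" where
  "sym_group N = Pm ` {w. w permutes {..<N}}"

lemma sym_group: "finite_subgroup (sym_group N)"
  unfolding finite_subgroup_def sym_group_def
proof (intro conjI ballI)
  show "finite (Pm ` {w. w permutes {..<N}})" by (simp add: finite_permutations)
  show "0 \<in> Pm ` {w. w permutes {..<N}}" using permutes_id by (metis Pm_id imageI mem_Collect_eq)
qed (auto simp: Pm_add Pm_uminus permutes_bij intro!: imageI permutes_compose permutes_inv)

lemma inj_Pm: "inj_on Pm {w. w permutes A}"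
  by (rule inj_onI) (metis Pm(1) mem_Collect_eq permutes_bij)

context mu_group
begin

subsection \<open>Weighted permutations and central elements\<close>

text \<open>A permutation of \<open>I\<close> together with labels. If the labels are constant on
  cycles and \<open>I\<close> is everything, these elements span what commutes with the diagonal
  group.\<close>

definition Xw :: "(nat \<Rightarrow> nat) \<Rightarrow> nat set \<Rightarrow> (nat \<Rightarrow> nat) \<Rightarrow> gmon galg" where
  "Xw w I \<chi> = gr (Pm w) * Ed I \<chi>"

lemma conj_Xw:
  assumes "finite I" "bij h" "w permutes I"
  shows "gr (Pm h) * Xw w I \<chi> * gr (- Pm h) = Xw (h \<circ> w \<circ> finv h) (h ` I) (\<chi> \<circ> finv h)"
proof -
  have bw: "bij w" "bij (finv h)" using assms by (auto intro: permutes_bij bij_imp_bij_inv)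
  have "gr (Pm h) * gr (Pm w) = gr (Pm (h \<circ> w \<circ> finv h)) * gr (Pm h)"
    using assms(2) bw by (simp add: gr_mult Pm_add bij_comp o_assoc[symmetric] bij_is_inj)
  then have "gr (Pm h) * Xw w I \<chi> * gr (- Pm h)
      = gr (Pm (h \<circ> w \<circ> finv h)) * (gr (Pm h) * Ed I \<chi> * gr (- Pm h))"
    by (simp add: Xw_def flip: mult.assoc)
  then show ?thesis by (simp add: Xw_def Ed_conj' assms)
qed

lemma conj_Xw_cong:
  assumes I: "finite I" and w: "w permutes I" and gh: "bij g" "bij h" "\<And>i. i \<in> I \<Longrightarrow> g i = h i"
  shows "gr (Pm g) * Xw w I \<chi> * gr (- Pm g) = gr (Pm h) * Xw w I \<chi> * gr (- Pm h)"
proof -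
  have "Ed (g ` I) (\<chi> \<circ> finv g) = Ed (g ` I) (\<chi> \<circ> finv h)"
  proof (rule Ed_cong)
    fix j assume "j \<in> g ` I"
    then obtain i where "i \<in> I" "j = g i" by blast
    then show "(\<chi> \<circ> finv g) j = (\<chi> \<circ> finv h) j"
      using gh by (metis comp_apply bij_is_inj inv_f_f)
  qed
  moreover have "g ` I = h ` I" using gh by auto
  ultimately have "Ed (g ` I) (\<chi> \<circ> finv g) = Ed (h ` I) (\<chi> \<circ> finv h)" by simp
  moreover have "g \<circ> w \<circ> finv g = h \<circ> w \<circ> finv h" using gh w by (intro conj_permutes_cong) auto
  ultimately show ?thesis using conj_Xw[OF I gh(1) w] conj_Xw[OF I gh(2) w] by (simp add: Xw_def)
qed

text \<open>The sum \<open>zc x c N\<close> is central and sees only the \<open>x\<close>-th component of a multipartition.\<close>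

definition conj_class :: "(nat \<Rightarrow> nat) \<times> nat set \<Rightarrow> nat \<Rightarrow> ((nat \<Rightarrow> nat) \<times> nat set) set" where
  "conj_class c N = {(w, I). I \<subseteq> {..<N} \<and> w permutes I \<and>
     (\<exists>h. bij h \<and> w = h \<circ> fst c \<circ> finv h \<and> I = h ` snd c)}"

definition zc :: "nat \<Rightarrow> (nat \<Rightarrow> nat) \<times> nat set \<Rightarrow> nat \<Rightarrow> gmon galg" where
  "zc x c N = (\<Sum>(w, I)\<in>conj_class c N. Xw w I (\<lambda>_. x))"

lemma finite_conj_class: "finite (conj_class c N)"
proof (rule finite_subset)
  show "conj_class c N \<subseteq> {w. w permutes {..<N}} \<times> Pow {..<N}"
    by (auto simp: conj_class_def intro: permutes_subset)
  show "finite ({w. w permutes {..<N}} \<times> Pow {..<N})"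
    using finite_permutations[of "{..<N}"] by auto
qed

lemma Xw_alg: "w permutes I \<Longrightarrow> I \<subseteq> {..<N} \<Longrightarrow> Xw w I \<chi> \<in> alg (full_group m N)"
  unfolding Xw_def by (intro alg_mult full_group Ed_alg) (auto intro: Pm_full permutes_subset)

lemma zc_alg: "zc x c N \<in> alg (full_group m N)"
  unfolding zc_def by (rule alg_sum) (auto simp: conj_class_def intro: Xw_alg)

lemma conj_class_conj:
  assumes "(w, I) \<in> conj_class c N" "h permutes {..<N}"
  shows "(h \<circ> w \<circ> finv h, h ` I) \<in> conj_class c N"
proof -
  obtain k where k: "bij k" "w = k \<circ> fst c \<circ> finv k" "I = k ` snd c"
    and I: "I \<subseteq> {..<N}" "w permutes I" using assms by (auto simp: conj_class_def)
  have h: "bij h" using assms by (simp add: permutes_bij)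
  have "h \<circ> w \<circ> finv h = (h \<circ> k) \<circ> fst c \<circ> finv (h \<circ> k)" "h ` I = (h \<circ> k) ` snd c"
    using k h by (simp_all add: o_inv_distrib o_assoc image_comp)
  moreover have "h ` I \<subseteq> {..<N}" using I(1) permutes_image[OF assms(2)] by blast
  moreover have "(h \<circ> w \<circ> finv h) permutes (h ` I)" using h I(2) by (rule conj_permutes)
  moreover have "bij (h \<circ> k)" using h k(1) by (simp add: bij_comp)
  ultimately show ?thesis unfolding conj_class_def mem_Collect_eq case_prod_conv
    by (intro conjI exI[of _ "h \<circ> k"])
qed

text \<open>Moving \<open>t\<close> past \<open>w\<close> changes it by a diagonal element
  \<open>u\<close> whose entries have product 1, and a constant label sees nothing but this
  product.\<close>

lemma Tm_Xw_commute:
  assumes I: "finite I" and w: "w permutes I" and t: "t \<in> D J" "finite J" "I \<subseteq> J"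
  shows "gr (Tm t) * Xw w I (\<lambda>_. x) = Xw w I (\<lambda>_. x) * gr (Tm t)"
proof -
  define u where "u = (\<lambda>i. inverse (t i) * t (w i))"
  have dt: "diagonal t" using t by (intro D_diagonal)
  have bw: "bij w" using w by (rule permutes_bij)
  have u: "u \<in> D I"
    using t w permutes_in_image[OF w]
    by (auto simp: u_def diag_group_def power_mult_distrib power_inverse permutes_not_in[OF w] subset_iff D_nonzero[OF t(1)])
  have "chi I (\<lambda>_. x) u = (\<Prod>i\<in>I. u i) ^ x" by (simp add: chi_def prod_power_distrib)
  also have "(\<Prod>i\<in>I. u i) = inverse (\<Prod>i\<in>I. t i) * (\<Prod>i\<in>I. t (w i))"
    by (simp add: u_def prod.distrib prod_inversef[symmetric] o_def)
  also have "(\<Prod>i\<in>I. t (w i)) = (\<Prod>i\<in>I. t i)" using prod.permute[OF w, of t] by (simp add: o_def)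
  finally have chi: "chi I (\<lambda>_. x) u = 1" using I D_nonzero[OF t(1)] by simp
  have "(\<lambda>i. t (w i)) = (\<lambda>i. t i * u i)" by (simp add: u_def fun_eq_iff D_nonzero[OF t(1)])
  then have "Tm (\<lambda>i. t (w i)) = Tm t + Tm u" using Tm_add[OF dt D_diagonal[OF I u]] by simp
  then have "gr (Tm (\<lambda>i. t (w i))) * Ed I (\<lambda>_. x) = gr (Tm t) * (gr (Tm u) * Ed I (\<lambda>_. x))"
    by (simp add: mult.assoc flip: gr_mult)
  also have "\<dots> = Ed I (\<lambda>_. x) * gr (Tm t)"
    by (simp add: Tm_Ed[OF I u] chi Tm_Ed_commute[OF I dt])
  finally have *: "gr (Tm (\<lambda>i. t (w i))) * Ed I (\<lambda>_. x) = Ed I (\<lambda>_. x) * gr (Tm t)" .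
  have **: "gr (Tm t) * gr (Pm w) = gr (Pm w) * gr (Tm (\<lambda>i. t (w i)))"
    by (simp add: gr_mult Tm_Pm[OF dt bw])
  have "gr (Tm t) * Xw w I (\<lambda>_. x) = (gr (Tm t) * gr (Pm w)) * Ed I (\<lambda>_. x)"
    by (simp add: Xw_def mult.assoc)
  also have "\<dots> = gr (Pm w) * (gr (Tm (\<lambda>i. t (w i))) * Ed I (\<lambda>_. x))"
    by (simp only: ** mult.assoc)
  also have "\<dots> = Xw w I (\<lambda>_. x) * gr (Tm t)" by (simp only: * Xw_def mult.assoc)
  finally show ?thesis .
qed

lemma commutant_full:
  assumes P: "\<And>w. w permutes {..<N} \<Longrightarrow> gr (Pm w) * y = y * gr (Pm w)"
    and T: "\<And>t. t \<in> D {..<N} \<Longrightarrow> gr (Tm t) * y = y * gr (Tm t)"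
  shows "y \<in> commutant (full_group m N)"
  unfolding commutant_def
proof (intro CollectI ballI)
  fix g assume "g \<in> full_group m N"
  then have g: "prm g permutes {..<N}" "cf g \<in> D {..<N}" by (auto simp: full_group_iff)
  have "gr g * y = gr (Pm (prm g)) * (gr (Tm (cf g)) * y)"
    by (subst gmon_decompose) (simp add: mult.assoc flip: gr_mult)
  also have "\<dots> = (gr (Pm (prm g)) * y) * gr (Tm (cf g))" by (simp add: T g mult.assoc)
  also have "\<dots> = y * (gr (Pm (prm g)) * gr (Tm (cf g)))" by (simp add: P g mult.assoc)
  also have "\<dots> = y * gr g" by (subst (3) gmon_decompose) (simp add: gr_mult)
  finally show "gr g * y = y * gr g" .
qed

lemma zc_commutant: "zc x c N \<in> commutant (full_group m N)"
proof (rule commutant_full)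
  fix h assume h: "h permutes {..<N}"
  then have bh: "bij h" by (rule permutes_bij)
  have ih: "finv h permutes {..<N}" using h by (rule permutes_inv)
  have i: "finv h (h j) = j" "h (finv h j) = j" for j
    using bh by (simp_all add: bij_is_inj bij_is_surj surj_f_inv_f)
  have c: "finv h \<circ> (h \<circ> w \<circ> finv h) \<circ> finv (finv h) = w" "h \<circ> (finv h \<circ> w \<circ> finv (finv h)) \<circ> finv h = w"
    "finv h ` h ` I = I" "h ` finv h ` I = I" for w :: "nat \<Rightarrow> nat" and I
    by (simp_all add: inv_inv_eq[OF bh] fun_eq_iff i image_image)
  have "gr (Pm h) * zc x c N * gr (- Pm h)
      = (\<Sum>(w, I)\<in>conj_class c N. Xw (h \<circ> w \<circ> finv h) (h ` I) (\<lambda>_. x))"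
    unfolding zc_def sum_distrib_left sum_distrib_right
  proof (intro sum.cong refl, clarify)
    fix w I assume "(w, I) \<in> conj_class c N"
    then have "finite I" "w permutes I" by (auto simp: conj_class_def intro: finite_subset)
    then show "gr (Pm h) * Xw w I (\<lambda>_. x) * gr (- Pm h) = Xw (h \<circ> w \<circ> finv h) (h ` I) (\<lambda>_. x)"
      using conj_Xw[of I h w "\<lambda>_. x"] bh by (simp add: o_def)
  qed
  also have "\<dots> = zc x c N" unfolding zc_def
    by (rule sum.reindex_bij_witness[where i = "\<lambda>(w, I). (finv h \<circ> w \<circ> finv (finv h), finv h ` I)"
          and j = "\<lambda>(w, I). (h \<circ> w \<circ> finv h, h ` I)"])
      (auto simp: c i image_image simp del: o_apply intro: conj_class_conj[OF _ h] conj_class_conj[OF _ ih])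
  finally show "gr (Pm h) * zc x c N = zc x c N * gr (Pm h)" by (simp only: commute_gr_iff)
next
  fix t assume t: "t \<in> D {..<N}"
  show "gr (Tm t) * zc x c N = zc x c N * gr (Tm t)"
    unfolding zc_def sum_distrib_left sum_distrib_right
  proof (intro sum.cong refl, clarify)
    fix w I assume "(w, I) \<in> conj_class c N"
    then have "I \<subseteq> {..<N}" "w permutes I" by (auto simp: conj_class_def)
    then show "gr (Tm t) * Xw w I (\<lambda>_. x) = Xw w I (\<lambda>_. x) * gr (Tm t)"
      using t by (intro Tm_Xw_commute[of I w t "{..<N}"]) (auto intro: finite_subset)
  qed
qed

text \<open>The classes consist of partial permutations with recorded domain. Therefore increasing
  \<open>n\<close> retains all terms and adds exactly those whose domain contains the new
  coordinate, where a fixed point counts as well.\<close>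

lemma zc_diff:
  "zc x c (Suc n) - zc x c n = (\<Sum>(w, I)\<in>{(w, I)\<in>conj_class c (Suc n). n \<in> I}. Xw w I (\<lambda>_. x))"
proof -
  define B where "B = {(w, I)\<in>conj_class c (Suc n). n \<in> I}"
  define Q where "Q w I \<longleftrightarrow> w permutes I \<and> (\<exists>h. bij h \<and> w = h \<circ> fst c \<circ> finv h \<and> I = h ` snd c)" for w and I :: "nat set"
  have cl: "conj_class c N = {(w, I). I \<subseteq> {..<N} \<and> Q w I}" for N
    by (simp add: conj_class_def Q_def)
  have "I \<subseteq> {..<Suc n} \<longleftrightarrow> I \<subseteq> {..<n} \<or> I \<subseteq> {..<Suc n} \<and> n \<in> I" for I
    by (cases "n \<in> I") (auto simp: lessThan_Suc subset_insert)
  then have eq: "conj_class c (Suc n) = conj_class c n \<union> B"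
    unfolding B_def cl by blast
  have disj: "conj_class c n \<inter> B = {}"
    by (auto simp: B_def cl)
  have fin: "finite B"
    unfolding B_def by (rule finite_subset[OF _ finite_conj_class[of c "Suc n"]]) auto
  have "zc x c (Suc n) = (\<Sum>(w, I)\<in>conj_class c n \<union> B. Xw w I (\<lambda>_. x))"
    unfolding zc_def by (rule sum.cong[OF eq refl])
  also have "\<dots> = zc x c n + (\<Sum>(w, I)\<in>B. Xw w I (\<lambda>_. x))"
    unfolding zc_def by (rule sum.union_disjoint[OF finite_conj_class fin disj])
  finally show ?thesis by (simp add: B_def)
qed

text \<open>Every term of the difference carries the label \<open>x\<close> at the coordinate
  \<open>n\<close>, in conflict with the label \<open>a\<close>.\<close>

lemma zc_diff_orthogonal:
  assumes "x < m" "a < m" "x \<noteq> a"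
  shows "(zc x c (Suc n) - zc x c n) * Ed {n} (\<lambda>_. a) = 0"
  unfolding zc_diff sum_distrib_right
proof (intro sum.neutral ballI, clarify)
  fix w I assume I: "(w, I) \<in> conj_class c (Suc n)" "n \<in> I"
  then have "finite I" by (auto simp: conj_class_def intro: finite_subset)
  then have "Ed I (\<lambda>_. x) * Ed {n} (\<lambda>_. a) = 0"
    using assms I by (intro Ed_orthogonal[of _ _ n]) auto
  then show "Xw w I (\<lambda>_. x) * Ed {n} (\<lambda>_. a) = 0" by (simp add: Xw_def mult.assoc)
qed

text \<open>For the class of a one-point domain, \<open>zc\<close> counts the coordinates with label
  \<open>x\<close>, and the difference tests the label of the last one. This class will be the index
  \<open>c0\<close> of \<open>branching\<close>.\<close>

lemma zc_diff_point: "(zc x (id, {0}) (Suc n) - zc x (id, {0}) n) * Ed {n} (\<lambda>_. x) = Ed {n} (\<lambda>_. x)"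
proof -
  have "{(w, I)\<in>conj_class (id, {0}) (Suc n). n \<in> I} = {(id, {n})}" (is "?L = ?R")
  proof
    have "id \<circ> finv h = finv h" "h \<circ> finv h = id" if "bij h" for h :: "nat \<Rightarrow> nat"
      using that by (auto simp: bij_is_surj surj_iff[THEN iffD1])
    then show "?L \<subseteq> ?R" by (auto simp: conj_class_def)
    have "bij (transpose 0 n)" by simp
    moreover have "id = transpose 0 n \<circ> id \<circ> finv (transpose 0 n)" "{n} = transpose 0 n ` {0}"
      by simp_all
    ultimately have "\<exists>h :: nat \<Rightarrow> nat. bij h \<and> id = h \<circ> id \<circ> finv h \<and> {n} = h ` {0}" by blast
    then show "?R \<subseteq> ?L" by (auto simp: conj_class_def permutes_id)
  qed
  then show ?thesis by (simp add: zc_diff Xw_def Ed_absorb(1))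
qed

text \<open>The twist multiplies the coefficient at \<open>Tm t\<close> by the \<open>d\<close>-th
  power of the product of the entries, which lowers a constant label by \<open>d\<close>.\<close>

lemma twist_Ed:
  assumes I: "finite I" and y: "[y = x + d] (mod m)"
  shows "twist (omega d) (Ed I (\<lambda>_. y)) = Ed I (\<lambda>_. x)"
  unfolding Ed_def twist_smul twist_sum
proof (intro arg_cong[where f = "\<lambda>u. (1 / of_nat (card (D I))) \<cdot> u"] sum.cong refl)
  fix t assume t: "t \<in> D I"
  define P where "P = (\<Prod>i\<in>I. t i)"
  have "Prod_any t = P"
    unfolding P_def using I t by (intro Prod_any.expand_superset) (auto simp: diag_group_def)
  then have om: "omega d (Tm t) = P ^ d" by (simp add: omega_def D_diagonal[OF I t])
  have chiP: "chi I (\<lambda>_. k) t = P ^ k" for k by (simp add: chi_def P_def prod_power_distrib)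
  have "P ^ m = 1" using t by (simp add: P_def diag_group_def prod_power_distrib)
  then have mod: "P ^ k = P ^ (k mod m)" for k
  proof -
    have "P ^ k = P ^ (m * (k div m) + k mod m)" by simp
    also have "\<dots> = P ^ (k mod m)" by (simp only: power_add power_mult \<open>P ^ m = 1\<close>) simp
    finally show ?thesis .
  qed
  have "P ^ y = P ^ x * P ^ d"
    using mod[of y] mod[of "x + d"] y by (simp add: cong_def power_add)
  moreover have "P \<noteq> 0" using I D_nonzero[OF t] by (simp add: P_def)
  ultimately have "inverse (P ^ y) * P ^ d = inverse (P ^ x)" by (simp add: field_simps)
  then show "inverse (chi I (\<lambda>_. y) t) \<cdot> twist (omega d) (gr (Tm t)) = inverse (chi I (\<lambda>_. x) t) \<cdot> gr (Tm t)"
    by (simp add: twist_smul twist_gr om chiP)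
qed

lemma twist_zc:
  assumes "[y = x + d] (mod m)"
  shows "twist (omega d) (zc y c N) = zc x c N"
  unfolding zc_def twist_sum
proof (intro sum.cong refl, clarify)
  fix w I assume I: "(w, I) \<in> conj_class c N"
  have mult: "twist (omega d) (u * v) = twist (omega d) u * twist (omega d) v" for u v
    unfolding twist_def by (rule lin_ext_mult) (simp add: omega_add gr_mult mult.commute)
  have "finite I" "bij w" using I by (auto simp: conj_class_def permutes_bij intro: finite_subset)
  then show "twist (omega d) (Xw w I (\<lambda>_. y)) = Xw w I (\<lambda>_. x)"
    by (simp add: Xw_def mult twist_Ed[OF _ assms] twist_gr)
qed

end

context mu_group
begin

subsection \<open>The weighted permutations that commute with the diagonal\<close>

definition invariant_pairs :: "nat \<Rightarrow> ((nat \<Rightarrow> nat) \<times> (nat \<Rightarrow> nat)) set" where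
  "invariant_pairs N = {(w, \<chi>). w permutes {..<N} \<and> \<chi> \<in> {..<N} \<rightarrow>\<^sub>E {..<m} \<and> (\<forall>i<N. \<chi> (w i) = \<chi> i)}"

definition invariant_span :: "nat \<Rightarrow> gmon galg set" where
  "invariant_span N = {y. \<exists>a. y = (\<Sum>(w, \<chi>)\<in>invariant_pairs N. a w \<chi> \<cdot> Xw w {..<N} \<chi>)}"

lemma finite_invariant_pairs: "finite (invariant_pairs N)"
proof (rule finite_subset)
  show "invariant_pairs N \<subseteq> {w. w permutes {..<N}} \<times> ({..<N} \<rightarrow>\<^sub>E {..<m})"
    by (auto simp: invariant_pairs_def)
  show "finite ({w. w permutes {..<N}} \<times> ({..<N} \<rightarrow>\<^sub>E {..<m}))"
    by (auto intro: finite_permutations finite_PiE)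
qed

lemma invariant_span_0: "0 \<in> invariant_span N"
  unfolding invariant_span_def by (auto intro!: exI[of _ "\<lambda>_ _. 0"])

lemma invariant_span_add:
  assumes "x \<in> invariant_span N" "y \<in> invariant_span N"
  shows "x + y \<in> invariant_span N"
proof -
  obtain a where a: "x = (\<Sum>(w, \<chi>)\<in>invariant_pairs N. a w \<chi> \<cdot> Xw w {..<N} \<chi>)"
    using assms(1) unfolding invariant_span_def by blast
  obtain b where b: "y = (\<Sum>(w, \<chi>)\<in>invariant_pairs N. b w \<chi> \<cdot> Xw w {..<N} \<chi>)"
    using assms(2) unfolding invariant_span_def by blast
  from a b have "x + y = (\<Sum>(w, \<chi>)\<in>invariant_pairs N. (a w \<chi> + b w \<chi>) \<cdot> Xw w {..<N} \<chi>)"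
    by (simp add: sum.distrib smul_add_left case_prod_unfold)
  then show ?thesis unfolding invariant_span_def by (blast intro: exI[of _ "\<lambda>w \<chi>. a w \<chi> + b w \<chi>"])
qed

lemma invariant_span_smul:
  assumes "x \<in> invariant_span N"
  shows "s \<cdot> x \<in> invariant_span N"
proof -
  obtain a where "x = (\<Sum>(w, \<chi>)\<in>invariant_pairs N. a w \<chi> \<cdot> Xw w {..<N} \<chi>)"
    using assms unfolding invariant_span_def by blast
  then have "s \<cdot> x = (\<Sum>(w, \<chi>)\<in>invariant_pairs N. (s * a w \<chi>) \<cdot> Xw w {..<N} \<chi>)"
    by (simp add: smul_sum case_prod_unfold)
  then show ?thesis unfolding invariant_span_def by (blast intro: exI[of _ "\<lambda>w \<chi>. s * a w \<chi>"])
qed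

lemma invariant_span_sum: "(\<And>i. i \<in> A \<Longrightarrow> f i \<in> invariant_span N) \<Longrightarrow> (\<Sum>i\<in>A. f i) \<in> invariant_span N"
  by (induction A rule: infinite_finite_induct) (auto intro: invariant_span_0 invariant_span_add)

lemma Xw_invariant_span:
  assumes "(w, \<chi>) \<in> invariant_pairs N"
  shows "Xw w {..<N} \<chi> \<in> invariant_span N"
proof -
  have "(\<Sum>(v, \<psi>)\<in>invariant_pairs N. (if v = w \<and> \<psi> = \<chi> then 1 else 0) \<cdot> Xw v {..<N} \<psi>)
      = (\<Sum>p\<in>invariant_pairs N. if p = (w, \<chi>) then Xw w {..<N} \<chi> else 0)"
    by (intro sum.cong) (auto split: if_splits)
  also have "\<dots> = Xw w {..<N} \<chi>" using assms by (simp add: finite_invariant_pairs)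
  finally show ?thesis
    unfolding invariant_span_def by (auto intro!: exI[of _ "\<lambda>v \<psi>. if v = w \<and> \<psi> = \<chi> then 1 else 0"])
qed

text \<open>Commuting with the diagonal matrices that are trivial in the last coordinate is enough,
  because \<open>\<chi> \<circ> w\<close> and \<open>\<chi>\<close> cannot differ in exactly one place.\<close>

lemma commuting_invariant_span:
  assumes y: "y \<in> alg (full_group m N)"
    and comm: "\<And>t. t \<in> D {..<N - 1} \<Longrightarrow> gr (Tm t) * y = y * gr (Tm t)"
  shows "y \<in> invariant_span N"
proof -
  let ?J = "{..<N - 1}"
  have gens: "Ed ?J \<chi> * gr g * Ed {..<N} \<chi> \<in> invariant_span N"
    if g: "g \<in> full_group m N" and \<chi>: "\<chi> \<in> {..<N} \<rightarrow>\<^sub>E {..<m}" for g \<chi>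
  proof -
    define w where "w = prm g"
    have w: "w permutes {..<N}" "bij w" and t: "cf g \<in> D {..<N}"
      using g by (auto simp: full_group_iff w_def permutes_bij)
    have iw: "finv w (w i) = i" "w (finv w i) = i" for i
      using w by (simp_all add: bij_is_inj bij_is_surj surj_f_inv_f)
    define I where "I = finv w ` ?J"
    have I: "finite I" "w ` I = ?J" "I \<subseteq> {..<N}"
      using permutes_image[OF permutes_inv[OF w(1)]] by (auto simp: I_def image_image iw)
    have "gr g * Ed {..<N} \<chi> = gr (Pm w) * (gr (Tm (cf g)) * Ed {..<N} \<chi>)"
      by (subst gmon_decompose) (simp add: w_def mult.assoc flip: gr_mult)
    also have "\<dots> = chi {..<N} \<chi> (cf g) \<cdot> (gr (Pm w) * Ed {..<N} \<chi>)"
      using t by (simp add: Tm_Ed)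
    finally have 1: "Ed ?J \<chi> * gr g * Ed {..<N} \<chi>
        = chi {..<N} \<chi> (cf g) \<cdot> (Ed ?J \<chi> * gr (Pm w) * Ed {..<N} \<chi>)"
      by (simp add: mult.assoc)
    have "gr (Pm w) * Ed I (\<chi> \<circ> w) = Ed ?J (\<chi> \<circ> w \<circ> finv w) * gr (Pm w)"
      using Ed_conj[OF I(1) w(2), of "\<chi> \<circ> w"] I(2) by simp
    moreover have "\<chi> \<circ> w \<circ> finv w = \<chi>" by (simp add: fun_eq_iff iw)
    ultimately have 2: "Ed ?J \<chi> * gr (Pm w) * Ed {..<N} \<chi>
        = gr (Pm w) * (Ed I (\<chi> \<circ> w) * Ed {..<N} \<chi>)" by (simp flip: mult.assoc)
    show ?thesis
    proof (cases "\<forall>i\<in>I. \<chi> (w i) = \<chi> i")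
      case False
      then obtain i where i: "i \<in> I" "\<chi> (w i) \<noteq> \<chi> i" by blast
      then have "i < N" "w i < N" using I(3) permutes_in_image[OF w(1), of i] by auto
      then have "Ed I (\<chi> \<circ> w) * Ed {..<N} \<chi> = 0"
        using i I(1) \<chi> by (intro Ed_orthogonal[of _ _ i]) (auto simp: PiE_def Pi_def)
      then show ?thesis using 1 2 by (simp add: invariant_span_0)
    next
      case True
      then have J: "\<chi> j = \<chi> (finv w j)" if "j < N - 1" for j
        using that by (force simp: I_def iw)
      have all: "\<chi> j = \<chi> (finv w j)" if "j < N" for j
      proof (cases "j < N - 1")
        case False
        then have j: "j = N - 1" "N = Suc (N - 1)" using that by auto
        \<comment> \<open>A permutation does not change the sum of all labels. Cancelling the
          coordinates below \<open>N - 1\<close>, where the two labellings agree, leaves equality at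
          the last one.\<close>
        have "(\<Sum>i<N. \<chi> (finv w i)) = (\<Sum>i<N. \<chi> i)"
          using sum.permute[OF permutes_inv[OF w(1)], of \<chi>] by (simp add: o_def)
        then have "(\<Sum>i<N - 1. \<chi> (finv w i)) + \<chi> (finv w (N - 1)) = (\<Sum>i<N - 1. \<chi> i) + \<chi> (N - 1)"
          using j(2) by (metis sum.lessThan_Suc)
        moreover have "(\<Sum>i<N - 1. \<chi> (finv w i)) = (\<Sum>i<N - 1. \<chi> i)"
          using J by (intro sum.cong) auto
        ultimately show ?thesis using j by simp
      qed (rule J)
      have "\<chi> (w i) = \<chi> i" if "i < N" for i
        using all[of "w i"] that permutes_in_image[OF w(1), of i] by (simp add: iw)
      then have "(w, \<chi>) \<in> invariant_pairs N" using w \<chi> by (auto simp: invariant_pairs_def)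
      moreover have "Ed I (\<chi> \<circ> w) * Ed {..<N} \<chi> = Ed {..<N} \<chi>"
        using True I by (intro Ed_absorb) auto
      ultimately show ?thesis using 1 2 Xw_invariant_span
        by (simp add: Xw_def invariant_span_smul)
    qed
  qed
  have mem: "Ed ?J \<chi> * y * Ed {..<N} \<chi> \<in> invariant_span N" if \<chi>: "\<chi> \<in> {..<N} \<rightarrow>\<^sub>E {..<m}" for \<chi>
  proof -
    have "finite (full_group m N)" using full_group by (simp add: finite_subgroup_def)
    from this y show ?thesis
      by (induction rule: alg_induct)
        (use gens[OF _ \<chi>] in \<open>auto simp: distrib_left distrib_right
          intro: invariant_span_0 invariant_span_add invariant_span_smul\<close>)
  qed
  \<comment> \<open>The sandwich loses nothing: \<open>y\<close> commutes with the left factors,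
    they are absorbed by the right ones, and the right ones add up to 1.\<close>
  have "(\<Sum>\<chi>\<in>{..<N} \<rightarrow>\<^sub>E {..<m}. Ed ?J \<chi> * y * Ed {..<N} \<chi>) = y"
  proof -
    have yE: "Ed ?J \<chi> * y = y * Ed ?J \<chi>" for \<chi>
      unfolding Ed_def using comm by (simp add: sum_distrib_left sum_distrib_right)
    have "Ed ?J \<chi> * y * Ed {..<N} \<chi> = y * Ed {..<N} \<chi>" for \<chi>
    proof -
      have "Ed ?J \<chi> * Ed {..<N} \<chi> = Ed {..<N} \<chi>" by (rule Ed_absorb) auto
      then show ?thesis by (simp only: yE mult.assoc)
    qed
    then show ?thesis using Ed_sum[of "{..<N}"] by (simp flip: sum_distrib_left)
  qed
  moreover have "(\<Sum>\<chi>\<in>{..<N} \<rightarrow>\<^sub>E {..<m}. Ed ?J \<chi> * y * Ed {..<N} \<chi>) \<in> invariant_span N"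
    by (rule invariant_span_sum) (rule mem)
  ultimately show ?thesis by simp
qed

subsection \<open>The anti-involution and multiplicity one\<close>

text \<open>Matrix transposition: the permutation part is inverted and the entries are kept.
  Inversion of group elements would negate the labels, whereas this anti-automorphism fixes every
  \<open>Ed I \<chi>\<close>.\<close>

definition transp :: "gmon galg \<Rightarrow> gmon galg" where
  "transp = lin_ext (\<lambda>g. gr (Tm (cf g) + Pm (finv (prm g))))"

lemma transp_mult: "transp (x * y) = transp y * transp x"
  unfolding transp_def
proof (rule lin_ext_antimult)
  fix g h :: gmon
  have b: "bij (finv (prm g))" "bij (finv (prm h))" by (simp_all add: bij_prm bij_imp_bij_inv)
  have i: "finv (prm h) (prm h i) = i" "prm h (finv (prm h) i) = i" for h i
    using bij_prm[of h] by (simp_all add: bij_is_inj bij_is_surj surj_f_inv_f)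
  have "Tm (cf (g + h)) + Pm (finv (prm (g + h)))
      = (Tm (cf h) + Pm (finv (prm h))) + (Tm (cf g) + Pm (finv (prm g)))"
    by (rule gmon_eqI)
      (simp_all add: b diagonal_cf bij_prm bij_comp bij_imp_bij_inv o_inv_distrib o_assoc fun_eq_iff i)
  then show "gr (Tm (cf (g + h)) + Pm (finv (prm (g + h))))
      = gr (Tm (cf h) + Pm (finv (prm h))) * gr (Tm (cf g) + Pm (finv (prm g)))"
    by (simp add: gr_mult)
qed

lemma transp_linear:
  "transp (x + y) = transp x + transp y" "transp (c \<cdot> x) = c \<cdot> transp x"
  "transp (\<Sum>i\<in>A. f i) = (\<Sum>i\<in>A. transp (f i))"
  by (simp_all add: transp_def lin_ext_add lin_ext_smul lin_ext_sum)

lemma Tm_one: "Tm (\<lambda>_. 1) = 0"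
  by (rule gmon_eqI) (auto simp: diagonal_def)

lemma transp_Pm: "bij w \<Longrightarrow> transp (gr (Pm w)) = gr (Pm (finv w))"
  by (simp add: transp_def Tm_one)

lemma transp_Tm: "diagonal t \<Longrightarrow> transp (gr (Tm t)) = gr (Tm t)"
  by (simp add: transp_def Pm_id[unfolded id_def] inv_id[unfolded id_def] id_def)

lemma transp_Ed: "finite I \<Longrightarrow> transp (Ed I \<chi>) = Ed I \<chi>"
  by (simp add: Ed_def transp_linear transp_Tm D_diagonal)

lemma transp_conj_sum: "transp (conj_sum (sym_group N) x) = conj_sum (sym_group N) (transp x)"
proof -
  have "transp (gr k * x * gr (- k)) = gr k * transp x * gr (- k)" if "k \<in> sym_group N" for k
  proof -
    obtain w where "k = Pm w" "bij w" using \<open>k \<in> sym_group N\<close> by (auto simp: sym_group_def permutes_bij)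
    then show ?thesis
      by (simp add: transp_mult transp_Pm Pm_uminus bij_imp_bij_inv inv_inv_eq mult.assoc)
  qed
  then show ?thesis by (simp add: conj_sum_def transp_linear)
qed

text \<open>An invariant element equals its normalised average over \<open>sym_group n\<close>, so
  it suffices to compare the averages of a labelled permutation and its transpose. The reflection
  that inverts \<open>w\<close> fixes \<open>n\<close> and preserves the labels; it lies in
  \<open>sym_group n\<close> and conjugates one to the other.\<close>

lemma transp_invariant:
  assumes y: "y \<in> alg (full_group m (Suc n))" "y \<in> commutant (full_group m n)"
  shows "transp y = y"
proof -
  let ?S = "sym_group n"
  have Sn: "?S \<subseteq> full_group m n" by (auto simp: sym_group_def Pm_full)
  have "card ?S \<noteq> 0" using sym_group[of n] by (auto simp: finite_subgroup_def)
  moreover have "conj_sum ?S y = of_nat (card ?S) \<cdot> y"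
    using y(2) Sn by (intro conj_sum_of_commutant) (auto simp: commutant_def)
  ultimately have y': "y = (1 / of_nat (card ?S)) \<cdot> conj_sum ?S y" by simp
  have "y \<in> invariant_span (Suc n)"
    using y Tm_full[of _ "{..<n}" n] by (intro commuting_invariant_span) (auto simp: commutant_def)
  then obtain a where a: "y = (\<Sum>(w, \<chi>)\<in>invariant_pairs (Suc n). a w \<chi> \<cdot> Xw w {..<Suc n} \<chi>)"
    unfolding invariant_span_def by blast
  have "conj_sum ?S (transp (Xw w {..<Suc n} \<chi>)) = conj_sum ?S (Xw w {..<Suc n} \<chi>)"
    if "(w, \<chi>) \<in> invariant_pairs (Suc n)" for w \<chi>
  proof -
    have w: "w permutes {..<Suc n}" "\<And>i. i < Suc n \<Longrightarrow> \<chi> (w i) = \<chi> i"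
      using \<open>(w, \<chi>) \<in> _\<close> by (auto simp: invariant_pairs_def)
    have bw: "bij w" "bij (finv w)" using w by (auto intro: permutes_bij bij_imp_bij_inv)
    obtain v where v: "v permutes ({..<Suc n} - {n})" "v \<circ> w = finv w \<circ> v"
      "\<forall>\<chi> :: nat \<Rightarrow> nat. (\<forall>i\<in>{..<Suc n}. \<chi> (w i) = \<chi> i) \<longrightarrow> (\<forall>i\<in>{..<Suc n}. \<chi> (v i) = \<chi> i)"
      by (rule reflection_exists[OF w(1), of n]) auto
    have vn: "v permutes {..<n}" using v(1) by (simp add: lessThan_Suc)
    have vS: "v permutes {..<Suc n}" using vn by (rule permutes_subset) auto
    have bv: "bij v" using vn by (rule permutes_bij)
    have iv: "v (finv v i) = i" for i using bv by (simp add: bij_is_surj surj_f_inv_f)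
    have "transp (Xw w {..<Suc n} \<chi>) = Ed {..<Suc n} \<chi> * gr (Pm (finv w))"
      by (simp add: Xw_def transp_mult transp_Pm bw transp_Ed)
    also have "Ed {..<Suc n} \<chi> * gr (Pm (finv w)) = gr (Pm (finv w)) * Ed {..<Suc n} \<chi>"
    proof -
      have "gr (Pm (finv w)) * Ed {..<Suc n} \<chi> = Ed (finv w ` {..<Suc n}) (\<chi> \<circ> finv (finv w)) * gr (Pm (finv w))"
        by (rule Ed_conj[OF _ bw(2)]) simp
      also have "finv w ` {..<Suc n} = {..<Suc n}" by (rule permutes_image[OF permutes_inv[OF w(1)]])
      also have "finv (finv w) = w" by (rule inv_inv_eq[OF bw(1)])
      also have "Ed {..<Suc n} (\<chi> \<circ> w) = Ed {..<Suc n} \<chi>" by (rule Ed_cong) (simp add: w(2))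
      finally show ?thesis by simp
    qed
    also have "\<dots> = gr (Pm v) * Xw w {..<Suc n} \<chi> * gr (- Pm v)"
    proof -
      have "v \<circ> w \<circ> finv v = finv w \<circ> (v \<circ> finv v)" by (simp add: v(2) o_assoc)
      also have "\<dots> = finv w" by (simp add: fun_eq_iff iv)
      finally have "v \<circ> w \<circ> finv v = finv w" .
      moreover have "Ed {..<Suc n} (\<chi> \<circ> finv v) = Ed {..<Suc n} \<chi>"
      proof (rule Ed_cong)
        fix i assume "i \<in> {..<Suc n}"
        then have "finv v i \<in> {..<Suc n}" using permutes_in_image[OF permutes_inv[OF vS]] by blast
        then have "\<chi> (v (finv v i)) = \<chi> (finv v i)" using v(3) w(2) by blast
        then show "(\<chi> \<circ> finv v) i = \<chi> i" by (simp add: iv)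
      qed
      ultimately show ?thesis
        using conj_Xw[OF _ bv w(1), of \<chi>] permutes_image[OF vS] by (simp add: Xw_def)
    qed
    finally have "transp (Xw w {..<Suc n} \<chi>) = gr (Pm v) * Xw w {..<Suc n} \<chi> * gr (- Pm v)" .
    moreover have "Pm v \<in> ?S" using vn by (auto simp: sym_group_def)
    ultimately show ?thesis using conj_sum_conj(2)[OF sym_group] by simp
  qed
  then have "conj_sum ?S (transp y) = conj_sum ?S y"
    by (subst (1 2) a) (auto simp: transp_linear conj_sum_sum conj_sum_smul case_prod_unfold intro!: sum.cong)
  then have "transp (conj_sum ?S y) = conj_sum ?S y" by (simp add: transp_conj_sum)
  then show ?thesis using y' transp_linear(2) by metis
qed

text \<open>Gelfand's trick: an anti-automorphism that is the identity on a subalgebra makes the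
  subalgebra commutative.\<close>

lemma invariants_commute:
  assumes "x \<in> alg (full_group m (Suc n))" "x \<in> commutant (full_group m n)"
    and "y \<in> alg (full_group m (Suc n))" "y \<in> commutant (full_group m n)"
  shows "x * y = y * x"
proof -
  have "gr k * (x * y) = (x * y) * gr k" if "k \<in> full_group m n" for k
  proof -
    have "gr k * (x * y) = x * (gr k * y)"
      by (simp add: commutantD[OF assms(2) that] flip: mult.assoc)
    then show ?thesis by (simp add: commutantD[OF assms(4) that] mult.assoc)
  qed
  then have "x * y \<in> commutant (full_group m n)" by (simp add: commutant_def)
  then have "transp (x * y) = x * y"
    using assms by (intro transp_invariant alg_mult full_group)
  then have "x * y = transp (x * y)" by simp
  also have "\<dots> = y * x"
    by (simp only: transp_mult transp_invariant[OF assms(1,2)] transp_invariant[OF assms(3,4)])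
  finally show ?thesis .
qed

subsection \<open>The central elements separate\<close>

lemma conj_sum_sym_group:
  "conj_sum (sym_group N) x = (\<Sum>h | h permutes {..<N}. gr (Pm h) * x * gr (- Pm h))"
  unfolding conj_sum_def sym_group_def by (subst sum.reindex[OF inj_Pm]) simp

lemma conj_sum_zc:
  assumes w: "w permutes I" and I: "I \<subseteq> {..<N}"
  shows "\<exists>k. conj_sum (sym_group N) (Xw w I (\<lambda>_. x)) = k \<cdot> zc x (w, I) N"
proof -
  let ?P = "{h. h permutes {..<N}}"
  define \<phi> where "\<phi> h = (h \<circ> w \<circ> finv h, h ` I)" for h :: "nat \<Rightarrow> nat"
  have fI: "finite I" using I by (rule finite_subset) simp
  have orbit: "\<phi> ` ?P = conj_class (w, I) N"
  proof (intro equalityI subsetI)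
    fix p assume "p \<in> \<phi> ` ?P"
    then obtain h where h: "h permutes {..<N}" "p = \<phi> h" by blast
    then have "bij h" "h ` I \<subseteq> {..<N}" using permutes_image[OF h(1)] I by (auto simp: permutes_bij)
    then show "p \<in> conj_class (w, I) N"
      using conj_permutes[OF _ w] by (auto simp: h \<phi>_def conj_class_def)
  next
    fix p assume "p \<in> conj_class (w, I) N"
    then obtain h where h: "bij h" "p = \<phi> h" "h ` I \<subseteq> {..<N}"
      by (auto simp: conj_class_def \<phi>_def)
    obtain g where g: "g permutes {..<N}" "\<And>i. i \<in> I \<Longrightarrow> g i = h i"
      by (rule permutes_extension[OF _ I, of h]) (use h in \<open>auto simp: bij_def inj_on_def\<close>)
    have "\<phi> g = \<phi> h"
      using conj_permutes_cong[OF permutes_bij[OF g(1)] h(1) w g(2)] g(2) by (auto simp: \<phi>_def)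
    then show "p \<in> \<phi> ` ?P" using g(1) h(2) by (metis imageI mem_Collect_eq)
  qed
  define k where "k = card {h \<in> ?P. \<phi> h = \<phi> id}"
  have fibre: "card {h \<in> ?P. \<phi> h = \<phi> g} = k" if g: "g permutes {..<N}" for g
  proof -
    have bg: "bij g" using g by (rule permutes_bij)
    have gi: "finv g (g i) = i" "g (finv g i) = i" for i
      using bg by (simp_all add: bij_is_inj bij_is_surj surj_f_inv_f)
    have comp: "\<phi> (v \<circ> h) = (v \<circ> fst (\<phi> h) \<circ> finv v, v ` snd (\<phi> h))" if "bij v" "bij h" for v h
      using that by (simp add: \<phi>_def o_inv_distrib o_assoc image_comp)
    have "bij_betw (\<lambda>h. g \<circ> h) {h \<in> ?P. \<phi> h = \<phi> id} {h \<in> ?P. \<phi> h = \<phi> g}"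
    proof (rule bij_betw_byWitness[where f' = "\<lambda>h. finv g \<circ> h"])
      show "(\<lambda>h. g \<circ> h) ` {h \<in> ?P. \<phi> h = \<phi> id} \<subseteq> {h \<in> ?P. \<phi> h = \<phi> g}"
      proof (intro image_subsetI)
        fix h assume "h \<in> {h \<in> ?P. \<phi> h = \<phi> id}"
        then have h: "h permutes {..<N}" "\<phi> h = \<phi> id" by auto
        have "\<phi> (g \<circ> h) = \<phi> (g \<circ> id)"
          by (simp only: comp[OF bg permutes_bij[OF h(1)]] comp[OF bg bij_id] h(2))
        then show "g \<circ> h \<in> {h \<in> ?P. \<phi> h = \<phi> g}"
          using permutes_compose[OF h(1) g] by simp
      qed
      show "(\<lambda>h. finv g \<circ> h) ` {h \<in> ?P. \<phi> h = \<phi> g} \<subseteq> {h \<in> ?P. \<phi> h = \<phi> id}"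
      proof (intro image_subsetI)
        fix h assume "h \<in> {h \<in> ?P. \<phi> h = \<phi> g}"
        then have h: "h permutes {..<N}" "\<phi> h = \<phi> g" by auto
        have "\<phi> (finv g \<circ> h) = \<phi> (finv g \<circ> g)"
          using bg by (simp only: comp[OF bij_imp_bij_inv permutes_bij[OF h(1)]] comp[OF bij_imp_bij_inv] h(2))
        moreover have "finv g \<circ> g = id" by (simp add: fun_eq_iff gi)
        ultimately show "finv g \<circ> h \<in> {h \<in> ?P. \<phi> h = \<phi> id}"
          using permutes_compose[OF h(1) permutes_inv[OF g]] by simp
      qed
    qed (auto simp: fun_eq_iff gi)
    then show ?thesis unfolding k_def by (rule bij_betw_same_card[symmetric])
  qed
  have "conj_sum (sym_group N) (Xw w I (\<lambda>_. x)) = (\<Sum>h\<in>?P. (\<lambda>(w, I). Xw w I (\<lambda>_. x)) (\<phi> h))"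
    unfolding conj_sum_sym_group
  proof (intro sum.cong refl)
    fix h assume "h \<in> ?P"
    then show "gr (Pm h) * Xw w I (\<lambda>_. x) * gr (- Pm h) = (\<lambda>(w, I). Xw w I (\<lambda>_. x)) (\<phi> h)"
      using conj_Xw[OF fI permutes_bij w, of h "{..<N}" "\<lambda>_. x"] by (simp add: \<phi>_def o_def)
  qed
  also have "\<dots> = (\<Sum>p\<in>\<phi> ` ?P. \<Sum>h\<in>{h \<in> ?P. \<phi> h = p}. (\<lambda>(w, I). Xw w I (\<lambda>_. x)) (\<phi> h))"
    by (rule sum.image_gen) (simp add: finite_permutations)
  also have "\<dots> = (\<Sum>p\<in>\<phi> ` ?P. of_nat k \<cdot> (\<lambda>(w, I). Xw w I (\<lambda>_. x)) p)"
  proof (intro sum.cong refl)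
    fix p assume "p \<in> \<phi> ` ?P"
    then obtain g where g: "g permutes {..<N}" "p = \<phi> g" by blast
    have "(\<Sum>h\<in>{h \<in> ?P. \<phi> h = p}. (\<lambda>(w, I). Xw w I (\<lambda>_. x)) (\<phi> h))
        = (\<Sum>h\<in>{h \<in> ?P. \<phi> h = p}. 1 \<cdot> (\<lambda>(w, I). Xw w I (\<lambda>_. x)) p)"
      by (intro sum.cong) auto
    also have "\<dots> = of_nat (card {h \<in> ?P. \<phi> h = p}) \<cdot> (\<lambda>(w, I). Xw w I (\<lambda>_. x)) p"
      by (simp only: sum_smul[symmetric]) simp
    finally show "(\<Sum>h\<in>{h \<in> ?P. \<phi> h = p}. (\<lambda>(w, I). Xw w I (\<lambda>_. x)) (\<phi> h))
        = of_nat k \<cdot> (\<lambda>(w, I). Xw w I (\<lambda>_. x)) p" using fibre[OF g(1)] g(2) by simp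
  qed
  also have "\<dots> = of_nat k \<cdot> zc x (w, I) N" by (simp add: orbit zc_def smul_sum)
  finally show ?thesis by blast
qed

lemma conj_sum_mult_commutant:
  assumes "z \<in> commutant K" "finite_subgroup K"
  shows "conj_sum K x * z = conj_sum K (x * z)"
  unfolding conj_sum_def sum_distrib_right
proof (intro sum.cong refl)
  fix k assume "k \<in> K"
  then have "gr (- k) * z = z * gr (- k)" using assms by (auto simp: commutant_def finite_subgroup_def)
  then show "gr k * x * gr (- k) * z = gr k * (x * z) * gr (- k)" by (simp add: mult.assoc)
qed

lemma Xw_split:
  assumes w1: "w1 permutes I1" and w2: "w2 permutes I2" and I: "finite I1" "finite I2" "I1 \<inter> I2 = {}"
    and x: "\<And>i. i \<in> I2 \<Longrightarrow> \<chi> i = x"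
  shows "Xw (w1 \<circ> w2) (I1 \<union> I2) \<chi> = Xw w1 I1 \<chi> * Xw w2 I2 (\<lambda>_. x)"
proof -
  have b: "bij w1" "bij w2" using w1 w2 by (auto simp: permutes_bij)
  have fix2: "w2 i = i" "finv w2 i = i" if "i \<in> I1" for i
    using that I(3) w2 permutes_inv[OF w2] by (auto simp: permutes_not_in disjoint_iff)
  have "gr (Pm w2) * Ed I1 \<chi> = Ed (w2 ` I1) (\<chi> \<circ> finv w2) * gr (Pm w2)" by (rule Ed_conj[OF I(1) b(2)])
  also have "w2 ` I1 = I1" using fix2 by auto
  also have "Ed I1 (\<chi> \<circ> finv w2) = Ed I1 \<chi>" by (rule Ed_cong) (simp add: fix2)
  finally have c: "gr (Pm w2) * Ed I1 \<chi> = Ed I1 \<chi> * gr (Pm w2)" .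
  have "Xw (w1 \<circ> w2) (I1 \<union> I2) \<chi> = gr (Pm w1) * (gr (Pm w2) * Ed I1 \<chi>) * Ed I2 \<chi>"
    by (simp add: Xw_def Ed_Un[OF I] mult.assoc Pm_add[OF b, symmetric] flip: gr_mult)
  also have "\<dots> = (gr (Pm w1) * Ed I1 \<chi>) * (gr (Pm w2) * Ed I2 \<chi>)" by (simp add: c mult.assoc)
  also have "Ed I2 \<chi> = Ed I2 (\<lambda>_. x)" by (rule Ed_cong) (simp add: x)
  finally show ?thesis by (simp only: Xw_def)
qed

text \<open>Class sums with several labels are generated by those with one label. Splitting off all
  coordinates with label \<open>x\<close> gives \<open>Xw w I \<chi> = A * B\<close>. In the product
  of the averages of \<open>A\<close> and \<open>B\<close>, conjugates of \<open>B\<close> whose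
  domain meets that of \<open>A\<close> are killed by the conflict of labels, and every other one
  contributes the average of \<open>A * B\<close>. The number of the latter is positive, so
  induction on the size of the domain applies.\<close>

lemma conj_sum_scalar:
  fixes p p' :: "gmon galg"
  assumes z: "\<And>x c. x < m \<Longrightarrow> \<exists>s. zc x c N * p = s \<cdot> p \<and> zc x c N * p' = s \<cdot> p'"
    and w: "w permutes I" "I \<subseteq> {..<N}" and \<chi>: "\<And>i. i \<in> I \<Longrightarrow> \<chi> i < m" "\<And>i. i \<in> I \<Longrightarrow> \<chi> (w i) = \<chi> i"
  shows "\<exists>s. conj_sum (sym_group N) (Xw w I \<chi>) * p = s \<cdot> p \<and> conj_sum (sym_group N) (Xw w I \<chi>) * p' = s \<cdot> p'"
  using w \<chi>
proof (induction "card I" arbitrary: I w rule: less_induct)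
  case less
  let ?S = "sym_group N"
  define C where "C = {y. \<exists>s. y * p = s \<cdot> p \<and> y * p' = s \<cdot> p'}"
  have Cmult: "x * y \<in> C" if "x \<in> C" "y \<in> C" for x y
  proof -
    obtain s t where "x * p = s \<cdot> p" "x * p' = s \<cdot> p'" "y * p = t \<cdot> p" "y * p' = t \<cdot> p'"
      using \<open>x \<in> C\<close> \<open>y \<in> C\<close> by (auto simp: C_def)
    then show ?thesis by (auto simp: C_def mult.assoc intro!: exI[of _ "t * s"])
  qed
  have Csmul: "s \<cdot> x \<in> C" if "x \<in> C" for s x using that by (auto simp: C_def)
  have fI: "finite I" using less.prems(2) by (rule finite_subset) simp
  show ?case
  proof (cases "I = {}")
    case True
    then have "w = id" using less.prems(1) by simp
    then have "conj_sum ?S (Xw w I \<chi>) = conj_sum ?S 1" by (simp add: Xw_def True Ed_empty Pm_id[unfolded id_def])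
    also have "\<dots> = of_nat (card ?S) \<cdot> 1" by (rule conj_sum_of_commutant) (simp add: commutant_def)
    finally show ?thesis by auto
  next
    case False
    then obtain i where i: "i \<in> I" by blast
    define x where "x = \<chi> i"
    define I2 where "I2 = {j\<in>I. \<chi> j = x}"
    define I1 where "I1 = {j\<in>I. \<chi> j \<noteq> x}"
    have xm: "x < m" using less.prems(3) i by (simp add: x_def)
    have sub: "I1 \<subseteq> I" "I2 \<subseteq> I" "I1 \<inter> I2 = {}" "I1 \<union> I2 = I" by (auto simp: I1_def I2_def)
    have f12: "finite I1" "finite I2" using sub fI by (auto intro: finite_subset)
    have wI: "w j \<in> I" if "j \<in> I" for j using that less.prems(1) by (simp add: permutes_in_image)
    have w1: "w j \<in> I1" if "j \<in> I1" for j using that wI less.prems(4) by (auto simp: I1_def)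
    have w2: "w j \<in> I2" if "j \<in> I2" for j using that wI less.prems(4) by (auto simp: I2_def)
    define v1 where "v1 = (\<lambda>j. if j \<in> I1 then w j else j)"
    define v2 where "v2 = (\<lambda>j. if j \<in> I2 then w j else j)"
    have v1: "v1 permutes I1" unfolding v1_def by (rule permutes_restrict[OF less.prems(1) sub(1) fI w1])
    have v2: "v2 permutes I2" unfolding v2_def by (rule permutes_restrict[OF less.prems(1) sub(2) fI w2])
    have "w = v1 \<circ> v2"
    proof
      fix j
      consider "j \<in> I1" "j \<notin> I2" | "j \<in> I2" "w j \<notin> I1" | "j \<notin> I" "j \<notin> I1" "j \<notin> I2"
        using sub w2 by blast
      then show "w j = (v1 \<circ> v2) j"
        using permutes_not_in[OF less.prems(1), of j] by cases (simp_all add: v1_def v2_def)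
    qed
    define A where "A = Xw v1 I1 \<chi>"
    define B where "B = Xw v2 I2 (\<lambda>_. x)"
    have AB: "Xw w I \<chi> = A * B"
      unfolding A_def B_def \<open>w = v1 \<circ> v2\<close> sub(4)[symmetric]
      by (rule Xw_split[OF v1 v2 f12 sub(3)]) (simp add: I2_def)
    have "card I1 < card I"
      using i sub fI by (intro psubset_card_mono) (auto simp: I1_def x_def)
    then have "conj_sum ?S A \<in> C"
      unfolding C_def A_def mem_Collect_eq using less.prems sub v1
      by (intro less.hyps) (auto simp: v1_def)
    moreover obtain k where "conj_sum ?S B = k \<cdot> zc x (v2, I2) N"
      using conj_sum_zc[OF v2, of N x] sub less.prems(2) by (auto simp: B_def)
    then have "conj_sum ?S B \<in> C" using Csmul[of "zc x (v2, I2) N" k] z[OF xm] by (simp add: C_def)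
    ultimately have "conj_sum ?S A * conj_sum ?S B \<in> C" by (rule Cmult)
    moreover have "conj_sum ?S A * conj_sum ?S B
        = of_nat (card {h. h permutes {..<N} \<and> h ` I2 \<inter> I1 = {}}) \<cdot> conj_sum ?S (A * B)"
    proof -
      have "conj_sum ?S A * conj_sum ?S B = conj_sum ?S (A * conj_sum ?S B)"
        by (rule conj_sum_mult_commutant[OF conj_sum_commutant[OF sym_group] sym_group])
      also have "A * conj_sum ?S B = (\<Sum>h | h permutes {..<N}. A * (gr (Pm h) * B * gr (- Pm h)))"
        by (simp add: conj_sum_sym_group sum_distrib_left)
      also have "conj_sum ?S \<dots> = (\<Sum>h | h permutes {..<N}. conj_sum ?S (A * (gr (Pm h) * B * gr (- Pm h))))"
        by (rule conj_sum_sum)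
      also have "\<dots> = (\<Sum>h | h permutes {..<N}. if h ` I2 \<inter> I1 = {} then 1 \<cdot> conj_sum ?S (A * B) else 0)"
      proof (intro sum.cong refl)
        fix h assume "h \<in> {h. h permutes {..<N}}"
        then have h: "h permutes {..<N}" "bij h" by (auto simp: permutes_bij)
        show "conj_sum ?S (A * (gr (Pm h) * B * gr (- Pm h)))
            = (if h ` I2 \<inter> I1 = {} then 1 \<cdot> conj_sum ?S (A * B) else 0)"
        proof (cases "h ` I2 \<inter> I1 = {}")
          case False
          then obtain j where j: "j \<in> h ` I2" "j \<in> I1" by blast
          have hB: "gr (Pm h) * B * gr (- Pm h) = Xw (h \<circ> v2 \<circ> finv h) (h ` I2) (\<lambda>_. x)"
            using conj_Xw[OF f12(2) h(2) v2, of "\<lambda>_. x"] by (simp add: B_def o_def)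
          have pv: "(h \<circ> v2 \<circ> finv h) permutes (h ` I2)" by (rule conj_permutes[OF h(2) v2])
          have "gr (Pm (h \<circ> v2 \<circ> finv h)) * Ed (h ` I2) (\<lambda>_. x)
              = Ed (h ` I2) (\<lambda>_. x) * gr (Pm (h \<circ> v2 \<circ> finv h))"
            using Ed_conj[OF finite_imageI[OF f12(2), of h] permutes_bij[OF pv], of "\<lambda>_. x"]
              permutes_image[OF pv] by (simp add: o_def)
          moreover have "Ed I1 \<chi> * Ed (h ` I2) (\<lambda>_. x) = 0"
            using j f12 xm less.prems(3) by (intro Ed_orthogonal[of _ _ j]) (auto simp: I1_def)
          ultimately have "A * (gr (Pm h) * B * gr (- Pm h)) = 0"
            unfolding hB by (simp add: A_def Xw_def mult.assoc assoc_rewrite[of "Ed I1 \<chi>" _ 0])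
          then show ?thesis using False by (simp add: conj_sum_0)
        next
          case True
          \<comment> \<open>Simultaneous conjugation: \<open>g\<close> fixes the domain of
            \<open>A\<close> pointwise and acts like \<open>h\<close> on that of \<open>B\<close>.
            Disjointness makes the prescription injective.\<close>
          obtain g where g: "g permutes {..<N}" "\<And>j. j \<in> I \<Longrightarrow> g j = (if j \<in> I1 then j else h j)"
          proof (rule permutes_extension[OF _ less.prems(2), of "\<lambda>j. if j \<in> I1 then j else h j"])
            have "h j \<notin> I1" if "j \<in> I" "j \<notin> I1" for j using True that sub(4) by auto
            then show "inj_on (\<lambda>j. if j \<in> I1 then j else h j) I"
              using h(2) by (auto simp: inj_on_def bij_def)
            show "(\<lambda>j. if j \<in> I1 then j else h j) ` I \<subseteq> {..<N}"
              using less.prems(2) permutes_in_image[OF h(1)] by auto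
          qed auto
          have bg: "bij g" using g(1) by (rule permutes_bij)
          have "gr (Pm g) * A * gr (- Pm g) = gr (Pm id) * A * gr (- Pm id)"
            unfolding A_def using g(2) sub by (intro conj_Xw_cong[OF f12(1) v1 bg]) auto
          then have gA: "gr (Pm g) * A * gr (- Pm g) = A" by simp
          have gB: "gr (Pm g) * B * gr (- Pm g) = gr (Pm h) * B * gr (- Pm h)"
            unfolding B_def using g(2) sub by (intro conj_Xw_cong[OF f12(2) v2 bg h(2)]) auto
          have "A * (gr (Pm h) * B * gr (- Pm h)) = (gr (Pm g) * A * gr (- Pm g)) * (gr (Pm g) * B * gr (- Pm g))"
            by (simp only: gA gB)
          also have "\<dots> = gr (Pm g) * (A * B) * gr (- Pm g)" by (simp add: mult.assoc)
          finally have "conj_sum ?S (A * (gr (Pm h) * B * gr (- Pm h))) = conj_sum ?S (A * B)"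
            using conj_sum_conj(2)[OF sym_group, of "Pm g" N "A * B"] g(1) by (simp add: sym_group_def)
          then show ?thesis using True by simp
        qed
      qed
      also have "\<dots> = (\<Sum>h\<in>{h \<in> {h. h permutes {..<N}}. h ` I2 \<inter> I1 = {}}. 1 \<cdot> conj_sum ?S (A * B))"
        by (rule sum.inter_filter[symmetric]) (simp add: finite_permutations)
      also have "\<dots> = of_nat (card {h. h permutes {..<N} \<and> h ` I2 \<inter> I1 = {}}) \<cdot> conj_sum ?S (A * B)"
        by (simp only: sum_smul[symmetric]) simp
      finally show ?thesis .
    qed
    moreover have "card {h. h permutes {..<N} \<and> h ` I2 \<inter> I1 = {}} \<noteq> 0"
    proof -
      have "finite {h. h permutes {..<N} \<and> h ` I2 \<inter> I1 = {}}"
        by (rule finite_subset[OF _ finite_permutations[of "{..<N}"]]) auto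
      moreover have "id \<in> {h. h permutes {..<N} \<and> h ` I2 \<inter> I1 = {}}"
        using sub(3) by (auto simp: permutes_id)
      ultimately show ?thesis unfolding card_eq_0_iff by blast
    qed
    ultimately have "conj_sum ?S (A * B) \<in> C"
      using Csmul[of "conj_sum ?S A * conj_sum ?S B" "1 / of_nat (card {h. h permutes {..<N} \<and> h ` I2 \<inter> I1 = {}})"]
      by simp
    then show ?thesis by (simp add: C_def AB)
  qed
qed

text \<open>A central element is a combination of averages of labelled permutations. By
  \<open>conj_sum_scalar\<close> these act on \<open>p\<close> and \<open>p'\<close> by common
  scalars, which is what \<open>primitive_separation\<close> asks for.\<close>

lemma zc_separation:
  assumes p: "primitive (full_group m N) p" "primitive (full_group m N) p'"
    and z: "\<And>x c. x < m \<Longrightarrow> \<exists>s. zc x c N * p = s \<cdot> p \<and> zc x c N * p' = s \<cdot> p'"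
  shows "\<exists>x\<in>alg (full_group m N). p * x * p' \<noteq> 0"
proof -
  let ?S = "sym_group N"
  have central: "\<exists>s. y * p = s \<cdot> p \<and> y * p' = s \<cdot> p'"
    if y: "y \<in> alg (full_group m N)" "y \<in> commutant (full_group m N)" for y
  proof -
    have Sn: "?S \<subseteq> full_group m N" by (auto simp: sym_group_def Pm_full)
    have S0: "card ?S \<noteq> 0" using sym_group[of N] by (auto simp: finite_subgroup_def)
    have "conj_sum ?S y = of_nat (card ?S) \<cdot> y"
      using y(2) Sn by (intro conj_sum_of_commutant) (auto simp: commutant_def)
    with S0 have y': "y = (1 / of_nat (card ?S)) \<cdot> conj_sum ?S y" by simp
    have "y \<in> invariant_span N"
      using y Tm_full[of _ "{..<N - 1}" N] by (intro commuting_invariant_span) (auto simp: commutant_def)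
    then obtain a where a: "y = (\<Sum>(w, \<chi>)\<in>invariant_pairs N. a w \<chi> \<cdot> Xw w {..<N} \<chi>)"
      unfolding invariant_span_def by blast
    have "\<exists>s. conj_sum ?S (Xw w {..<N} \<chi>) * p = s \<cdot> p \<and> conj_sum ?S (Xw w {..<N} \<chi>) * p' = s \<cdot> p'"
      if "(w, \<chi>) \<in> invariant_pairs N" for w \<chi>
      using that by (intro conj_sum_scalar z) (auto simp: invariant_pairs_def PiE_def Pi_def)
    then obtain s where s: "\<And>w \<chi>. (w, \<chi>) \<in> invariant_pairs N \<Longrightarrow>
        conj_sum ?S (Xw w {..<N} \<chi>) * p = s w \<chi> \<cdot> p \<and> conj_sum ?S (Xw w {..<N} \<chi>) * p' = s w \<chi> \<cdot> p'"
      by metis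
    have cy: "conj_sum ?S y = (\<Sum>(w, \<chi>)\<in>invariant_pairs N. a w \<chi> \<cdot> conj_sum ?S (Xw w {..<N} \<chi>))"
      by (subst a) (simp add: conj_sum_sum conj_sum_smul case_prod_unfold)
    define \<sigma> where "\<sigma> = (\<Sum>(w, \<chi>)\<in>invariant_pairs N. a w \<chi> * s w \<chi>)"
    have "conj_sum ?S y * p = \<sigma> \<cdot> p"
      unfolding cy sum_distrib_right \<sigma>_def sum_smul using s by (intro sum.cong) auto
    moreover have "conj_sum ?S y * p' = \<sigma> \<cdot> p'"
      unfolding cy sum_distrib_right \<sigma>_def sum_smul using s by (intro sum.cong) auto
    ultimately have "y * p = (1 / of_nat (card ?S) * \<sigma>) \<cdot> p \<and> y * p' = (1 / of_nat (card ?S) * \<sigma>) \<cdot> p'"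
      by (subst (1 2) y') simp
    then show ?thesis by blast
  qed
  show ?thesis
    by (rule primitive_separation[OF full_group p central]) blast+
qed

subsection \<open>Branching for the monomial groups\<close>

lemma graded_full_group:
  assumes "m = d * e"
  shows "graded_group (full_group m N) (omega d) e"
proof
  show "finite_subgroup (full_group m N)" by (rule full_group)
  show "omega d (g + h) = omega d g * omega d h" for g h by (rule omega_add)
  show "e > 0" using m assms by (cases e) auto
  fix g assume "g \<in> full_group m N"
  then have g: "cf g \<in> D {..<N}" by (simp add: full_group_iff)
  have "Prod_any (cf g) = (\<Prod>i<N. cf g i)"
    using g by (intro Prod_any.expand_superset) (auto simp: diag_group_def)
  then have "omega d g ^ e = (\<Prod>i<N. cf g i) ^ m"
    by (simp add: omega_def assms power_mult)
  also have "\<dots> = 1" using g by (simp add: prod_power_distrib diag_group_def)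
  finally show "omega d g ^ e = 1" .
qed

text \<open>Labels are exponents and hence naturals below \<open>m\<close>, while
  \<open>branching\<close> indexes by integers; reduction modulo \<open>m\<close> translates between
  the two and makes the rotation by \<open>d\<close> cyclic.\<close>

lemma branching_full_group:
  assumes md: "m = d * e"
  shows "branching (full_group m (Suc n)) (full_group m n) (omega d) e d m
    (\<lambda>x c. zc (nat (x mod int m)) c (Suc n)) (\<lambda>x c. zc (nat (x mod int m)) c n)
    (\<lambda>a. Ed {n} (\<lambda>_. nat (a mod int m))) (id, {0})"
proof -
  have dpos: "d > 0" using m md by (cases d) auto
  have nat_lt: "nat (x mod int m) < m" for x using m by (simp add: nat_less_iff)
  have nat_eq: "nat (x mod int m) = nat (y mod int m) \<longleftrightarrow> [x = y] (mod int m)" for x y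
    using m by (simp add: cong_def eq_nat_nat_iff)
  have shift: "[nat ((x + int d) mod int m) = nat (x mod int m) + d] (mod m)" for x
  proof -
    have "[(x + int d) mod int m = x mod int m + int d] (mod int m)"
      by (simp add: cong_def mod_add_left_eq)
    then have "[int (nat ((x + int d) mod int m)) = int (nat (x mod int m) + d)] (mod int m)"
      using m by simp
    then show ?thesis by (simp only: cong_int_iff)
  qed
  have sub: "full_group m n \<subseteq> full_group m (Suc n)"
    using permutes_subset[of _ "{..<n}" "{..<Suc n}"] D_mono[of "{..<n}" "{..<Suc n}"]
    by (auto simp: full_group_iff)
  show ?thesis
  proof (intro branching.intro branching_axioms.intro graded_full_group[OF md] sub md dpos)
    show "x * y = y * x" if "x \<in> alg (full_group m (Suc n))" "x \<in> commutant (full_group m n)"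
      "y \<in> alg (full_group m (Suc n))" "y \<in> commutant (full_group m n)" for x y
      using that by (rule invariants_commute)
    show "Ed {n} (\<lambda>_. nat (a mod int m)) \<in> alg (full_group m (Suc n))" for a by (rule Ed_alg) auto
    show "Ed {n} (\<lambda>_. nat (a mod int m)) \<in> commutant (full_group m n)" for a
    proof (rule commutant_full)
      fix w assume w: "w permutes {..<n}"
      have "w n = n" using w by (simp add: permutes_not_in)
      then show "gr (Pm w) * Ed {n} (\<lambda>_. nat (a mod int m)) = Ed {n} (\<lambda>_. nat (a mod int m)) * gr (Pm w)"
        using Ed_conj[of "{n}" w "\<lambda>_. nat (a mod int m)"] permutes_bij[OF w] by (simp add: o_def)
    next
      fix t assume "t \<in> D {..<n}"
      then show "gr (Tm t) * Ed {n} (\<lambda>_. nat (a mod int m)) = Ed {n} (\<lambda>_. nat (a mod int m)) * gr (Tm t)"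
        by (intro Tm_Ed_commute) (auto intro: D_diagonal)
    qed
    have "(\<Sum>a<m. Ed {n} (\<lambda>_. nat (int a mod int m))) = (\<Sum>a<m. Ed {n} (\<lambda>_. a))"
      by (intro sum.cong) auto
    then show "(\<Sum>a<m. Ed {n} (\<lambda>_. nat (int a mod int m))) = 1" by (simp add: Ed_single_sum)
    fix x y a :: int and c :: "(nat \<Rightarrow> nat) \<times> nat set"
    show "zc (nat (x mod int m)) c (Suc n) = zc (nat (y mod int m)) c (Suc n)" if "[x = y] (mod int m)"
      using that nat_eq by metis
    show "zc (nat (x mod int m)) c n = zc (nat (y mod int m)) c n" if "[x = y] (mod int m)"
      using that nat_eq by metis
    show "(zc (nat (x mod int m)) c (Suc n) - zc (nat (x mod int m)) c n) * Ed {n} (\<lambda>_. nat (a mod int m)) = 0"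
      if "\<not> [x = a] (mod int m)"
      using that nat_eq nat_lt by (intro zc_diff_orthogonal) auto
    show "(zc (nat (x mod int m)) (id, {0}) (Suc n) - zc (nat (x mod int m)) (id, {0}) n) * Ed {n} (\<lambda>_. nat (a mod int m))
        = Ed {n} (\<lambda>_. nat (a mod int m))" if "[x = a] (mod int m)"
    proof -
      have "nat (a mod int m) = nat (x mod int m)" using that nat_eq by metis
      then show ?thesis using zc_diff_point by simp
    qed
    show "twist (omega d) (zc (nat ((x + int d) mod int m)) c (Suc n)) = zc (nat (x mod int m)) c (Suc n)"
      "twist (omega d) (zc (nat ((x + int d) mod int m)) c n) = zc (nat (x mod int m)) c n"
      by (rule twist_zc[OF shift])+
  next
    have "\<exists>x\<in>alg (full_group m N). q * x * q' \<noteq> 0"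
      if "primitive (full_group m N) q" "primitive (full_group m N) q'"
        "\<And>x c. \<exists>s. zc (nat (x mod int m)) c N * q = s \<cdot> q \<and> zc (nat (x mod int m)) c N * q' = s \<cdot> q'" for N q q'
    proof (rule zc_separation[OF that(1,2)])
      fix x c assume "x < m"
      then have "nat (int x mod int m) = x" by simp
      then show "\<exists>s. zc x c N * q = s \<cdot> q \<and> zc x c N * q' = s \<cdot> q'" using that(3)[of "int x" c] by simp
    qed
    then show "primitive (full_group m (Suc n)) q \<Longrightarrow> primitive (full_group m (Suc n)) q' \<Longrightarrow>
        (\<And>x c. \<exists>s. zc (nat (x mod int m)) c (Suc n) * q = s \<cdot> q \<and> zc (nat (x mod int m)) c (Suc n) * q' = s \<cdot> q') \<Longrightarrow>
        \<exists>x\<in>alg (full_group m (Suc n)). q * x * q' \<noteq> 0"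
      "primitive (full_group m n) q \<Longrightarrow> primitive (full_group m n) q' \<Longrightarrow>
        (\<And>x c. \<exists>s. zc (nat (x mod int m)) c n * q = s \<cdot> q \<and> zc (nat (x mod int m)) c n * q' = s \<cdot> q') \<Longrightarrow>
        \<exists>x\<in>alg (full_group m n). q * x * q' \<noteq> 0" for q q'
      by blast+
  qed (rule zc_alg zc_commutant)+
qed

end

section \<open>From linear dependence in a corner to the trace of an idempotent matrix\<close>

section \<open>Matrix coefficients\<close>

text \<open>The columns of an idempotent matrix are fixed vectors, so at most two of them are
  independent. If all columns are combinations of \<open>b\<close> and \<open>b'\<close>, the
  equations \<open>A b = b\<close> and \<open>A b' = b'\<close> determine the sums of products of
  coefficients that make up the trace.\<close>

lemma idempotent_trace_le_2:
  fixes A :: "nat \<Rightarrow> nat \<Rightarrow> complex"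
  assumes idem: "\<And>i j. i < n \<Longrightarrow> j < n \<Longrightarrow> (\<Sum>k<n. A i k * A k j) = A i j"
    and dep: "\<And>v :: nat \<Rightarrow> nat \<Rightarrow> complex. (\<And>i k. k < n \<Longrightarrow> (\<Sum>j<n. A k j * v i j) = v i k) \<Longrightarrow>
      \<exists>c. (\<exists>i<3. c i \<noteq> 0) \<and> (\<forall>k<n. (\<Sum>i<3. c i * v i k) = 0)"
  shows "\<exists>t\<le>2. (\<Sum>i<n. A i i) = of_nat t"
proof -
  define col where "col j k = A k j" for j k
  have fixed: "(\<Sum>j<n. A k j * col i j) = col i k" if "i < n" "k < n" for i k
    using idem that by (simp add: col_def)
  have s3: "(\<Sum>i<3. g i) = g 0 + g 1 + g 2" for g :: "nat \<Rightarrow> complex"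
    by (simp add: numeral_3_eq_3 numeral_2_eq_2)
  show ?thesis
  proof (cases "\<exists>j<n. \<exists>k<n. col j k \<noteq> 0")
    case False
    then have "(\<Sum>i<n. A i i) = 0" by (simp add: col_def)
    then show ?thesis by (intro exI[of _ 0]) simp
  next
    case True
    then obtain j1 k1 where j1: "j1 < n" "k1 < n" "col j1 k1 \<noteq> 0" by blast
    define b where "b = col j1"
    have bA: "b k = (\<Sum>j<n. b j * col j k)" if "k < n" for k
      using fixed[OF j1(1) that] by (simp add: b_def col_def mult.commute)
    show ?thesis
    proof (cases "\<forall>j<n. \<exists>\<alpha>. \<forall>k<n. col j k = \<alpha> * b k")
      case True
      then obtain \<alpha> where \<alpha>: "\<And>j k. j < n \<Longrightarrow> k < n \<Longrightarrow> col j k = \<alpha> j * b k" by metis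
      have "b k1 = (\<Sum>j<n. b j * \<alpha> j) * b k1"
        using bA[OF j1(2)] j1(2) by (simp add: \<alpha> sum_distrib_right mult.assoc)
      then have "(\<Sum>j<n. b j * \<alpha> j) = 1" using j1(3) by (simp add: b_def)
      moreover have "(\<Sum>i<n. A i i) = (\<Sum>j<n. b j * \<alpha> j)"
      proof (intro sum.cong refl)
        fix j assume "j \<in> {..<n}"
        then have "col j j = \<alpha> j * b j" by (simp add: \<alpha>)
        then show "A j j = b j * \<alpha> j" by (simp add: col_def)
      qed
      ultimately show ?thesis by (intro exI[of _ 1]) simp
    next
      case False
      then obtain j2 where j2: "j2 < n" and nm: "\<And>\<alpha>. \<exists>k<n. col j2 k \<noteq> \<alpha> * b k" by blast
      define b' where "b' = col j2"
      have bA': "b' k = (\<Sum>j<n. b' j * col j k)" if "k < n" for k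
        using fixed[OF j2 that] by (simp add: b'_def col_def mult.commute)
      have indep: "x = 0 \<and> y = 0" if xy: "\<And>k. k < n \<Longrightarrow> x * b k + y * b' k = 0" for x y
      proof -
        have "y = 0"
        proof (rule ccontr)
          assume y: "y \<noteq> 0"
          obtain k where k: "k < n" "b' k \<noteq> (- x / y) * b k" using nm[of "- x / y"] by (auto simp: b'_def)
          then show False using xy[OF k(1)] y by (simp add: field_simps add_eq_0_iff2)
        qed
        then show ?thesis using xy[OF j1(2)] j1(3) by (simp add: b_def)
      qed
      have "\<forall>j. \<exists>\<alpha> \<beta>. j < n \<longrightarrow> (\<forall>k<n. col j k = \<alpha> * b k + \<beta> * b' k)"
      proof (intro allI)
        fix j
        show "\<exists>\<alpha> \<beta>. j < n \<longrightarrow> (\<forall>k<n. col j k = \<alpha> * b k + \<beta> * b' k)"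
        proof (cases "j < n")
          case True
          define v where "v i = (if i = 0 then b else if i = 1 then b' else col j)" for i :: nat
          have "(\<Sum>l<n. A k l * v i l) = v i k" if "k < n" for i k
            using fixed j1 j2 True that by (simp add: v_def b_def b'_def)
          then obtain c where c: "\<exists>i<3. c i \<noteq> 0" "\<And>k. k < n \<Longrightarrow> (\<Sum>i<3. c i * v i k) = 0"
            using dep[of v] by blast
          have c': "c 0 * b k + c 1 * b' k + c 2 * col j k = 0" if "k < n" for k
            using c(2)[OF that] by (simp add: s3 v_def)
          have c2: "c 2 \<noteq> 0"
          proof
            assume "c 2 = 0"
            then have "c 0 = 0 \<and> c 1 = 0" using c' by (intro indep) simp
            then have "c i = 0" if "i < 3" for i
              using that \<open>c 2 = 0\<close> by (auto simp: numeral_3_eq_3 numeral_2_eq_2 less_Suc_eq)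
            then show False using c(1) by blast
          qed
          have "col j k = (- c 0 / c 2) * b k + (- c 1 / c 2) * b' k" if "k < n" for k
          proof -
            have "c 2 * col j k = - (c 0 * b k + c 1 * b' k)"
              using c'[OF that] by (simp add: add_eq_0_iff)
            then have "col j k = - (c 0 * b k + c 1 * b' k) / c 2" using c2 by (simp add: field_simps)
            then show ?thesis by (simp add: add_divide_distrib diff_divide_distrib)
          qed
          then show ?thesis by blast
        qed simp
      qed
      then obtain \<alpha> \<beta> where \<alpha>\<beta>: "\<And>j k. j < n \<Longrightarrow> k < n \<Longrightarrow> col j k = \<alpha> j * b k + \<beta> j * b' k"
        by metis
      have expand: "(\<Sum>j<n. u j * col j k) = (\<Sum>j<n. u j * \<alpha> j) * b k + (\<Sum>j<n. u j * \<beta> j) * b' k"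
        if "k < n" for u k
      proof -
        have "(\<Sum>j<n. u j * col j k) = (\<Sum>j<n. u j * \<alpha> j * b k + u j * \<beta> j * b' k)"
          using that by (intro sum.cong refl) (simp add: \<alpha>\<beta> algebra_simps)
        then show ?thesis by (simp add: sum.distrib sum_distrib_right)
      qed
      have "(\<Sum>j<n. b j * \<alpha> j) - 1 = 0 \<and> (\<Sum>j<n. b j * \<beta> j) = 0"
        by (rule indep) (use bA expand[of _ b] in \<open>simp add: algebra_simps\<close>)
      moreover have "(\<Sum>j<n. b' j * \<alpha> j) = 0 \<and> (\<Sum>j<n. b' j * \<beta> j) - 1 = 0"
        by (rule indep) (use bA' expand[of _ b'] in \<open>simp add: algebra_simps\<close>)
      moreover have "(\<Sum>i<n. A i i) = (\<Sum>j<n. b j * \<alpha> j) + (\<Sum>j<n. b' j * \<beta> j)"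
        unfolding sum.distrib[symmetric]
      proof (intro sum.cong refl)
        fix j assume "j \<in> {..<n}"
        then have "col j j = \<alpha> j * b j + \<beta> j * b' j" by (simp add: \<alpha>\<beta>)
        then show "A j j = b j * \<alpha> j + b' j * \<beta> j" by (simp add: col_def mult.commute)
      qed
      ultimately show ?thesis by (intro exI[of _ 2]) simp
    qed
  qed
qed

text \<open>Multiplicativity and Schur orthogonality are all that the group algebra needs to know
  about an irreducible representation in coordinates.\<close>

locale coefficients =
  fixes L :: "'g::group_add set" and \<mu> :: "'g \<Rightarrow> nat \<Rightarrow> nat \<Rightarrow> complex" and n :: nat
  assumes L: "finite_subgroup L" and n: "n > 0"
    and mult: "\<And>g h i j. g \<in> L \<Longrightarrow> h \<in> L \<Longrightarrow> i < n \<Longrightarrow> j < n \<Longrightarrow> \<mu> (g + h) i j = (\<Sum>k<n. \<mu> g i k * \<mu> h k j)"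
    and orth: "\<And>i j k l. i < n \<Longrightarrow> j < n \<Longrightarrow> k < n \<Longrightarrow> l < n \<Longrightarrow>
      (\<Sum>g\<in>L. \<mu> g i j * \<mu> (- g) k l) = (if i = l \<and> j = k then of_nat (card L) / of_nat n else 0)"
begin

definition mx :: "'g galg \<Rightarrow> nat \<Rightarrow> nat \<Rightarrow> complex" where
  "mx x i j = (\<Sum>g\<in>L. lookup x g * \<mu> g i j)"

definition mv :: "'g galg \<Rightarrow> (nat \<Rightarrow> complex) \<Rightarrow> nat \<Rightarrow> complex" where
  "mv x y i = (\<Sum>j<n. mx x i j * y j)"

text \<open>The embedding of the representation space as a left ideal: the coefficient at
  \<open>h\<close> is entry 0 of the vector \<open>\<mu> (- h) y\<close>. The inverse of
  \<open>h\<close> makes it equivariant for left multiplication.\<close>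

definition phi :: "(nat \<Rightarrow> complex) \<Rightarrow> 'g galg" where
  "phi y = (\<Sum>h\<in>L. (\<Sum>k<n. \<mu> (- h) 0 k * y k) \<cdot> gr h)"

text \<open>Normalised so that its matrix is the matrix unit at position (0, 0), see
  \<open>mx_idem\<close>; the image of \<open>phi\<close> is the left ideal it generates.\<close>

definition idem :: "'g galg" where
  "idem = (of_nat n / of_nat (card L)) \<cdot> phi (\<lambda>i. if i = 0 then 1 else 0)"

lemma finL: "finite L" and subL: "0 \<in> L" "g \<in> L \<Longrightarrow> h \<in> L \<Longrightarrow> g + h \<in> L" "g \<in> L \<Longrightarrow> - g \<in> L"
  using L by (auto simp: finite_subgroup_def)

lemma cardL: "card L > 0" using finL subL(1) by (auto simp: card_gt_0_iff)

lemma mx_gr: "g \<in> L \<Longrightarrow> mx (gr g) i j = \<mu> g i j"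
proof -
  assume "g \<in> L"
  then have "mx (gr g) i j = (\<Sum>h\<in>L. if h = g then \<mu> g i j else 0)"
    unfolding mx_def by (intro sum.cong) (auto simp: lookup_gr)
  then show ?thesis using \<open>g \<in> L\<close> finL by simp
qed

lemma mx_linear: "mx (x + y) i j = mx x i j + mx y i j" "mx (c \<cdot> x) i j = c * mx x i j" "mx 0 i j = 0"
  by (simp_all add: mx_def lookup_add lookup_smul sum.distrib distrib_right sum_distrib_left mult.assoc)

lemma mx_mult:
  assumes x: "x \<in> alg L" and y: "y \<in> alg L" and ij: "i < n" "j < n"
  shows "mx (x * y) i j = (\<Sum>k<n. mx x i k * mx y k j)"
  using finL x
proof (induction rule: alg_induct)
  case (single g c)
  from finL y show ?case
  proof (induction rule: alg_induct)
    case (single h b)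
    then show ?case
      using \<open>g \<in> L\<close> ij
      by (simp add: gr_mult mx_linear mx_gr subL mult sum_distrib_left mult_ac)
  qed (simp_all add: distrib_left mx_linear sum.distrib)
qed (simp_all add: distrib_right mx_linear sum.distrib)

lemma phi_cong: "(\<And>k. k < n \<Longrightarrow> y k = y' k) \<Longrightarrow> phi y = phi y'"
  by (simp add: phi_def)

lemma phi_add: "phi (\<lambda>k. y k + y' k) = phi y + phi y'"
  by (simp add: phi_def distrib_left sum.distrib smul_add_left)

lemma phi_smul: "phi (\<lambda>k. c * y k) = c \<cdot> phi y"
  by (simp add: phi_def smul_sum sum_distrib_left mult_ac)

lemma phi_0: "phi (\<lambda>_. 0) = 0"
  by (simp add: phi_def)

lemma phi_sum: "phi (\<lambda>k. \<Sum>i\<in>A. f i k) = (\<Sum>i\<in>A. phi (f i))"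
  by (induction A rule: infinite_finite_induct) (simp_all add: phi_0 phi_add)

lemma phi_alg: "phi y \<in> alg L"
  unfolding phi_def by (intro alg_sum alg_smul) auto

lemma lookup_phi: "h \<in> L \<Longrightarrow> lookup (phi y) h = (\<Sum>k<n. \<mu> (- h) 0 k * y k)"
proof -
  assume h: "h \<in> L"
  have "lookup (phi y) h = (\<Sum>g\<in>L. if g = h then \<Sum>k<n. \<mu> (- h) 0 k * y k else 0)"
    unfolding phi_def lookup_sum by (intro sum.cong) (auto simp: lookup_smul lookup_gr)
  then show ?thesis using h finL by simp
qed

lemma phi_equivariant:
  assumes x: "x \<in> alg L"
  shows "x * phi y = phi (mv x y)"
  using finL x
proof (induction rule: alg_induct)
  case zero
  then show ?case by (simp add: mv_def mx_linear phi_0)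
next
  case (single g c)
  have "gr g * phi y = (\<Sum>h\<in>L. (\<Sum>k<n. \<mu> (- h) 0 k * y k) \<cdot> gr (g + h))"
    by (simp add: phi_def sum_distrib_left gr_mult)
  also have "\<dots> = (\<Sum>h\<in>L. (\<Sum>k<n. \<mu> (- (g + h) + g) 0 k * y k) \<cdot> gr (g + h))"
    by (simp add: minus_add add.assoc del: add_uminus_conv_diff)
  also have "\<dots> = (\<Sum>h\<in>L. (\<Sum>k<n. \<mu> (- h + g) 0 k * y k) \<cdot> gr h)"
    by (rule sum_subgroup_translate(1)[OF L single, of "\<lambda>h. (\<Sum>k<n. \<mu> (- h + g) 0 k * y k) \<cdot> gr h"])
  also have "\<dots> = phi (mv (gr g) y)"
    unfolding phi_def
  proof (rule sum.cong[OF refl])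
    fix h assume h: "h \<in> L"
    have "(\<Sum>k<n. \<mu> (- h + g) 0 k * y k) = (\<Sum>k<n. \<Sum>l<n. \<mu> (- h) 0 l * \<mu> g l k * y k)"
      using h single n by (intro sum.cong refl) (simp add: mult subL sum_distrib_right)
    also have "\<dots> = (\<Sum>l<n. \<mu> (- h) 0 l * mv (gr g) y l)"
      using single by (subst sum.swap) (simp add: mv_def mx_gr sum_distrib_left mult.assoc)
    finally show "(\<Sum>k<n. \<mu> (- h + g) 0 k * y k) \<cdot> gr h = (\<Sum>k<n. \<mu> (- h) 0 k * mv (gr g) y k) \<cdot> gr h"
      by simp
  qed
  finally have "gr g * phi y = phi (mv (gr g) y)" .
  moreover have "mv (c \<cdot> gr g) y = (\<lambda>k. c * mv (gr g) y k)"
    by (simp add: mv_def mx_linear sum_distrib_left mult.assoc fun_eq_iff)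
  ultimately show ?case by (simp add: phi_smul)
next
  case (add x x')
  have "mv (x + x') y = (\<lambda>k. mv x y k + mv x' y k)"
    by (simp add: mv_def mx_linear distrib_right sum.distrib fun_eq_iff)
  then show ?case using add by (simp add: distrib_right phi_add)
qed

lemma mx_phi:
  assumes ij: "i < n" "j < n"
  shows "mx (phi y) i j = (if j = 0 then of_nat (card L) / of_nat n * y i else 0)"
proof -
  have "mx (phi y) i j = (\<Sum>h\<in>L. \<Sum>k<n. y k * (\<mu> h i j * \<mu> (- h) 0 k))"
    unfolding mx_def by (intro sum.cong refl) (simp add: lookup_phi sum_distrib_right sum_distrib_left mult_ac)
  also have "\<dots> = (\<Sum>k<n. y k * (\<Sum>h\<in>L. \<mu> h i j * \<mu> (- h) 0 k))"
    by (subst sum.swap) (simp add: sum_distrib_left)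
  also have "\<dots> = (\<Sum>k<n. if k = i then (if j = 0 then of_nat (card L) / of_nat n * y i else 0) else 0)"
    using ij n by (intro sum.cong refl) (auto simp: orth)
  also have "\<dots> = (if j = 0 then of_nat (card L) / of_nat n * y i else 0)"
    using ij by simp
  finally show ?thesis .
qed

lemma mx_idem: "i < n \<Longrightarrow> j < n \<Longrightarrow> mx idem i j = (if i = 0 \<and> j = 0 then 1 else 0)"
  using cardL n by (simp add: idem_def mx_linear mx_phi)

lemma phi_eq_0:
  assumes "phi y = 0" "i < n"
  shows "y i = 0"
  using mx_phi[OF assms(2) n, of y] assms cardL n by (simp add: mx_linear)

lemma idem_alg: "idem \<in> alg L"
  unfolding idem_def by (intro alg_smul phi_alg)

lemma phi_idem: "phi y * idem = phi y"
proof -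
  have "phi y * idem = (of_nat n / of_nat (card L)) \<cdot> phi (mv (phi y) (\<lambda>i. if i = 0 then 1 else 0))"
    by (simp add: idem_def phi_equivariant phi_alg)
  also have "phi (mv (phi y) (\<lambda>i. if i = 0 then 1 else 0)) = phi (\<lambda>i. of_nat (card L) / of_nat n * y i)"
  proof (rule phi_cong)
    fix k assume k: "k < n"
    have "mv (phi y) (\<lambda>i. if i = 0 then 1 else 0) k = (\<Sum>j<n. if j = 0 then mx (phi y) k 0 else 0)"
      unfolding mv_def by (intro sum.cong) auto
    then show "mv (phi y) (\<lambda>i. if i = 0 then 1 else 0) k = of_nat (card L) / of_nat n * y k"
      using n k by (simp add: mx_phi)
  qed
  also have "\<dots> = (of_nat (card L) / of_nat n) \<cdot> phi y" by (rule phi_smul)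
  finally show ?thesis using cardL n by simp
qed

lemma idem_primitive: "primitive L idem"
  unfolding primitive_def
proof (intro conjI ballI)
  let ?e = "\<lambda>i::nat. if i = 0 then 1 else (0::complex)"
  let ?c = "of_nat n / of_nat (card L) :: complex"
  show "idem \<in> alg L" by (rule idem_alg)
  show "idem \<noteq> 0" using mx_idem[OF n n] by (auto simp: mx_linear)
  have "phi ?e * idem = phi ?e" by (rule phi_idem)
  then show "idem * idem = idem" by (subst (1 3) idem_def) simp
  fix x assume x: "x \<in> alg L"
  have mve: "mv z ?e k = mx z k 0" for z k
  proof -
    have "mv z ?e k = (\<Sum>j<n. if j = 0 then mx z k 0 else 0)"
      unfolding mv_def by (intro sum.cong) auto
    then show ?thesis using n by simp
  qed
  have "idem * x * idem = ?c \<cdot> (idem * x * phi ?e)" by (subst (2) idem_def) simp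
  also have "idem * x * phi ?e = phi (mv (idem * x) ?e)"
    using L by (intro phi_equivariant alg_mult idem_alg x)
  also have "\<dots> = phi (\<lambda>k. mx x 0 0 * ?e k)"
  proof (rule phi_cong)
    fix k assume k: "k < n"
    have "mx (idem * x) k 0 = (\<Sum>l<n. mx idem k l * mx x l 0)" by (rule mx_mult[OF idem_alg x k n])
    also have "\<dots> = (\<Sum>l<n. if l = 0 then (if k = 0 then mx x 0 0 else 0) else 0)"
      using k by (intro sum.cong) (auto simp: mx_idem)
    finally show "mv (idem * x) ?e k = mx x 0 0 * ?e k" using n by (simp add: mve)
  qed
  also have "\<dots> = mx x 0 0 \<cdot> phi ?e" by (rule phi_smul)
  finally have "idem * x * idem = mx x 0 0 \<cdot> idem" by (simp add: idem_def mult.commute)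
  then show "\<exists>c. idem * x * idem = c \<cdot> idem" by blast
qed

lemma lookup_idem: "g \<in> L \<Longrightarrow> lookup idem g = of_nat n / of_nat (card L) * \<mu> (- g) 0 0"
proof -
  assume g: "g \<in> L"
  have "(\<Sum>k<n. \<mu> (- g) 0 k * (if k = 0 then 1 else 0)) = (\<Sum>k<n. if k = 0 then \<mu> (- g) 0 0 else 0)"
    by (intro sum.cong) auto
  then show ?thesis using g n by (simp add: idem_def lookup_smul lookup_phi)
qed

end

context branching
begin

text \<open>The sum is the trace of \<open>p\<close> in the representation \<open>\<rho>\<close>.
  Vectors fixed by \<open>p\<close> are embedded by \<open>B.phi\<close> into the elements
  \<open>v\<close> with \<open>p * v = v\<close> and \<open>v * B.idem = v\<close>, any three of
  which are dependent by \<open>three_dependent\<close>.\<close>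

lemma trace_le_2:
  assumes big: "coefficients big.H \<rho> N" and small: "coefficients small.H \<mu> u"
  shows "\<exists>t\<le>2. (\<Sum>g\<in>small.H. of_nat u / of_nat (card small.H) * \<mu> (- g) 0 0 * (\<Sum>i<N. \<rho> g i i)) = of_nat t"
proof -
  interpret B: coefficients big.H \<rho> N by (rule big)
  interpret S: coefficients small.H \<mu> u by (rule small)
  define p where "p = S.idem"
  have p: "primitive small.H p" unfolding p_def by (rule S.idem_primitive)
  note pp = primitiveD[OF p]
  have HH: "small.H \<subseteq> big.H" using sub by auto
  have pB: "p \<in> alg big.H" using pp(1) HH by (rule alg_mono[rotated])
  have "\<exists>t\<le>2. (\<Sum>i<N. B.mx p i i) = of_nat t"
  proof (rule idempotent_trace_le_2[where A = "B.mx p"])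
    show "(\<Sum>k<N. B.mx p i k * B.mx p k j) = B.mx p i j" if "i < N" "j < N" for i j
      using B.mx_mult[OF pB pB that] pp(3) by simp
    fix v :: "nat \<Rightarrow> nat \<Rightarrow> complex"
    assume v: "\<And>i k. k < N \<Longrightarrow> (\<Sum>j<N. B.mx p k j * v i j) = v i k"
    have "p * B.phi (v i) = B.phi (v i)" for i
      using v by (simp add: B.phi_equivariant[OF pB] B.mv_def cong: B.phi_cong)
    then obtain c where c: "\<exists>i<3. c i \<noteq> 0" "(\<Sum>i<3. c i \<cdot> B.phi (v i)) = 0"
      using three_dependent[OF p B.idem_primitive, of "\<lambda>i. B.phi (v i)"] B.phi_alg B.phi_idem by blast
    have "B.phi (\<lambda>k. \<Sum>i<3. c i * v i k) = 0" using c(2) by (simp add: B.phi_sum B.phi_smul)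
    then show "\<exists>c. (\<exists>i<3. c i \<noteq> 0) \<and> (\<forall>k<N. (\<Sum>i<3. c i * v i k) = 0)"
      using c(1) B.phi_eq_0 by blast
  qed
  moreover have "(\<Sum>i<N. B.mx p i i)
      = (\<Sum>g\<in>small.H. of_nat u / of_nat (card small.H) * \<mu> (- g) 0 0 * (\<Sum>i<N. \<rho> g i i))"
  proof -
    have "B.mx p i i = (\<Sum>g\<in>small.H. lookup p g * \<rho> g i i)" for i
      unfolding B.mx_def using HH pp(1) B.finL
      by (intro sum.mono_neutral_right) (auto simp: alg_def in_keys_iff)
    then have "(\<Sum>i<N. B.mx p i i) = (\<Sum>g\<in>small.H. lookup p g * (\<Sum>i<N. \<rho> g i i))"
      by (simp add: sum_distrib_left) (rule sum.swap)
    then show ?thesis by (simp add: p_def S.lookup_idem)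
  qed
  ultimately show ?thesis by simp
qed

end

section \<open>Schur's lemma, orthogonality and Maschke's theorem in coordinates\<close>

section \<open>Representations of finite groups\<close>

subsection \<open>Sums and traces of matrices\<close>

text \<open>Matrices of all sizes share one type, so there is no single zero from which to sum; the
  dimensions are passed explicitly, which also settles the empty sum.\<close>

definition msum :: "nat \<Rightarrow> nat \<Rightarrow> ('a \<Rightarrow> complex mat) \<Rightarrow> 'a set \<Rightarrow> complex mat" where
  "msum nr nc f A = mat nr nc (\<lambda>(i, j). \<Sum>a\<in>A. f a $$ (i, j))"

definition mtrace :: "nat \<Rightarrow> complex mat \<Rightarrow> complex" where
  "mtrace n A = (\<Sum>i<n. A $$ (i, i))"

lemma msum_carrier [simp]: "msum nr nc f A \<in> carrier_mat nr nc"
  by (simp add: msum_def)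

lemma mult_entry:
  assumes "A \<in> carrier_mat nr n" "B \<in> carrier_mat n nc" "i < nr" "j < nc"
  shows "(A * B) $$ (i, j) = (\<Sum>k<n. A $$ (i, k) * B $$ (k, j))"
  using assms by (simp add: scalar_prod_def atLeast0LessThan)

lemma mat_vec_entry:
  assumes "A \<in> carrier_mat nr n" "v \<in> carrier_vec n" "i < nr"
  shows "(A *\<^sub>v v) $ i = (\<Sum>k<n. A $$ (i, k) * v $ k)"
  using assms by (simp add: scalar_prod_def atLeast0LessThan)

lemma msum_mult_left:
  assumes X: "X \<in> carrier_mat k nr" and f: "\<And>a. a \<in> A \<Longrightarrow> f a \<in> carrier_mat nr nc"
  shows "X * msum nr nc f A = msum k nc (\<lambda>a. X * f a) A"
proof (rule eq_matI)
  fix i j assume ij: "i < dim_row (msum k nc (\<lambda>a. X * f a) A)" "j < dim_col (msum k nc (\<lambda>a. X * f a) A)"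
  then have ij: "i < k" "j < nc" by (simp_all add: msum_def)
  have "(X * msum nr nc f A) $$ (i, j) = (\<Sum>l<nr. \<Sum>a\<in>A. X $$ (i, l) * f a $$ (l, j))"
    using ij by (simp add: mult_entry[OF X msum_carrier]) (simp add: msum_def sum_distrib_left)
  also have "\<dots> = (\<Sum>a\<in>A. (X * f a) $$ (i, j))"
    by (subst sum.swap) (simp add: mult_entry[OF X f] ij)
  finally show "(X * msum nr nc f A) $$ (i, j) = msum k nc (\<lambda>a. X * f a) A $$ (i, j)"
    using ij by (simp add: msum_def)
qed (use X in \<open>auto simp: msum_def\<close>)

lemma msum_mult_right:
  assumes X: "X \<in> carrier_mat nc k" and f: "\<And>a. a \<in> A \<Longrightarrow> f a \<in> carrier_mat nr nc"
  shows "msum nr nc f A * X = msum nr k (\<lambda>a. f a * X) A"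
proof (rule eq_matI)
  fix i j assume ij: "i < dim_row (msum nr k (\<lambda>a. f a * X) A)" "j < dim_col (msum nr k (\<lambda>a. f a * X) A)"
  then have ij: "i < nr" "j < k" by (simp_all add: msum_def)
  have "(msum nr nc f A * X) $$ (i, j) = (\<Sum>l<nc. \<Sum>a\<in>A. f a $$ (i, l) * X $$ (l, j))"
    using ij by (simp add: mult_entry[OF msum_carrier X]) (simp add: msum_def sum_distrib_right)
  also have "\<dots> = (\<Sum>a\<in>A. (f a * X) $$ (i, j))"
    by (subst sum.swap) (simp add: mult_entry[OF f X] ij)
  finally show "(msum nr nc f A * X) $$ (i, j) = msum nr k (\<lambda>a. f a * X) A $$ (i, j)"
    using ij by (simp add: msum_def)
qed (use X in \<open>auto simp: msum_def\<close>)

lemma msum_cong: "(\<And>a. a \<in> A \<Longrightarrow> f a = g a) \<Longrightarrow> msum nr nc f A = msum nr nc g A"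
  unfolding msum_def by (intro cong_mat) auto

lemma msum_const: "X \<in> carrier_mat nr nc \<Longrightarrow> msum nr nc (\<lambda>_. X) A = of_nat (card A) \<cdot>\<^sub>m X"
  by (intro eq_matI) (auto simp: msum_def)

lemma mtrace_commute:
  assumes "A \<in> carrier_mat n k" "B \<in> carrier_mat k n"
  shows "mtrace n (A * B) = mtrace k (B * A)"
  unfolding mtrace_def
  by (simp add: mult_entry[OF assms] mult_entry[OF assms(2,1)]) (subst sum.swap, simp add: mult.commute)

lemma mtrace_one: "mtrace n (1\<^sub>m n) = of_nat n"
  by (simp add: mtrace_def)

lemma mtrace_four_block:
  assumes "A \<in> carrier_mat n n" "D \<in> carrier_mat k k"
  shows "mtrace (n + k) (four_block_mat A B C D) = mtrace n A + mtrace k D"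
proof -
  have "(\<Sum>i<n + k. four_block_mat A B C D $$ (i, i))
      = (\<Sum>i<n. four_block_mat A B C D $$ (i, i)) + (\<Sum>i<k. four_block_mat A B C D $$ (n + i, n + i))"
    by (induction k) (simp_all add: add.assoc)
  then show ?thesis using assms by (simp add: mtrace_def)
qed

lemma eq_mat_on_vec:
  fixes A B :: "complex mat"
  assumes "A \<in> carrier_mat nr nc" "B \<in> carrier_mat nr nc"
    and eq: "\<And>v. v \<in> carrier_vec nc \<Longrightarrow> A *\<^sub>v v = B *\<^sub>v v"
  shows "A = B"
proof (rule eq_matI)
  fix i j assume "i < dim_row B" "j < dim_col B"
  then have ij: "i < nr" "j < nc" using assms by auto
  have unit: "(M *\<^sub>v unit_vec nc j) $ i = M $$ (i, j)" if M: "M \<in> carrier_mat nr nc" for M :: "complex mat"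
  proof -
    have "(M *\<^sub>v unit_vec nc j) $ i = (\<Sum>l<nc. if l = j then M $$ (i, j) else 0)"
      using M ij by (simp add: scalar_prod_def atLeast0LessThan unit_vec_def if_distrib[of "(*) _"] cong: if_cong)
    then show ?thesis using ij by simp
  qed
  show "A $$ (i, j) = B $$ (i, j)"
    unfolding unit[OF assms(1), symmetric] unit[OF assms(2), symmetric] using eq[of "unit_vec nc j"] by simp
qed (use assms in auto)

lemma scalar_mat_vec: "v \<in> carrier_vec n \<Longrightarrow> (c \<cdot>\<^sub>m 1\<^sub>m n) *\<^sub>v v = c \<cdot>\<^sub>v (v :: complex vec)"
proof (intro eq_vecI)
  fix i assume v: "v \<in> carrier_vec n" and "i < dim_vec (c \<cdot>\<^sub>v v)"
  then have i: "i < n" by simp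
  have "((c \<cdot>\<^sub>m 1\<^sub>m n) *\<^sub>v v) $ i = (\<Sum>l<n. (c \<cdot>\<^sub>m 1\<^sub>m n) $$ (i, l) * v $ l)"
    using v i by (auto simp: scalar_prod_def atLeast0LessThan intro!: sum.cong)
  also have "\<dots> = (\<Sum>l<n. if l = i then c * v $ i else 0)"
    using i by (intro sum.cong) auto
  finally show "((c \<cdot>\<^sub>m 1\<^sub>m n) *\<^sub>v v) $ i = (c \<cdot>\<^sub>v v) $ i" using v i by simp
qed auto

lemma zero_mat_vec: "v \<in> carrier_vec nc \<Longrightarrow> 0\<^sub>m nr nc *\<^sub>v v = 0\<^sub>v nr"
  by (intro eq_vecI) (auto simp: scalar_prod_def)

definition lin_subspace :: "nat \<Rightarrow> complex vec set \<Rightarrow> bool" where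
  "lin_subspace n W \<longleftrightarrow> W \<subseteq> carrier_vec n \<and> 0\<^sub>v n \<in> W \<and>
     (\<forall>v\<in>W. \<forall>w\<in>W. v + w \<in> W) \<and> (\<forall>c. \<forall>v\<in>W. c \<cdot>\<^sub>v v \<in> W)"

lemma lin_subspace_iff: "VectorSpace.subspace class_ring W (module_vec TYPE(complex) n) \<longleftrightarrow> lin_subspace n W"
proof
  assume "VectorSpace.subspace class_ring W (module_vec TYPE(complex) n)"
  then have "submodule class_ring W (module_vec TYPE(complex) n)" by (simp add: VectorSpace.subspace_def)
  then show "lin_subspace n W"
    unfolding submodule_def lin_subspace_def by (auto simp: module_vec_def)
next
  assume W: "lin_subspace n W"
  interpret vec_space "TYPE(complex)" n .
  show "VectorSpace.subspace class_ring W (module_vec TYPE(complex) n)"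
    unfolding VectorSpace.subspace_def submodule_def
    using W vec_vs module_axioms by (auto simp: module_vec_def lin_subspace_def)
qed

lemma lin_subspace_minus:
  assumes "lin_subspace n W" "v \<in> W" "w \<in> W"
  shows "v - w \<in> W"
proof -
  have "v + (-1) \<cdot>\<^sub>v w \<in> W" using assms by (auto simp: lin_subspace_def)
  moreover have "v + (-1) \<cdot>\<^sub>v w = v - w" using assms by (intro eq_vecI) (auto simp: lin_subspace_def)
  ultimately show ?thesis by simp
qed

text \<open>If \<open>n < k\<close>, padding both matrices with zeros to size \<open>k\<close> gives
  square matrices with a one-sided, hence two-sided, inverse, although the product in the other
  order has a zero row.\<close>

lemma left_inverse_dim:
  assumes B: "B \<in> carrier_mat n k" and C: "C \<in> carrier_mat k n" and CB: "C * B = (1\<^sub>m k :: complex mat)"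
  shows "k \<le> n"
proof (rule ccontr)
  assume "\<not> k \<le> n"
  then have kn: "n < k" by simp
  define B' where "B' = mat k k (\<lambda>(i, j). if i < n then B $$ (i, j) else 0)"
  define C' where "C' = mat k k (\<lambda>(i, j). if j < n then C $$ (i, j) else 0)"
  have c: "B' \<in> carrier_mat k k" "C' \<in> carrier_mat k k" by (simp_all add: B'_def C'_def)
  have "C' * B' = 1\<^sub>m k"
  proof (rule eq_matI)
    fix i j assume "i < dim_row (1\<^sub>m k)" "j < dim_col (1\<^sub>m k)"
    then have ij: "i < k" "j < k" by auto
    have "(C' * B') $$ (i, j) = (\<Sum>l<k. if l < n then C $$ (i, l) * B $$ (l, j) else 0)"
      unfolding mult_entry[OF c(2,1) ij] using ij by (intro sum.cong) (auto simp: B'_def C'_def)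
    also have "\<dots> = (\<Sum>l<n. C $$ (i, l) * B $$ (l, j))"
      using kn by (intro sum.mono_neutral_cong_right) auto
    also have "\<dots> = (1\<^sub>m k :: complex mat) $$ (i, j)" unfolding CB[symmetric] by (rule mult_entry[OF C B ij, symmetric])
    finally show "(C' * B') $$ (i, j) = (1\<^sub>m k :: complex mat) $$ (i, j)" .
  qed (use c in auto)
  then have "B' * C' = 1\<^sub>m k" using mat_mult_left_right_inverse[OF c(2,1)] by simp
  then have "(B' * C') $$ (n, n) = 1" using kn by simp
  moreover have "(B' * C') $$ (n, n) = 0"
    using kn by (simp add: mult_entry[OF c kn kn]) (simp add: B'_def)
  ultimately show False by simp
qed

text \<open>The columns of \<open>B\<close> are a basis of \<open>W\<close> and \<open>C\<close>
  reads off coordinates. Both are taken with \<open>k\<close> maximal: if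
  \<open>x = w - B *\<^sub>v (C *\<^sub>v w)\<close> were nonzero at \<open>i0\<close>, then
  \<open>x\<close> as a new column of \<open>B\<close> and row \<open>i0\<close> of
  \<open>1 - B * C\<close>, divided by that entry, as a new row of \<open>C\<close> would enlarge
  \<open>k\<close>.\<close>

lemma subspace_basis:
  assumes W: "lin_subspace n W"
  obtains k B C where "B \<in> carrier_mat n k" "C \<in> carrier_mat k n" "C * B = 1\<^sub>m k"
    "\<And>v. v \<in> carrier_vec k \<Longrightarrow> B *\<^sub>v v \<in> W" "\<And>w. w \<in> W \<Longrightarrow> B *\<^sub>v (C *\<^sub>v w) = w"
proof -
  define good where "good k \<longleftrightarrow> (\<exists>B\<in>carrier_mat n k. \<exists>C\<in>carrier_mat k n. C * B = (1\<^sub>m k :: complex mat) \<and>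
     (\<forall>v\<in>carrier_vec k. B *\<^sub>v v \<in> W))" for k
  have "good 0"
  proof -
    have "0\<^sub>m n 0 *\<^sub>v v = 0\<^sub>v n" if "v \<in> carrier_vec 0" for v :: "complex vec"
      using that by (intro eq_vecI) (auto simp: scalar_prod_def)
    moreover have "0\<^sub>m 0 n * 0\<^sub>m n 0 = (1\<^sub>m 0 :: complex mat)" by (intro eq_matI) auto
    ultimately show ?thesis using W unfolding good_def lin_subspace_def
      by (intro bexI[of _ "0\<^sub>m n 0"] bexI[of _ "0\<^sub>m 0 n"]) auto
  qed
  moreover have bound: "k \<le> n" if "good k" for k
    using that left_inverse_dim by (auto simp: good_def)
  ultimately obtain k where k: "good k" "\<And>j. good j \<Longrightarrow> j \<le> k"
    using GreatestI_nat[of good 0 n] Greatest_le_nat[of good _ n] by blast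
  obtain B C where B: "B \<in> carrier_mat n k" and C: "C \<in> carrier_mat k n" and CB: "C * B = 1\<^sub>m k"
    and BW: "\<And>v. v \<in> carrier_vec k \<Longrightarrow> B *\<^sub>v v \<in> W" using k(1) by (auto simp: good_def)
  have "B *\<^sub>v (C *\<^sub>v w) = w" if w: "w \<in> W" for w
  proof (rule ccontr)
    assume ne: "B *\<^sub>v (C *\<^sub>v w) \<noteq> w"
    have wc: "w \<in> carrier_vec n" using w W by (auto simp: lin_subspace_def)
    have Cw: "C *\<^sub>v w \<in> carrier_vec k" using C wc by simp
    define x where "x = w - B *\<^sub>v (C *\<^sub>v w)"
    have BCw: "B *\<^sub>v (C *\<^sub>v w) \<in> carrier_vec n" using B Cw by simp
    have xW: "x \<in> W" unfolding x_def by (rule lin_subspace_minus[OF W w BW[OF Cw]])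
    have xc: "x \<in> carrier_vec n" using xW W by (auto simp: lin_subspace_def)
    have "\<exists>i<n. x $ i \<noteq> 0"
    proof (rule ccontr)
      assume "\<not> (\<exists>i<n. x $ i \<noteq> 0)"
      then have "w $ i = (B *\<^sub>v (C *\<^sub>v w)) $ i" if "i < n" for i
        using that wc B by (auto simp: x_def)
      then have "w = B *\<^sub>v (C *\<^sub>v w)" using wc B by (intro eq_vecI) auto
      then show False using ne by simp
    qed
    then obtain i0 where i0: "i0 < n" "x $ i0 \<noteq> 0" by blast
    have Cx: "C *\<^sub>v x = 0\<^sub>v k"
    proof -
      have "C *\<^sub>v (B *\<^sub>v (C *\<^sub>v w)) = C *\<^sub>v w"
        using assoc_mult_mat_vec[OF C B Cw] CB Cw by simp
      then show ?thesis unfolding x_def using mult_minus_distrib_mat_vec[OF C wc BCw] C wc by simp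
    qed
    have Cx': "(\<Sum>l<n. C $$ (i, l) * x $ l) = 0" if "i < k" for i
    proof -
      have "(\<Sum>l<n. C $$ (i, l) * x $ l) = (C *\<^sub>v x) $ i"
        using C xc that by (simp add: scalar_prod_def atLeast0LessThan)
      then show ?thesis using Cx that by simp
    qed
    define D where "D = 1\<^sub>m n - B * C"
    have D: "D \<in> carrier_mat n n" using B C by (auto simp: D_def)
    have Dx: "(\<Sum>l<n. D $$ (i, l) * x $ l) = x $ i" if "i < n" for i
    proof -
      have "(B * C) *\<^sub>v x = B *\<^sub>v (C *\<^sub>v x)" by (rule assoc_mult_mat_vec[OF B C xc])
      also have "\<dots> = 0\<^sub>v n" using B by (auto simp: Cx)
      finally have "((B * C) *\<^sub>v x) $ i = 0" using that by simp
      then have "(\<Sum>l<n. (B * C) $$ (i, l) * x $ l) = 0"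
        by (simp only: mat_vec_entry[OF mult_carrier_mat[OF B C] xc that])
      moreover have "(\<Sum>l<n. (if i = l then 1 else 0) * x $ l) = (\<Sum>l<n. if l = i then x $ i else 0)"
        by (intro sum.cong) auto
      ultimately show ?thesis
        using that B C by (simp add: D_def left_diff_distrib sum_subtractf)
    qed
    have DB: "(\<Sum>l<n. D $$ (i, l) * B $$ (l, j)) = 0" if "i < n" "j < k" for i j
    proof -
      have "D * B = B - (B * C) * B" unfolding D_def using minus_mult_distrib_mat[of "1\<^sub>m n" n n "B * C" B k] B C by simp
      also have "(B * C) * B = B" using assoc_mult_mat[OF B C B] CB B by simp
      finally have "D * B = 0\<^sub>m n k" using B by auto
      then have "(D * B) $$ (i, j) = 0" using that by simp
      then show ?thesis by (simp only: mult_entry[OF D B that])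
    qed
    define B2 where "B2 = mat n (Suc k) (\<lambda>(i, j). if j < k then B $$ (i, j) else x $ i)"
    define C2 where "C2 = mat (Suc k) n (\<lambda>(i, j). if i < k then C $$ (i, j) else D $$ (i0, j) / x $ i0)"
    have c2: "B2 \<in> carrier_mat n (Suc k)" "C2 \<in> carrier_mat (Suc k) n" by (simp_all add: B2_def C2_def)
    have "C2 * B2 = 1\<^sub>m (Suc k)"
    proof (rule eq_matI)
      fix i j assume "i < dim_row (1\<^sub>m (Suc k))" "j < dim_col (1\<^sub>m (Suc k))"
      then have ij: "i < Suc k" "j < Suc k" by auto
      have e: "(C2 * B2) $$ (i, j) = (\<Sum>l<n. C2 $$ (i, l) * B2 $$ (l, j))"
        by (rule mult_entry[OF c2(2,1) ij])
      consider "i < k" "j < k" | "i < k" "j = k" | "i = k" "j < k" | "i = k" "j = k" using ij by linarith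
      then show "(C2 * B2) $$ (i, j) = (1\<^sub>m (Suc k) :: complex mat) $$ (i, j)"
      proof cases
        case 1
        then have "(C2 * B2) $$ (i, j) = (C * B) $$ (i, j)"
          unfolding e mult_entry[OF C B 1] by (intro sum.cong) (auto simp: B2_def C2_def)
        then show ?thesis using 1 by (simp add: CB)
      next
        case 2
        then have "(C2 * B2) $$ (i, j) = (\<Sum>l<n. C $$ (i, l) * x $ l)"
          unfolding e by (intro sum.cong) (auto simp: B2_def C2_def)
        then show ?thesis using 2 Cx' by simp
      next
        case 3
        then have "(C2 * B2) $$ (i, j) = (\<Sum>l<n. D $$ (i0, l) * B $$ (l, j)) / x $ i0"
          unfolding e sum_divide_distrib by (intro sum.cong) (auto simp: B2_def C2_def)
        then show ?thesis using 3 DB[OF i0(1)] by simp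
      next
        case 4
        then have "(C2 * B2) $$ (i, j) = (\<Sum>l<n. D $$ (i0, l) * x $ l) / x $ i0"
          unfolding e sum_divide_distrib by (intro sum.cong) (auto simp: B2_def C2_def)
        then show ?thesis using 4 Dx[OF i0(1)] i0 by simp
      qed
    qed (use c2 in auto)
    moreover have "B2 *\<^sub>v v \<in> W" if v: "v \<in> carrier_vec (Suc k)" for v
    proof -
      define u where "u = vec k (\<lambda>i. v $ i)"
      have "B2 *\<^sub>v v = B *\<^sub>v u + v $ k \<cdot>\<^sub>v x"
        using B v xc by (intro eq_vecI) (auto simp: B2_def u_def scalar_prod_def mult.commute)
      moreover have "B *\<^sub>v u \<in> W" by (rule BW) (simp add: u_def)
      ultimately show ?thesis using W xW by (auto simp: lin_subspace_def)
    qed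
    ultimately have "good (Suc k)" unfolding good_def using c2 by blast
    then show False using k(2) by force
  qed
  with that B C CB BW show thesis by blast
qed

subsection \<open>Representations\<close>

lemma GL_carrier:
  "A \<in> carrier (GL n) \<longleftrightarrow> A \<in> carrier_mat n n \<and> (\<exists>B\<in>carrier_mat n n. B * A = 1\<^sub>m n \<and> A * B = 1\<^sub>m n)"
  by (auto simp: GL_def units_of_def Units_def ring_mat_def)

lemma GL_simps: "A \<otimes>\<^bsub>GL n\<^esub> B = A * B" "\<one>\<^bsub>GL n\<^esub> = 1\<^sub>m n"
  by (simp_all add: GL_def units_of_def ring_mat_def)

lemma group_GL: "group (GL n)"
proof -
  interpret ring "ring_mat TYPE(complex) n ()" by (rule ring_mat)
  show ?thesis unfolding GL_def by (rule units_group)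
qed

locale finite_group = group G for G (structure) +
  assumes fin: "finite (carrier G)"
begin

lemma sum_translate: "h \<in> carrier G \<Longrightarrow> (\<Sum>g\<in>carrier G. f (h \<otimes> g)) = (\<Sum>g\<in>carrier G. f g)"
  by (rule sum.reindex_bij_witness[where i = "\<lambda>g. inv h \<otimes> g" and j = "\<lambda>g. h \<otimes> g"])
    (auto simp: m_assoc[symmetric])

lemma msum_translate:
  assumes h: "h \<in> carrier G"
  shows "msum nr nc (\<lambda>g. f (h \<otimes> g)) (carrier G) = msum nr nc f (carrier G)"
proof -
  have "(\<Sum>g\<in>carrier G. f (h \<otimes> g) $$ ij) = (\<Sum>g\<in>carrier G. f g $$ ij)" for ij
    by (rule sum_translate[OF h, of "\<lambda>g. f g $$ ij"])
  then show ?thesis by (simp add: msum_def)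
qed

lemma card_pos: "card (carrier G) > 0"
  using fin one_closed by (auto simp: card_gt_0_iff)

lemma repD:
  assumes R: "representation G R"
  shows "g \<in> carrier G \<Longrightarrow> snd R g \<in> carrier_mat (fst R) (fst R)"
    "g \<in> carrier G \<Longrightarrow> h \<in> carrier G \<Longrightarrow> snd R (g \<otimes> h) = snd R g * snd R h"
    "snd R \<one> = 1\<^sub>m (fst R)"
    "g \<in> carrier G \<Longrightarrow> snd R g * snd R (inv g) = 1\<^sub>m (fst R)"
    "g \<in> carrier G \<Longrightarrow> snd R (inv g) * snd R g = 1\<^sub>m (fst R)"
proof -
  have hom: "snd R \<in> hom G (GL (fst R))" using R by (simp add: representation_def)
  show c: "snd R g \<in> carrier_mat (fst R) (fst R)" if "g \<in> carrier G" for g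
    using hom that by (auto simp: hom_def Pi_def GL_carrier)
  show m: "snd R (g \<otimes> h) = snd R g * snd R h" if "g \<in> carrier G" "h \<in> carrier G" for g h
    using hom that by (auto simp: hom_def GL_simps)
  show o: "snd R \<one> = 1\<^sub>m (fst R)" using hom_one[OF hom is_group group_GL] by (simp add: GL_simps)
  show "snd R g * snd R (inv g) = 1\<^sub>m (fst R)" "snd R (inv g) * snd R g = 1\<^sub>m (fst R)" if "g \<in> carrier G"
    using that m[of g "inv g"] m[of "inv g" g] by (simp_all add: o)
qed

lemma repI:
  assumes c: "\<And>g. g \<in> carrier G \<Longrightarrow> f g \<in> carrier_mat n n"
    and m: "\<And>g h. g \<in> carrier G \<Longrightarrow> h \<in> carrier G \<Longrightarrow> f (g \<otimes> h) = f g * f h"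
    and o: "f \<one> = 1\<^sub>m n"
  shows "representation G (n, f)"
proof -
  have "f g \<in> carrier (GL n)" if g: "g \<in> carrier G" for g
  proof -
    have "f (inv g) * f g = 1\<^sub>m n" "f g * f (inv g) = 1\<^sub>m n"
      using m[of g "inv g"] m[of "inv g" g] g o by simp_all
    then show ?thesis using c g by (auto simp: GL_carrier)
  qed
  then show ?thesis by (simp add: representation_def hom_def GL_simps m)
qed

lemma irreducible_invariant:
  assumes "irreducible_rep G R" "lin_subspace (fst R) W"
    and "\<And>g w. g \<in> carrier G \<Longrightarrow> w \<in> W \<Longrightarrow> snd R g *\<^sub>v w \<in> W"
  shows "W = {0\<^sub>v (fst R)} \<or> W = carrier_vec (fst R)"
  using assms by (auto simp: irreducible_rep_def invariant_subspace_def lin_subspace_iff)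

lemma schur_scalar:
  assumes R: "irreducible_rep G R" and A: "A \<in> carrier_mat (fst R) (fst R)"
    and comm: "\<And>g. g \<in> carrier G \<Longrightarrow> snd R g * A = A * snd R g"
  shows "\<exists>c. A = c \<cdot>\<^sub>m 1\<^sub>m (fst R)"
proof -
  let ?n = "fst R"
  have rep: "representation G R" and n: "?n > 0" using R by (auto simp: irreducible_rep_def)
  obtain c where "c \<in> spectrum A" using spectrum_non_empty[OF A n] by blast
  then obtain v where v: "v \<in> carrier_vec ?n" "v \<noteq> 0\<^sub>v ?n" "A *\<^sub>v v = c \<cdot>\<^sub>v v"
    using A by (auto simp: spectrum_def eigenvalue_def eigenvector_def)
  define W where "W = {v \<in> carrier_vec ?n. A *\<^sub>v v = c \<cdot>\<^sub>v v}"
  have "lin_subspace ?n W"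
    unfolding lin_subspace_def W_def
    using A by (auto simp: mult_add_distrib_mat_vec smult_add_distrib_vec mult_mat_vec smult_smult_assoc mult.commute)
  moreover have "snd R g *\<^sub>v w \<in> W" if g: "g \<in> carrier G" and w: "w \<in> W" for g w
  proof -
    have wc: "w \<in> carrier_vec ?n" "A *\<^sub>v w = c \<cdot>\<^sub>v w" using w by (auto simp: W_def)
    have "A *\<^sub>v (snd R g *\<^sub>v w) = (A * snd R g) *\<^sub>v w"
      using assoc_mult_mat_vec[OF A repD(1)[OF rep g] wc(1)] by simp
    also have "\<dots> = snd R g *\<^sub>v (A *\<^sub>v w)"
      using assoc_mult_mat_vec[OF repD(1)[OF rep g] A wc(1)] comm[OF g] by simp
    also have "\<dots> = c \<cdot>\<^sub>v (snd R g *\<^sub>v w)"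
      using mult_mat_vec[OF repD(1)[OF rep g] wc(1)] by (simp add: wc)
    finally show ?thesis using repD(1)[OF rep g] wc by (simp add: W_def)
  qed
  ultimately have "W = {0\<^sub>v ?n} \<or> W = carrier_vec ?n" by (rule irreducible_invariant[OF R])
  moreover have "v \<in> W" using v by (simp add: W_def)
  ultimately have "W = carrier_vec ?n" using v(2) by auto
  then have "A *\<^sub>v w = (c \<cdot>\<^sub>m 1\<^sub>m ?n) *\<^sub>v w" if "w \<in> carrier_vec ?n" for w
    using that scalar_mat_vec[OF that, of c] by (auto simp: W_def)
  then have "A = c \<cdot>\<^sub>m 1\<^sub>m ?n" using A by (intro eq_mat_on_vec) auto
  then show ?thesis by blast
qed

lemma schur_iso:
  assumes S: "irreducible_rep G S" and U: "irreducible_rep G U"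
    and P: "P \<in> carrier_mat (fst S) (fst U)" "P \<noteq> 0\<^sub>m (fst S) (fst U)"
    and comm: "\<And>g. g \<in> carrier G \<Longrightarrow> snd S g * P = P * snd U g"
  shows "equivalent_reps G U S"
proof -
  let ?s = "fst S" and ?u = "fst U"
  have repS: "representation G S" and repU: "representation G U"
    using S U by (auto simp: irreducible_rep_def)
  define K where "K = {v \<in> carrier_vec ?u. P *\<^sub>v v = 0\<^sub>v ?s}"
  have "lin_subspace ?u K"
    unfolding lin_subspace_def K_def using P by (auto simp: mult_add_distrib_mat_vec mult_mat_vec)
  moreover have "snd U g *\<^sub>v w \<in> K" if g: "g \<in> carrier G" and w: "w \<in> K" for g w
  proof -
    have wc: "w \<in> carrier_vec ?u" "P *\<^sub>v w = 0\<^sub>v ?s" using w by (auto simp: K_def)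
    have "P *\<^sub>v (snd U g *\<^sub>v w) = snd S g *\<^sub>v (P *\<^sub>v w)"
      using assoc_mult_mat_vec[OF P(1) repD(1)[OF repU g] wc(1)]
        assoc_mult_mat_vec[OF repD(1)[OF repS g] P(1) wc(1)] comm[OF g] by simp
    also have "\<dots> = 0\<^sub>v ?s" using repD(1)[OF repS g] wc by auto
    finally show ?thesis using repD(1)[OF repU g] wc by (simp add: K_def)
  qed
  ultimately have "K = {0\<^sub>v ?u} \<or> K = carrier_vec ?u" by (rule irreducible_invariant[OF U])
  moreover have "K \<noteq> carrier_vec ?u"
  proof
    assume "K = carrier_vec ?u"
    then have "P *\<^sub>v v = 0\<^sub>m ?s ?u *\<^sub>v v" if "v \<in> carrier_vec ?u" for v
      using that zero_mat_vec[OF that] by (auto simp: K_def)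
    then have "P = 0\<^sub>m ?s ?u" using P by (intro eq_mat_on_vec) auto
    then show False using P by simp
  qed
  ultimately have K: "K = {0\<^sub>v ?u}" by simp
  define I where "I = (\<lambda>v. P *\<^sub>v v) ` carrier_vec ?u"
  have "lin_subspace ?s I"
    unfolding lin_subspace_def
  proof (intro conjI ballI allI)
    show "I \<subseteq> carrier_vec ?s" using P by (auto simp: I_def)
    have "P *\<^sub>v 0\<^sub>v ?u = 0\<^sub>v ?s" using P by auto
    then show "0\<^sub>v ?s \<in> I" unfolding I_def by (metis image_eqI zero_carrier_vec)
    fix v w assume "v \<in> I" "w \<in> I"
    then obtain v' w' where vw: "v' \<in> carrier_vec ?u" "w' \<in> carrier_vec ?u" "v = P *\<^sub>v v'" "w = P *\<^sub>v w'"
      by (auto simp: I_def)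
    then have "v + w = P *\<^sub>v (v' + w')" using P by (simp add: mult_add_distrib_mat_vec)
    then show "v + w \<in> I" using vw by (auto simp: I_def)
    fix c
    have "c \<cdot>\<^sub>v v = P *\<^sub>v (c \<cdot>\<^sub>v v')" using P vw by (simp add: mult_mat_vec)
    then show "c \<cdot>\<^sub>v v \<in> I" using vw by (auto simp: I_def)
  qed
  moreover have "snd S g *\<^sub>v w \<in> I" if g: "g \<in> carrier G" and w: "w \<in> I" for g w
  proof -
    obtain v where v: "v \<in> carrier_vec ?u" "w = P *\<^sub>v v" using w by (auto simp: I_def)
    have "snd S g *\<^sub>v w = P *\<^sub>v (snd U g *\<^sub>v v)"
      using assoc_mult_mat_vec[OF P(1) repD(1)[OF repU g] v(1)]
        assoc_mult_mat_vec[OF repD(1)[OF repS g] P(1) v(1)] comm[OF g] v by simp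
    moreover have "snd U g *\<^sub>v v \<in> carrier_vec ?u" using repD(1)[OF repU g] v by simp
    ultimately show ?thesis by (auto simp: I_def)
  qed
  ultimately have "I = {0\<^sub>v ?s} \<or> I = carrier_vec ?s" by (rule irreducible_invariant[OF S])
  moreover have "I \<noteq> {0\<^sub>v ?s}"
  proof
    assume "I = {0\<^sub>v ?s}"
    then have "K = carrier_vec ?u" by (auto simp: I_def K_def)
    then show False using \<open>K \<noteq> carrier_vec ?u\<close> by simp
  qed
  ultimately have I: "I = carrier_vec ?s" by simp
  have "\<forall>j. \<exists>x. j < ?s \<longrightarrow> x \<in> carrier_vec ?u \<and> P *\<^sub>v x = unit_vec ?s j"
  proof
    fix j
    have "unit_vec ?s j \<in> I" unfolding I by simp
    then show "\<exists>x. j < ?s \<longrightarrow> x \<in> carrier_vec ?u \<and> P *\<^sub>v x = unit_vec ?s j"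
      unfolding I_def by (metis imageE)
  qed
  then obtain x where x: "\<And>j. j < ?s \<Longrightarrow> x j \<in> carrier_vec ?u \<and> P *\<^sub>v x j = unit_vec ?s j" by metis
  define Q where "Q = mat ?u ?s (\<lambda>(i, j). x j $ i)"
  have Q: "Q \<in> carrier_mat ?u ?s" by (simp add: Q_def)
  have PQ: "P * Q = 1\<^sub>m ?s"
  proof (rule eq_matI)
    fix i j assume "i < dim_row (1\<^sub>m ?s)" "j < dim_col (1\<^sub>m ?s)"
    then have ij: "i < ?s" "j < ?s" by auto
    have xj: "x j \<in> carrier_vec ?u" using x[OF ij(2)] by blast
    have "(P * Q) $$ (i, j) = (\<Sum>k<?u. P $$ (i, k) * x j $ k)"
      unfolding mult_entry[OF P(1) Q ij] using ij by (intro sum.cong) (auto simp: Q_def)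
    also have "\<dots> = (P *\<^sub>v x j) $ i"
      using P(1) ij xj by (simp add: scalar_prod_def atLeast0LessThan)
    finally have "(P * Q) $$ (i, j) = (P *\<^sub>v x j) $ i" .
    then show "(P * Q) $$ (i, j) = (1\<^sub>m ?s :: complex mat) $$ (i, j)" using x[OF ij(2)] ij by (simp add: unit_vec_def)
  qed (use P Q in auto)
  have QP: "Q * P = 1\<^sub>m ?u"
  proof (rule eq_mat_on_vec[of _ ?u ?u])
    fix v :: "complex vec" assume v: "v \<in> carrier_vec ?u"
    have Pv: "P *\<^sub>v v \<in> carrier_vec ?s" using P v by simp
    define w where "w = Q *\<^sub>v (P *\<^sub>v v) - v"
    have QPv: "Q *\<^sub>v (P *\<^sub>v v) \<in> carrier_vec ?u" using Q Pv by simp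
    have "P *\<^sub>v (Q *\<^sub>v (P *\<^sub>v v)) = P *\<^sub>v v" using assoc_mult_mat_vec[OF P(1) Q Pv] PQ Pv by simp
    then have "P *\<^sub>v w = 0\<^sub>v ?s" unfolding w_def using mult_minus_distrib_mat_vec[OF P(1) QPv v] Pv by simp
    then have "w \<in> K" using QPv v by (simp add: K_def w_def)
    then have "w = 0\<^sub>v ?u" using K by simp
    then have "(Q *\<^sub>v (P *\<^sub>v v)) $ i = v $ i" if "i < ?u" for i
      using that QPv v unfolding w_def by (metis carrier_vecD eq_iff_diff_eq_0 index_minus_vec(1) index_zero_vec(1))
    then have "Q *\<^sub>v (P *\<^sub>v v) = v" using Q v by (intro eq_vecI) auto
    then show "(Q * P) *\<^sub>v v = 1\<^sub>m ?u *\<^sub>v v" using assoc_mult_mat_vec[OF Q P(1) v] v by simp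
  qed (use P Q in auto)
  \<comment> \<open>Equality of the two degrees comes from the traces of \<open>P * Q\<close> and
    \<open>Q * P\<close>.\<close>
  have "of_nat ?s = (of_nat ?u :: complex)"
    using mtrace_commute[OF P(1) Q] by (simp add: PQ QP mtrace_one)
  then have su: "?s = ?u" by simp
  then have "P \<in> carrier (GL ?u)" using P Q PQ QP by (auto simp: GL_carrier)
  then show ?thesis unfolding equivalent_reps_def using su comm by (auto intro!: bexI[of _ P])
qed

lemma averaging:
  assumes S: "representation G S" and U: "representation G U"
    and X: "X \<in> carrier_mat (fst S) (fst U)"
  defines "A \<equiv> msum (fst S) (fst U) (\<lambda>g. snd S g * X * snd U (inv g)) (carrier G)"
  shows "h \<in> carrier G \<Longrightarrow> snd S h * A = A * snd U h"
proof -
  assume h: "h \<in> carrier G"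
  note s = repD[OF S] and u = repD[OF U]
  let ?f = "\<lambda>g. snd S g * X * snd U (inv g)"
  have f: "?f g \<in> carrier_mat (fst S) (fst U)" if "g \<in> carrier G" for g
    using s(1)[OF that] u(1)[of "inv g"] X that by (meson inv_closed mult_carrier_mat)
  have eq: "snd S h * ?f g = ?f (h \<otimes> g) * snd U h" if g: "g \<in> carrier G" for g
  proof -
    have gi: "inv g \<in> carrier G" "inv h \<in> carrier G" using g h by auto
    have SX: "snd S g * X \<in> carrier_mat (fst S) (fst U)" using s(1)[OF g] X by simp
    have "?f (h \<otimes> g) * snd U h = (snd S h * snd S g * X) * (snd U (inv g) * snd U (inv h)) * snd U h"
      using g h by (simp add: s(2) u(2) inv_mult_group)
    also have "\<dots> = (snd S h * snd S g * X) * (snd U (inv g) * (snd U (inv h) * snd U h))"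
      using s(1)[OF h] s(1)[OF g] X u(1)[OF gi(1)] u(1)[OF gi(2)] u(1)[OF h]
      by (simp add: assoc_mult_mat[of _ "fst S" "fst U" _ "fst U" _ "fst U"]
          assoc_mult_mat[of _ "fst U" "fst U" _ "fst U" _ "fst U"])
    also have "\<dots> = snd S h * (snd S g * X * snd U (inv g))"
      using s(1)[OF h] s(1)[OF g] X u(1)[OF gi(1)] u(5)[OF h]
      by (simp add: assoc_mult_mat[of _ "fst S" "fst S" _ "fst S" _ "fst U"]
          assoc_mult_mat[of _ "fst S" "fst S" _ "fst U" _ "fst U"])
    finally show ?thesis by simp
  qed
  have "snd S h * A = msum (fst S) (fst U) (\<lambda>g. snd S h * ?f g) (carrier G)"
    unfolding A_def by (rule msum_mult_left[OF s(1)[OF h] f])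
  also have "\<dots> = msum (fst S) (fst U) (\<lambda>g. ?f (h \<otimes> g) * snd U h) (carrier G)"
    by (rule msum_cong) (rule eq)
  also have "\<dots> = msum (fst S) (fst U) (\<lambda>g. ?f g * snd U h) (carrier G)"
    by (rule msum_translate[OF h, of _ _ "\<lambda>g. ?f g * snd U h"])
  also have "\<dots> = A * snd U h"
    unfolding A_def by (rule msum_mult_right[OF u(1)[OF h] f, symmetric])
  finally show ?thesis .
qed

text \<open>Averaging a matrix unit produces the sums of the orthogonality relations as entries, so
  that Schur's lemma evaluates all of them.\<close>

lemma averaging_unit_entry:
  assumes S: "representation G S" and U: "representation G U"
    and ij: "i < fst S" "j < fst S" "k < fst U" "l < fst U"
  defines "X \<equiv> mat (fst S) (fst U) (\<lambda>(a, b). if a = j \<and> b = k then 1 else 0)"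
  shows "msum (fst S) (fst U) (\<lambda>g. snd S g * X * snd U (inv g)) (carrier G) $$ (i, l)
    = (\<Sum>g\<in>carrier G. snd S g $$ (i, j) * snd U (inv g) $$ (k, l))"
proof -
  have X: "X \<in> carrier_mat (fst S) (fst U)" by (simp add: X_def)
  have "(snd S g * X * snd U (inv g)) $$ (i, l) = snd S g $$ (i, j) * snd U (inv g) $$ (k, l)"
    if g: "g \<in> carrier G" for g
  proof -
    have Sg: "snd S g \<in> carrier_mat (fst S) (fst S)" and Ug: "snd U (inv g) \<in> carrier_mat (fst U) (fst U)"
      using repD(1)[OF S g] repD(1)[OF U, of "inv g"] g by auto
    have SX: "(snd S g * X) $$ (i, b) = (if b = k then snd S g $$ (i, j) else 0)" if b: "b < fst U" for b
    proof -
      have "(snd S g * X) $$ (i, b) = (\<Sum>a<fst S. if a = j then (if b = k then snd S g $$ (i, j) else 0) else 0)"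
        unfolding mult_entry[OF Sg X ij(1) b] using b by (intro sum.cong) (auto simp: X_def)
      then show ?thesis using ij by simp
    qed
    have "(snd S g * X * snd U (inv g)) $$ (i, l) = (\<Sum>b<fst U. (snd S g * X) $$ (i, b) * snd U (inv g) $$ (b, l))"
      by (rule mult_entry[OF _ Ug ij(1,4)]) (use Sg X in simp)
    also have "\<dots> = (\<Sum>b<fst U. if b = k then snd S g $$ (i, j) * snd U (inv g) $$ (k, l) else 0)"
      by (intro sum.cong) (auto simp: SX)
    finally show ?thesis using ij by simp
  qed
  then show ?thesis using ij by (simp add: msum_def)
qed

lemma orthogonality_inequivalent:
  assumes S: "irreducible_rep G S" and U: "irreducible_rep G U" and ne: "\<not> equivalent_reps G U S"
    and ij: "i < fst S" "j < fst S" "k < fst U" "l < fst U"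
  shows "(\<Sum>g\<in>carrier G. snd S g $$ (i, j) * snd U (inv g) $$ (k, l)) = 0"
proof -
  have rep: "representation G S" "representation G U" using S U by (auto simp: irreducible_rep_def)
  define X :: "complex mat" where "X = mat (fst S) (fst U) (\<lambda>(a, b). if a = j \<and> b = k then 1 else 0)"
  define A where "A = msum (fst S) (fst U) (\<lambda>g. snd S g * X * snd U (inv g)) (carrier G)"
  have X: "X \<in> carrier_mat (fst S) (fst U)" by (simp add: X_def)
  have comm: "snd S g * A = A * snd U g" if "g \<in> carrier G" for g
    unfolding A_def by (rule averaging[OF rep X that])
  have "A = 0\<^sub>m (fst S) (fst U)"
  proof (rule ccontr)
    assume "A \<noteq> 0\<^sub>m (fst S) (fst U)"
    moreover have "A \<in> carrier_mat (fst S) (fst U)" by (simp add: A_def)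
    ultimately show False using schur_iso[OF S U _ _ comm] ne by simp
  qed
  then show ?thesis using averaging_unit_entry[OF rep ij] ij by (simp add: A_def X_def)
qed

lemma orthogonality:
  assumes U: "irreducible_rep G U" and ij: "i < fst U" "j < fst U" "k < fst U" "l < fst U"
  shows "(\<Sum>g\<in>carrier G. snd U g $$ (i, j) * snd U (inv g) $$ (k, l))
    = (if i = l \<and> j = k then of_nat (card (carrier G)) / of_nat (fst U) else 0)"
proof -
  let ?n = "fst U"
  have rep: "representation G U" and n: "?n > 0" using U by (auto simp: irreducible_rep_def)
  define X :: "complex mat" where "X = mat ?n ?n (\<lambda>(a, b). if a = j \<and> b = k then 1 else 0)"
  define A where "A = msum ?n ?n (\<lambda>g. snd U g * X * snd U (inv g)) (carrier G)"
  have X: "X \<in> carrier_mat ?n ?n" by (simp add: X_def)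
  have comm: "snd U g * A = A * snd U g" if "g \<in> carrier G" for g
    unfolding A_def by (rule averaging[OF rep rep X that])
  have "A \<in> carrier_mat ?n ?n" by (simp add: A_def)
  then obtain c where c: "A = c \<cdot>\<^sub>m 1\<^sub>m ?n" using schur_scalar[OF U _ comm] by blast
  \<comment> \<open>Schur's lemma leaves one unknown scalar, and the trace, invariant under
    conjugation, determines it.\<close>
  have "mtrace ?n A = (\<Sum>g\<in>carrier G. mtrace ?n (snd U g * X * snd U (inv g)))"
    unfolding A_def mtrace_def msum_def by (simp add: sum.swap[of _ "{..<?n}"])
  also have "\<dots> = (\<Sum>g\<in>carrier G. mtrace ?n X)"
  proof (intro sum.cong refl)
    fix g assume g: "g \<in> carrier G"
    have Ug: "snd U g \<in> carrier_mat ?n ?n" "snd U (inv g) \<in> carrier_mat ?n ?n"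
      using repD(1)[OF rep] g by auto
    have "mtrace ?n ((snd U g * X) * snd U (inv g)) = mtrace ?n (snd U (inv g) * (snd U g * X))"
      using Ug X by (intro mtrace_commute) auto
    also have "snd U (inv g) * (snd U g * X) = X"
      using assoc_mult_mat[OF Ug(2,1) X] repD(5)[OF rep g] X by simp
    finally show "mtrace ?n (snd U g * X * snd U (inv g)) = mtrace ?n X" .
  qed
  also have "mtrace ?n X = (\<Sum>a<?n. if a = j then (if j = k then 1 else 0) else 0)"
    unfolding mtrace_def by (intro sum.cong) (auto simp: X_def)
  also have "\<dots> = (if j = k then 1 else 0)" using ij by simp
  finally have "c * of_nat ?n = (if j = k then of_nat (card (carrier G)) else 0)"
    by (simp add: c mtrace_def mult.commute)
  then have "c = (if j = k then of_nat (card (carrier G)) / of_nat ?n else 0)"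
    using n by (auto simp: field_simps)
  moreover have "(\<Sum>g\<in>carrier G. snd U g $$ (i, j) * snd U (inv g) $$ (k, l)) = A $$ (i, l)"
    using averaging_unit_entry[OF rep rep ij] by (simp add: A_def X_def)
  ultimately show ?thesis using ij by (auto simp: c)
qed

subsection \<open>Complete reducibility\<close>

definition block_diag :: "complex mat \<Rightarrow> complex mat \<Rightarrow> complex mat" where
  "block_diag A B = four_block_mat A (0\<^sub>m (dim_row A) (dim_col B)) (0\<^sub>m (dim_row B) (dim_col A)) B"

lemma block_diag_carrier: "A \<in> carrier_mat a b \<Longrightarrow> B \<in> carrier_mat c d \<Longrightarrow> block_diag A B \<in> carrier_mat (a + c) (b + d)"
  by (auto simp: block_diag_def)

lemma block_diag_mult:
  assumes "A \<in> carrier_mat a a" "B \<in> carrier_mat b b" "A' \<in> carrier_mat a a" "B' \<in> carrier_mat b b"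
  shows "block_diag A B * block_diag A' B' = block_diag (A * A') (B * B')"
proof -
  have "block_diag A B * block_diag A' B'
      = four_block_mat (A * A' + 0\<^sub>m a b * 0\<^sub>m b a) (A * 0\<^sub>m a b + 0\<^sub>m a b * B')
          (0\<^sub>m b a * A' + B * 0\<^sub>m b a) (0\<^sub>m b a * 0\<^sub>m a b + B * B')"
    using assms unfolding block_diag_def by (subst mult_four_block_mat[of _ a a _ b _ b]) auto
  also have "\<dots> = block_diag (A * A') (B * B')"
    using assms unfolding block_diag_def by (intro arg_cong4[where f = four_block_mat]) auto
  finally show ?thesis .
qed

lemma block_diag_one: "block_diag (1\<^sub>m a) (1\<^sub>m b) = 1\<^sub>m (a + b)"
  by (intro eq_matI) (auto simp: block_diag_def)

lemma equivalent_trans: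
  assumes R: "representation G R" and S: "\<And>g. g \<in> carrier G \<Longrightarrow> snd S g \<in> carrier_mat (fst S) (fst S)"
    and T: "\<And>g. g \<in> carrier G \<Longrightarrow> snd T g \<in> carrier_mat (fst T) (fst T)"
    and RS: "equivalent_reps G R S" and ST: "equivalent_reps G S T"
  shows "equivalent_reps G R T"
proof -
  let ?n = "fst R"
  obtain P where n1: "fst S = ?n" and P: "P \<in> carrier (GL ?n)" "\<And>g. g \<in> carrier G \<Longrightarrow> P * snd R g = snd S g * P"
    using RS by (auto simp: equivalent_reps_def)
  obtain Q where n2: "fst T = ?n" and Q: "Q \<in> carrier (GL ?n)" "\<And>g. g \<in> carrier G \<Longrightarrow> Q * snd S g = snd T g * Q"
    using ST by (auto simp: equivalent_reps_def n1)
  interpret GL: group "GL ?n" by (rule group_GL)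
  have PQ: "P \<in> carrier_mat ?n ?n" "Q \<in> carrier_mat ?n ?n" using P Q by (auto simp: GL_carrier)
  have "Q * P \<in> carrier (GL ?n)" using GL.m_closed[OF Q(1) P(1)] by (simp add: GL_simps)
  moreover have "(Q * P) * snd R g = snd T g * (Q * P)" if g: "g \<in> carrier G" for g
  proof -
    have c: "snd R g \<in> carrier_mat ?n ?n" "snd S g \<in> carrier_mat ?n ?n" "snd T g \<in> carrier_mat ?n ?n"
      using repD(1)[OF R g] S[OF g] T[OF g] n1 n2 by auto
    have "(Q * P) * snd R g = Q * (snd S g * P)" using assoc_mult_mat[OF PQ(2,1) c(1)] P(2)[OF g] by simp
    also have "\<dots> = (snd T g * Q) * P" using assoc_mult_mat[OF PQ(2) c(2) PQ(1)] Q(2)[OF g] by simp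
    also have "\<dots> = snd T g * (Q * P)" by (rule assoc_mult_mat[OF c(3) PQ(2,1)])
    finally show ?thesis .
  qed
  ultimately show ?thesis unfolding equivalent_reps_def using n2 by auto
qed

lemma zero_block_simps:
  "X \<in> carrier_mat a c \<Longrightarrow> Y \<in> carrier_mat b c \<Longrightarrow> X + 0\<^sub>m a b * Y = (X :: complex mat)"
  "X \<in> carrier_mat a c \<Longrightarrow> Y \<in> carrier_mat b c \<Longrightarrow> 0\<^sub>m a b * Y + X = (X :: complex mat)"
  "Z \<in> carrier_mat a b \<Longrightarrow> Y \<in> carrier_mat a c \<Longrightarrow> Z * 0\<^sub>m b 0 + Y * 0\<^sub>m c 0 = (0\<^sub>m a 0 :: complex mat)"
  by (auto intro!: eq_matI)

lemma split_rep:
  assumes R: "representation G R" and n: "fst R = k1 + k2"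
    and B1: "B1 \<in> carrier_mat (fst R) k1" and C1: "C1 \<in> carrier_mat k1 (fst R)" and CB1: "C1 * B1 = 1\<^sub>m k1"
    and B2: "B2 \<in> carrier_mat (fst R) k2" and C2: "C2 \<in> carrier_mat k2 (fst R)" and CB2: "C2 * B2 = 1\<^sub>m k2"
    and sum: "B1 * C1 + B2 * C2 = 1\<^sub>m (fst R)"
    and comm1: "\<And>g. g \<in> carrier G \<Longrightarrow> snd R g * (B1 * C1) = (B1 * C1) * snd R g"
    and comm2: "\<And>g. g \<in> carrier G \<Longrightarrow> snd R g * (B2 * C2) = (B2 * C2) * snd R g"
  shows "representation G (k1, \<lambda>g. C1 * snd R g * B1)" "representation G (k2, \<lambda>g. C2 * snd R g * B2)"
    "equivalent_reps G R (k1 + k2, \<lambda>g. block_diag (C1 * snd R g * B1) (C2 * snd R g * B2))"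
proof -
  let ?n = "fst R"
  note r = repD[OF R]
  have push: "C * snd R g = C * snd R g * B * C"
    if C: "C \<in> carrier_mat k ?n" and B: "B \<in> carrier_mat ?n k" and CB: "C * B = 1\<^sub>m k"
      and comm: "snd R g * (B * C) = (B * C) * snd R g" and g: "g \<in> carrier G" for k B C g
  proof -
    note rg = r(1)[OF g]
    have BC: "B * C \<in> carrier_mat ?n ?n" using B C by simp
    have "C * snd R g * B * C = (C * snd R g) * (B * C)"
      using B C rg by (intro assoc_mult_mat[of _ k ?n _ k _ ?n]) auto
    also have "\<dots> = C * ((B * C) * snd R g)" using assoc_mult_mat[OF C rg BC] comm by simp
    also have "\<dots> = (C * (B * C)) * snd R g" using assoc_mult_mat[OF C BC rg] by simp
    also have "C * (B * C) = C" using assoc_mult_mat[OF C B C] CB C by simp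
    finally show ?thesis by simp
  qed
  have sub: "representation G (k, \<lambda>g. C * snd R g * B)"
    if C: "C \<in> carrier_mat k ?n" and B: "B \<in> carrier_mat ?n k" and CB: "C * B = 1\<^sub>m k"
      and comm: "\<And>g. g \<in> carrier G \<Longrightarrow> snd R g * (B * C) = (B * C) * snd R g" for k B C
  proof (rule repI)
    show "C * snd R g * B \<in> carrier_mat k k" if "g \<in> carrier G" for g using B C r(1)[OF that] by simp
    show "C * snd R \<one> * B = 1\<^sub>m k" using C CB by (simp add: r(3))
    fix g h assume g: "g \<in> carrier G" and h: "h \<in> carrier G"
    have Cg: "C * snd R g \<in> carrier_mat k ?n" "C * snd R h \<in> carrier_mat k ?n"
      using C r(1)[OF g] r(1)[OF h] by auto
    have "C * snd R (g \<otimes> h) * B = (C * snd R g) * snd R h * B"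
      using assoc_mult_mat[OF C r(1)[OF g] r(1)[OF h]] by (simp add: r(2) g h)
    also have "\<dots> = (C * snd R g * B * C) * snd R h * B" using push[OF C B CB comm[OF g] g] by simp
    also have "\<dots> = (C * snd R g * B) * (C * snd R h) * B"
      using assoc_mult_mat[OF mult_carrier_mat[OF Cg(1) B] C r(1)[OF h]] by simp
    also have "\<dots> = (C * snd R g * B) * (C * snd R h * B)"
      by (rule assoc_mult_mat[OF mult_carrier_mat[OF Cg(1) B] Cg(2) B])
    finally show "C * snd R (g \<otimes> h) * B = (C * snd R g * B) * (C * snd R h * B)" .
  qed
  show "representation G (k1, \<lambda>g. C1 * snd R g * B1)" by (rule sub[OF C1 B1 CB1 comm1])
  show "representation G (k2, \<lambda>g. C2 * snd R g * B2)" by (rule sub[OF C2 B2 CB2 comm2])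
  \<comment> \<open>\<open>P\<close> stacks \<open>C1\<close> on \<open>C2\<close> and
    \<open>Q\<close> puts \<open>B1\<close> beside \<open>B2\<close>; blocks of width or height 0
    fit this into \<open>four_block_mat\<close>.\<close>
  define P where "P = four_block_mat C1 (0\<^sub>m k1 0) C2 (0\<^sub>m k2 0)"
  define Q where "Q = four_block_mat B1 B2 (0\<^sub>m 0 k1) (0\<^sub>m 0 k2)"
  have Pc: "P \<in> carrier_mat (k1 + k2) (k1 + k2)" and Qc: "Q \<in> carrier_mat (k1 + k2) (k1 + k2)"
    using B1 B2 C1 C2 n by (auto simp: P_def Q_def)
  have pad: "four_block_mat X (0\<^sub>m ?n 0) (0\<^sub>m 0 ?n) (0\<^sub>m 0 0) = X" if "X \<in> carrier_mat ?n ?n" for X :: "complex mat"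
    using that by (intro eq_matI) auto
  have "Q * P = four_block_mat (B1 * C1 + B2 * C2) (B1 * 0\<^sub>m k1 0 + B2 * 0\<^sub>m k2 0)
      (0\<^sub>m 0 k1 * C1 + 0\<^sub>m 0 k2 * C2) (0\<^sub>m 0 k1 * 0\<^sub>m k1 0 + 0\<^sub>m 0 k2 * 0\<^sub>m k2 0)"
    unfolding P_def Q_def by (rule mult_four_block_mat[OF B1 B2 _ _ C1 _ C2]) auto
  also have "\<dots> = four_block_mat (1\<^sub>m ?n) (0\<^sub>m ?n 0) (0\<^sub>m 0 ?n) (0\<^sub>m 0 0)"
    using B1 B2 C1 C2 by (intro arg_cong4[where f = four_block_mat]) (auto simp: sum)
  also have "\<dots> = 1\<^sub>m (k1 + k2)" using pad[of "1\<^sub>m ?n"] n by simp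
  finally have QP: "Q * P = 1\<^sub>m (k1 + k2)" .
  then have "P * Q = 1\<^sub>m (k1 + k2)" by (rule mat_mult_left_right_inverse[OF Qc Pc])
  then have "P \<in> carrier (GL ?n)" using QP Pc Qc n by (auto simp: GL_carrier)
  moreover have "P * snd R g = block_diag (C1 * snd R g * B1) (C2 * snd R g * B2) * P" if g: "g \<in> carrier G" for g
  proof -
    note rg = r(1)[OF g]
    let ?D1 = "C1 * snd R g * B1" and ?D2 = "C2 * snd R g * B2"
    have D: "?D1 \<in> carrier_mat k1 k1" "?D2 \<in> carrier_mat k2 k2" using B1 B2 C1 C2 rg by auto
    have "P * snd R g = P * four_block_mat (snd R g) (0\<^sub>m ?n 0) (0\<^sub>m 0 ?n) (0\<^sub>m 0 0)" by (simp add: pad[OF rg])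
    also have "\<dots> = four_block_mat (C1 * snd R g + 0\<^sub>m k1 0 * 0\<^sub>m 0 ?n) (C1 * 0\<^sub>m ?n 0 + 0\<^sub>m k1 0 * 0\<^sub>m 0 0)
        (C2 * snd R g + 0\<^sub>m k2 0 * 0\<^sub>m 0 ?n) (C2 * 0\<^sub>m ?n 0 + 0\<^sub>m k2 0 * 0\<^sub>m 0 0)"
      unfolding P_def by (rule mult_four_block_mat[OF C1 _ C2 _ rg]) auto
    also have "\<dots> = four_block_mat (?D1 * C1 + 0\<^sub>m k1 k2 * C2) (?D1 * 0\<^sub>m k1 0 + 0\<^sub>m k1 k2 * 0\<^sub>m k2 0)
        (0\<^sub>m k2 k1 * C1 + ?D2 * C2) (0\<^sub>m k2 k1 * 0\<^sub>m k1 0 + ?D2 * 0\<^sub>m k2 0)"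
    proof (intro arg_cong4[where f = four_block_mat])
      have X: "C1 * snd R g \<in> carrier_mat k1 ?n" "C2 * snd R g \<in> carrier_mat k2 ?n" using C1 C2 rg by auto
      note push1 = push[OF C1 B1 CB1 comm1[OF g] g] and push2 = push[OF C2 B2 CB2 comm2[OF g] g]
      show "C1 * snd R g + 0\<^sub>m k1 0 * 0\<^sub>m 0 ?n = ?D1 * C1 + 0\<^sub>m k1 k2 * C2"
        unfolding push1[symmetric] zero_block_simps(1)[OF X(1) C2] by (rule zero_block_simps(1)[OF X(1)]) simp
      show "C2 * snd R g + 0\<^sub>m k2 0 * 0\<^sub>m 0 ?n = 0\<^sub>m k2 k1 * C1 + ?D2 * C2"
        unfolding push2[symmetric] zero_block_simps(2)[OF X(2) C1] by (rule zero_block_simps(1)[OF X(2)]) simp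
      show "C1 * 0\<^sub>m ?n 0 + 0\<^sub>m k1 0 * 0\<^sub>m 0 0 = ?D1 * 0\<^sub>m k1 0 + 0\<^sub>m k1 k2 * 0\<^sub>m k2 0"
        using C1 D by (simp only: zero_block_simps(3)[OF C1 zero_carrier_mat] zero_block_simps(3)[OF D(1) zero_carrier_mat])
      show "C2 * 0\<^sub>m ?n 0 + 0\<^sub>m k2 0 * 0\<^sub>m 0 0 = 0\<^sub>m k2 k1 * 0\<^sub>m k1 0 + ?D2 * 0\<^sub>m k2 0"
        using C2 D by (simp only: zero_block_simps(3)[OF C2 zero_carrier_mat] zero_block_simps(3)[OF zero_carrier_mat D(2)])
    qed
    also have "\<dots> = four_block_mat ?D1 (0\<^sub>m k1 k2) (0\<^sub>m k2 k1) ?D2 * P"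
      unfolding P_def by (rule mult_four_block_mat[OF D(1) zero_carrier_mat zero_carrier_mat D(2)
          C1 zero_carrier_mat C2 zero_carrier_mat, symmetric])
    also have "four_block_mat X (0\<^sub>m k1 k2) (0\<^sub>m k2 k1) Y = block_diag X Y"
      if "X \<in> carrier_mat k1 k1" "Y \<in> carrier_mat k2 k2" for X Y
      using that by (simp add: block_diag_def)
    note this[OF D]
    finally show ?thesis .
  qed
  ultimately show "equivalent_reps G R (k1 + k2, \<lambda>g. block_diag (C1 * snd R g * B1) (C2 * snd R g * B2))"
    unfolding equivalent_reps_def using n by auto
qed

lemma direct_sum_carrier:
  assumes "\<forall>S\<in>set Rs. representation G S" "g \<in> carrier G"
  shows "snd (direct_sum_rep Rs) g \<in> carrier_mat (fst (direct_sum_rep Rs)) (fst (direct_sum_rep Rs))"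
proof -
  have "dim_row (snd S g) = fst S" "dim_col (snd S g) = fst S" if "S \<in> set Rs" for S
    using assms that repD(1)[of S g] by auto
  then have "map (dim_row \<circ> (\<lambda>R. snd R g)) Rs = map fst Rs" "map (dim_col \<circ> (\<lambda>R. snd R g)) Rs = map fst Rs"
    by simp_all
  then show ?thesis
    by (intro carrier_matI) (simp_all only: direct_sum_rep_def fst_conv snd_conv dim_diag_block_mat map_map)
qed

lemma direct_sum_append:
  assumes "g \<in> carrier G"
  shows "snd (direct_sum_rep (Rs @ Ss)) g = block_diag (snd (direct_sum_rep Rs) g) (snd (direct_sum_rep Ss) g)"
  by (simp add: direct_sum_rep_def diag_block_mat_append Let_def block_diag_def)

text \<open>Maschke's averaging, applied to the projection \<open>B * C\<close> onto
  \<open>W\<close>. Invariance of \<open>W\<close> means that \<open>B * C\<close> acts as the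
  identity after any \<open>snd R g * (B * C)\<close>; this is why the average is again a projection
  with image \<open>W\<close>, as the two product identities express.\<close>

lemma reducible_idempotent:
  assumes R: "representation G R" and W: "lin_subspace (fst R) W"
    and inv: "\<And>g w. g \<in> carrier G \<Longrightarrow> w \<in> W \<Longrightarrow> snd R g *\<^sub>v w \<in> W"
    and B: "B \<in> carrier_mat (fst R) k" and C: "C \<in> carrier_mat k (fst R)" and CB: "C * B = 1\<^sub>m k"
    and BW: "\<And>v. v \<in> carrier_vec k \<Longrightarrow> B *\<^sub>v v \<in> W" and fixW: "\<And>w. w \<in> W \<Longrightarrow> B *\<^sub>v (C *\<^sub>v w) = w"
  obtains A where "A \<in> carrier_mat (fst R) (fst R)" "(B * C) * A = A" "A * (B * C) = B * C" "A * A = A"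
    "\<And>g. g \<in> carrier G \<Longrightarrow> snd R g * A = A * snd R g"
proof -
  let ?n = "fst R"
  note r = repD[OF R]
  define A0 where "A0 = B * C"
  have A0: "A0 \<in> carrier_mat ?n ?n" using B C by (simp add: A0_def)
  have A0v: "A0 *\<^sub>v v \<in> W" if v: "v \<in> carrier_vec ?n" for v
  proof -
    have "C *\<^sub>v v \<in> carrier_vec k" using C v by simp
    then show ?thesis using BW assoc_mult_mat_vec[OF B C v] by (simp add: A0_def)
  qed
  have A0w: "A0 *\<^sub>v w = w" if w: "w \<in> W" for w
  proof -
    have "w \<in> carrier_vec ?n" using w W by (auto simp: lin_subspace_def)
    then show ?thesis using fixW[OF w] assoc_mult_mat_vec[OF B C] by (simp add: A0_def)
  qed
  have inv0: "A0 * (snd R g * A0) = snd R g * A0" if g: "g \<in> carrier G" for g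
  proof (rule eq_mat_on_vec[of _ ?n ?n])
    note rg = r(1)[OF g]
    fix v :: "complex vec" assume v: "v \<in> carrier_vec ?n"
    have "(snd R g * A0) *\<^sub>v v = snd R g *\<^sub>v (A0 *\<^sub>v v)" by (rule assoc_mult_mat_vec[OF rg A0 v])
    moreover have "snd R g *\<^sub>v (A0 *\<^sub>v v) \<in> W" by (rule inv[OF g A0v[OF v]])
    moreover have "(A0 * (snd R g * A0)) *\<^sub>v v = A0 *\<^sub>v ((snd R g * A0) *\<^sub>v v)"
      by (rule assoc_mult_mat_vec[OF A0 mult_carrier_mat[OF rg A0] v])
    ultimately show "(A0 * (snd R g * A0)) *\<^sub>v v = (snd R g * A0) *\<^sub>v v" using A0w by simp
  qed (use r(1)[OF g] A0 in auto)
  let ?f = "\<lambda>g. snd R g * A0 * snd R (inv g)"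
  have f: "?f g \<in> carrier_mat ?n ?n" if "g \<in> carrier G" for g
    using r(1)[OF that] r(1)[of "inv g"] A0 that by auto
  define M where "M = msum ?n ?n ?f (carrier G)"
  define N where "N = (of_nat (card (carrier G)) :: complex)"
  have N: "N \<noteq> 0" using card_pos by (simp add: N_def)
  have Mc: "M \<in> carrier_mat ?n ?n" by (simp add: M_def)
  have A0M: "A0 * M = M"
  proof -
    have "A0 * M = msum ?n ?n (\<lambda>g. A0 * ?f g) (carrier G)" unfolding M_def by (rule msum_mult_left[OF A0 f])
    also have "\<dots> = M" unfolding M_def
    proof (rule msum_cong)
      fix g assume g: "g \<in> carrier G"
      have "A0 * ?f g = (A0 * (snd R g * A0)) * snd R (inv g)"
        using assoc_mult_mat[OF A0 mult_carrier_mat[OF r(1)[OF g] A0] r(1)[of "inv g"]] g by simp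
      then show "A0 * ?f g = ?f g" using inv0[OF g] by simp
    qed
    finally show ?thesis .
  qed
  have MA0: "M * A0 = N \<cdot>\<^sub>m A0"
  proof -
    have "M * A0 = msum ?n ?n (\<lambda>g. ?f g * A0) (carrier G)" unfolding M_def by (rule msum_mult_right[OF A0 f])
    also have "\<dots> = msum ?n ?n (\<lambda>g. A0) (carrier G)"
    proof (rule msum_cong)
      fix g assume g: "g \<in> carrier G"
      then have gi: "inv g \<in> carrier G" by simp
      have "?f g * A0 = (snd R g * A0) * (snd R (inv g) * A0)"
        by (rule assoc_mult_mat[OF mult_carrier_mat[OF r(1)[OF g] A0] r(1)[OF gi] A0])
      also have "\<dots> = snd R g * (A0 * (snd R (inv g) * A0))"
        by (rule assoc_mult_mat[OF r(1)[OF g] A0 mult_carrier_mat[OF r(1)[OF gi] A0]])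
      also have "\<dots> = (snd R g * snd R (inv g)) * A0"
        unfolding inv0[OF gi] by (rule assoc_mult_mat[OF r(1)[OF g] r(1)[OF gi] A0, symmetric])
      finally show "?f g * A0 = A0" using r(4)[OF g] A0 by simp
    qed
    also have "\<dots> = N \<cdot>\<^sub>m A0" unfolding N_def by (rule msum_const[OF A0])
    finally show ?thesis .
  qed
  have Mcomm: "snd R g * M = M * snd R g" if "g \<in> carrier G" for g
    unfolding M_def by (rule averaging[OF R R A0 that])
  define A where "A = (1 / N) \<cdot>\<^sub>m M"
  have A: "A \<in> carrier_mat ?n ?n" using Mc by (simp add: A_def)
  have 1: "A0 * A = A" unfolding A_def using mult_smult_distrib[OF A0 Mc] A0M by simp
  have 2: "A * A0 = A0"
  proof -
    have "A * A0 = (1 / N) \<cdot>\<^sub>m (N \<cdot>\<^sub>m A0)" unfolding A_def using mult_smult_assoc_mat[OF Mc A0] MA0 by simp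
    also have "\<dots> = A0" using N by (intro eq_matI) auto
    finally show ?thesis .
  qed
  have "A * A = A * (A0 * A)" using 1 by simp
  also have "\<dots> = A" using assoc_mult_mat[OF A A0 A] 1 2 by simp
  finally have 3: "A * A = A" .
  have 4: "snd R g * A = A * snd R g" if "g \<in> carrier G" for g
    unfolding A_def using mult_smult_distrib[OF r(1)[OF that] Mc] mult_smult_assoc_mat[OF Mc r(1)[OF that]] Mcomm[OF that] by simp
  show thesis using that[OF A] 1 2 3 4 by (simp add: A0_def)
qed

text \<open>The summands are the image and the kernel of the invariant projection \<open>A\<close>.
  Their dimensions are the traces of \<open>A\<close> and of the complementary projection
  \<open>A'\<close>, so they add up to the degree; both are positive because \<open>W\<close> is
  neither zero nor everything.\<close>

lemma reducible_split:
  assumes R: "representation G R" and W: "lin_subspace (fst R) W"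
    and inv: "\<And>g w. g \<in> carrier G \<Longrightarrow> w \<in> W \<Longrightarrow> snd R g *\<^sub>v w \<in> W"
    and proper: "W \<noteq> {0\<^sub>v (fst R)}" "W \<noteq> carrier_vec (fst R)"
  obtains R1 R2 where "representation G R1" "representation G R2" "fst R1 < fst R" "fst R2 < fst R"
    "equivalent_reps G R (fst R1 + fst R2, \<lambda>g. block_diag (snd R1 g) (snd R2 g))"
proof -
  let ?n = "fst R"
  note r = repD[OF R]
  obtain k B C where B: "B \<in> carrier_mat ?n k" and C: "C \<in> carrier_mat k ?n" and CB: "C * B = 1\<^sub>m k"
    and BW: "\<And>v. v \<in> carrier_vec k \<Longrightarrow> B *\<^sub>v v \<in> W" and fixW: "\<And>w. w \<in> W \<Longrightarrow> B *\<^sub>v (C *\<^sub>v w) = w"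
    by (rule subspace_basis[OF W]) (rule that, assumption+)
  obtain A where A: "A \<in> carrier_mat ?n ?n" and 1: "(B * C) * A = A" and 2: "A * (B * C) = B * C"
    and 3: "A * A = A" and comm: "\<And>g. g \<in> carrier G \<Longrightarrow> snd R g * A = A * snd R g"
    by (rule reducible_idempotent[OF R W inv B C CB BW fixW]) (assumption | rule that)+
  define C1 where "C1 = C * A"
  have C1: "C1 \<in> carrier_mat k ?n" using C A by (simp add: C1_def)
  have BC1: "B * C1 = A" unfolding C1_def using assoc_mult_mat[OF B C A] 1 by simp
  have BCB: "(B * C) * B = B" using assoc_mult_mat[OF B C B] CB B by simp
  have AB: "A * B = B"
  proof -
    have BC: "B * C \<in> carrier_mat ?n ?n" using B C by simp
    have "A * B = A * ((B * C) * B)" by (simp add: BCB)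
    also have "\<dots> = (A * (B * C)) * B" using assoc_mult_mat[OF A BC B] by simp
    finally show ?thesis by (simp add: 2 BCB)
  qed
  have CB1: "C1 * B = 1\<^sub>m k" unfolding C1_def using assoc_mult_mat[OF C A B] AB CB by simp
  define A' where "A' = 1\<^sub>m ?n - A"
  have A': "A' \<in> carrier_mat ?n ?n" using A by (auto simp: A'_def)
  have AA': "A * A' = 0\<^sub>m ?n ?n"
    unfolding A'_def using mult_minus_distrib_mat[OF A one_carrier_mat A] A by (simp add: 3)
  define W' where "W' = {v \<in> carrier_vec ?n. A *\<^sub>v v = 0\<^sub>v ?n}"
  have W': "lin_subspace ?n W'"
    unfolding lin_subspace_def W'_def using A by (auto simp: mult_add_distrib_mat_vec mult_mat_vec)
  obtain k' B' D where B': "B' \<in> carrier_mat ?n k'" and D: "D \<in> carrier_mat k' ?n" and DB: "D * B' = 1\<^sub>m k'"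
    and BW': "\<And>v. v \<in> carrier_vec k' \<Longrightarrow> B' *\<^sub>v v \<in> W'" and fixW': "\<And>w. w \<in> W' \<Longrightarrow> B' *\<^sub>v (D *\<^sub>v w) = w"
    by (rule subspace_basis[OF W']) (rule that, assumption+)
  have AB': "A * B' = 0\<^sub>m ?n k'"
  proof (rule eq_mat_on_vec[of _ ?n k'])
    fix v :: "complex vec" assume v: "v \<in> carrier_vec k'"
    then have "A *\<^sub>v (B' *\<^sub>v v) = 0\<^sub>v ?n" using BW' by (simp add: W'_def)
    then show "(A * B') *\<^sub>v v = 0\<^sub>m ?n k' *\<^sub>v v" using assoc_mult_mat_vec[OF A B' v] zero_mat_vec[OF v] by simp
  qed (use A B' in auto)
  have A'B': "A' * B' = B'"
    unfolding A'_def using minus_mult_distrib_mat[OF one_carrier_mat A B'] B' by (auto simp: AB')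
  define C2 where "C2 = D * A'"
  have C2: "C2 \<in> carrier_mat k' ?n" using D A' by (simp add: C2_def)
  have BC2: "B' * C2 = A'"
  proof (rule eq_mat_on_vec[of _ ?n ?n])
    fix v :: "complex vec" assume v: "v \<in> carrier_vec ?n"
    have A'v: "A' *\<^sub>v v \<in> carrier_vec ?n" using A' v by simp
    have "A *\<^sub>v (A' *\<^sub>v v) = 0\<^sub>v ?n" using assoc_mult_mat_vec[OF A A' v] zero_mat_vec[OF v] by (simp add: AA')
    then have "A' *\<^sub>v v \<in> W'" using A'v by (simp add: W'_def)
    then have "B' *\<^sub>v (D *\<^sub>v (A' *\<^sub>v v)) = A' *\<^sub>v v" by (rule fixW')
    then show "(B' * C2) *\<^sub>v v = A' *\<^sub>v v"
      using assoc_mult_mat_vec[OF B' C2 v] assoc_mult_mat_vec[OF D A' v] by (simp add: C2_def)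
  qed (use B' C2 A' in auto)
  have CB2: "C2 * B' = 1\<^sub>m k'" unfolding C2_def using assoc_mult_mat[OF D A' B'] A'B' DB by simp
  have sumA: "A + A' = 1\<^sub>m ?n" using A by (intro eq_matI) (auto simp: A'_def)
  have comm': "snd R g * A' = A' * snd R g" if g: "g \<in> carrier G" for g
    unfolding A'_def using mult_minus_distrib_mat[OF r(1)[OF g] one_carrier_mat A]
      minus_mult_distrib_mat[OF one_carrier_mat A r(1)[OF g]] comm[OF g] r(1)[OF g] by simp
  have "mtrace ?n A = of_nat k"
    using mtrace_commute[OF B C1] by (simp add: BC1 CB1 mtrace_one)
  moreover have "mtrace ?n A' = of_nat k'"
    using mtrace_commute[OF B' C2] by (simp add: BC2 CB2 mtrace_one)
  moreover have "mtrace ?n A + mtrace ?n A' = of_nat ?n"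
  proof -
    have "mtrace ?n A + mtrace ?n A' = mtrace ?n (A + A')"
      using A A' by (simp add: mtrace_def sum.distrib)
    then show ?thesis by (simp add: sumA mtrace_one)
  qed
  ultimately have "of_nat (k + k') = (of_nat ?n :: complex)" by simp
  then have kn: "?n = k + k'" using of_nat_eq_iff by metis
  have "k > 0"
  proof (rule ccontr)
    assume "\<not> k > 0"
    then have "k = 0" by simp
    then have "w = 0\<^sub>v ?n" if w: "w \<in> W" for w
    proof -
      have "w = B *\<^sub>v (C *\<^sub>v w)" using fixW[OF w] by simp
      also have "\<dots> = 0\<^sub>v ?n" using B \<open>k = 0\<close> C by (intro eq_vecI) (auto simp: scalar_prod_def)
      finally show ?thesis .
    qed
    then show False using proper(1) W by (auto simp: lin_subspace_def)
  qed
  moreover have "k' > 0"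
  proof (rule ccontr)
    assume "\<not> k' > 0"
    then have "k' = 0" by simp
    then have "A' = 0\<^sub>m ?n ?n" unfolding BC2[symmetric] using B' C2 by (intro eq_matI) (auto simp: scalar_prod_def)
    then have "A = 1\<^sub>m ?n" using sumA A by simp
    have "v \<in> W" if v: "v \<in> carrier_vec ?n" for v
    proof -
      have "v = A *\<^sub>v v" using v \<open>A = 1\<^sub>m ?n\<close> by simp
      also have "\<dots> = B *\<^sub>v (C1 *\<^sub>v v)" using assoc_mult_mat_vec[OF B C1 v] BC1 by simp
      also have "\<dots> \<in> W" using C1 v by (intro BW) auto
      finally show ?thesis .
    qed
    then show False using proper(2) W by (auto simp: lin_subspace_def)
  qed
  moreover note split_rep[OF R kn B C1 CB1 B' C2 CB2 _ comm[folded BC1] comm'[folded BC2]]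
  ultimately show thesis
    using that[of "(k, \<lambda>g. C1 * snd R g * B)" "(k', \<lambda>g. C2 * snd R g * B')"] kn sumA
    by (simp add: BC1 BC2)
qed

theorem maschke:
  assumes "representation G R"
  shows "\<exists>Rs. irreducible_decomposition G R Rs"
  using assms
proof (induction "fst R" arbitrary: R rule: less_induct)
  case less
  let ?n = "fst R"
  have refl: "equivalent_reps G R S"
    if "fst S = ?n" "\<And>g. g \<in> carrier G \<Longrightarrow> snd S g = snd R g" for S
  proof -
    have "1\<^sub>m ?n \<in> carrier (GL ?n)" by (auto simp: GL_carrier intro: bexI[of _ "1\<^sub>m ?n"])
    moreover have "1\<^sub>m ?n * snd R g = snd S g * 1\<^sub>m ?n" if g: "g \<in> carrier G" for g
      using left_mult_one_mat[OF repD(1)[OF less.prems g]] right_mult_one_mat[OF repD(1)[OF less.prems g]]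
        \<open>\<And>g. g \<in> carrier G \<Longrightarrow> snd S g = snd R g\<close>[OF g] by simp
    ultimately show ?thesis unfolding equivalent_reps_def using that(1) by auto
  qed
  consider "?n = 0" | "irreducible_rep G R" | "?n > 0" "\<not> irreducible_rep G R" by auto
  then show ?case
  proof cases
    case 1
    have "snd R g = 0\<^sub>m 0 0" if "g \<in> carrier G" for g
      using repD(1)[OF less.prems that] 1 by (intro eq_matI) auto
    then have "equivalent_reps G R (direct_sum_rep [])"
      by (intro refl) (simp_all add: direct_sum_rep_def 1)
    then show ?thesis by (intro exI[of _ "[]"]) (simp add: irreducible_decomposition_def)
  next
    case 2
    have "snd (direct_sum_rep [R]) g = snd R g" for g
      by (simp only: direct_sum_rep_def snd_conv list.map diag_block_mat_singleton)
    then have "equivalent_reps G R (direct_sum_rep [R])"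
      by (intro refl) (simp_all add: direct_sum_rep_def)
    then show ?thesis using 2 by (intro exI[of _ "[R]"]) (simp add: irreducible_decomposition_def)
  next
    case 3
    then obtain W where W: "invariant_subspace G R W" "W \<noteq> {0\<^sub>v ?n}" "W \<noteq> carrier_vec ?n"
      using less.prems by (auto simp: irreducible_rep_def)
    then have W': "lin_subspace ?n W" "\<And>g w. g \<in> carrier G \<Longrightarrow> w \<in> W \<Longrightarrow> snd R g *\<^sub>v w \<in> W"
      by (auto simp: invariant_subspace_def lin_subspace_iff)
    obtain R1 R2 where R12: "representation G R1" "representation G R2" "fst R1 < ?n" "fst R2 < ?n"
      "equivalent_reps G R (fst R1 + fst R2, \<lambda>g. block_diag (snd R1 g) (snd R2 g))"
      by (rule reducible_split[OF less.prems W'(1) W'(2) W(2,3)])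
    obtain Rs1 where Rs1: "irreducible_decomposition G R1 Rs1" using less.hyps[OF R12(3,1)] by blast
    obtain Rs2 where Rs2: "irreducible_decomposition G R2 Rs2" using less.hyps[OF R12(4,2)] by blast
    have reps: "\<forall>S\<in>set Rs1. representation G S" "\<forall>S\<in>set Rs2. representation G S"
      using Rs1 Rs2 by (auto simp: irreducible_decomposition_def irreducible_rep_def)
    obtain P1 where n1: "fst R1 = fst (direct_sum_rep Rs1)" and P1: "P1 \<in> carrier (GL (fst R1))"
      "\<And>g. g \<in> carrier G \<Longrightarrow> P1 * snd R1 g = snd (direct_sum_rep Rs1) g * P1"
      using Rs1 by (auto simp: irreducible_decomposition_def equivalent_reps_def)
    obtain P2 where n2: "fst R2 = fst (direct_sum_rep Rs2)" and P2: "P2 \<in> carrier (GL (fst R2))"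
      "\<And>g. g \<in> carrier G \<Longrightarrow> P2 * snd R2 g = snd (direct_sum_rep Rs2) g * P2"
      using Rs2 by (auto simp: irreducible_decomposition_def equivalent_reps_def)
    have Pc: "P1 \<in> carrier_mat (fst R1) (fst R1)" "P2 \<in> carrier_mat (fst R2) (fst R2)"
      using P1 P2 by (auto simp: GL_carrier)
    let ?S = "(fst R1 + fst R2, \<lambda>g. block_diag (snd R1 g) (snd R2 g))"
    have n: "fst (direct_sum_rep (Rs1 @ Rs2)) = fst R1 + fst R2"
      using n1 n2 by (simp add: direct_sum_rep_def)
    have D: "snd (direct_sum_rep Rs1) g \<in> carrier_mat (fst R1) (fst R1)"
      "snd (direct_sum_rep Rs2) g \<in> carrier_mat (fst R2) (fst R2)" if "g \<in> carrier G" for g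
      using direct_sum_carrier[OF reps(1) that] direct_sum_carrier[OF reps(2) that] n1 n2 by auto
    have "block_diag P1 P2 \<in> carrier (GL (fst R1 + fst R2))"
    proof -
      obtain Q1 Q2 where Q: "Q1 \<in> carrier_mat (fst R1) (fst R1)" "Q1 * P1 = 1\<^sub>m (fst R1)" "P1 * Q1 = 1\<^sub>m (fst R1)"
        "Q2 \<in> carrier_mat (fst R2) (fst R2)" "Q2 * P2 = 1\<^sub>m (fst R2)" "P2 * Q2 = 1\<^sub>m (fst R2)"
        using P1(1) P2(1) by (auto simp: GL_carrier)
      then show ?thesis unfolding GL_carrier
        using Pc block_diag_mult[OF Q(1,4) Pc] block_diag_mult[OF Pc Q(1,4)]
        by (auto simp: block_diag_one block_diag_carrier intro!: bexI[of _ "block_diag Q1 Q2"])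
    qed
    moreover have "block_diag P1 P2 * block_diag (snd R1 g) (snd R2 g)
        = snd (direct_sum_rep (Rs1 @ Rs2)) g * block_diag P1 P2" if g: "g \<in> carrier G" for g
      unfolding direct_sum_append[OF g]
      using block_diag_mult[OF Pc repD(1)[OF R12(1) g] repD(1)[OF R12(2) g]]
        block_diag_mult[OF D[OF g] Pc] P1(2)[OF g] P2(2)[OF g] by simp
    ultimately have eqS: "equivalent_reps G ?S (direct_sum_rep (Rs1 @ Rs2))"
      unfolding equivalent_reps_def using n by auto
    have cS: "snd ?S g \<in> carrier_mat (fst ?S) (fst ?S)" if "g \<in> carrier G" for g
      using repD(1)[OF R12(1) that] repD(1)[OF R12(2) that] by (simp add: block_diag_carrier)
    have cT: "snd (direct_sum_rep (Rs1 @ Rs2)) g \<in> carrier_mat (fst (direct_sum_rep (Rs1 @ Rs2))) (fst (direct_sum_rep (Rs1 @ Rs2)))"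
      if "g \<in> carrier G" for g
      using reps by (intro direct_sum_carrier that) auto
    have "equivalent_reps G R (direct_sum_rep (Rs1 @ Rs2))"
      by (rule equivalent_trans[OF less.prems cS cT R12(5) eqS])
    then show ?thesis using Rs1 Rs2
      by (intro exI[of _ "Rs1 @ Rs2"]) (auto simp: irreducible_decomposition_def)
  qed
qed

subsection \<open>Multiplicities as weighted traces\<close>

text \<open>The trace on \<open>R\<close> of the primitive idempotent attached to \<open>U\<close>,
  with the coefficients of \<open>lookup_idem\<close>. Its trace is 1 on a copy of \<open>U\<close>
  and 0 on any other irreducible, so it counts multiplicities and has the shape that
  \<open>trace_le_2\<close> bounds.\<close>

definition weighted_trace :: "'a rep \<Rightarrow> 'a rep \<Rightarrow> complex" where
  "weighted_trace U R = (\<Sum>g\<in>carrier G. of_nat (fst U) / of_nat (card (carrier G)) * snd U (inv g) $$ (0, 0)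
     * mtrace (fst R) (snd R g))"

lemma trace_equivalent:
  assumes R: "representation G R" and S: "snd S g \<in> carrier_mat (fst S) (fst S)"
    and RS: "equivalent_reps G R S" and g: "g \<in> carrier G"
  shows "mtrace (fst R) (snd R g) = mtrace (fst S) (snd S g)"
proof -
  let ?n = "fst R"
  obtain P where n: "fst S = ?n" and P: "P \<in> carrier (GL ?n)" and PR: "P * snd R g = snd S g * P"
    using RS g by (auto simp: equivalent_reps_def)
  obtain Q where Q: "Q \<in> carrier_mat ?n ?n" "Q * P = 1\<^sub>m ?n" "P * Q = 1\<^sub>m ?n" and Pc: "P \<in> carrier_mat ?n ?n"
    using P by (auto simp: GL_carrier)
  have Rg: "snd R g \<in> carrier_mat ?n ?n" and Sg: "snd S g \<in> carrier_mat ?n ?n"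
    using repD(1)[OF R g] S n by auto
  have "snd R g = Q * (P * snd R g)" using assoc_mult_mat[OF Q(1) Pc Rg] Q Rg by simp
  then have "mtrace ?n (snd R g) = mtrace ?n (Q * (snd S g * P))" by (simp only: PR)
  also have "\<dots> = mtrace ?n ((snd S g * P) * Q)" using Q Pc Sg by (intro mtrace_commute) auto
  also have "(snd S g * P) * Q = snd S g" using assoc_mult_mat[OF Sg Pc Q(1)] Q Sg by simp
  finally show ?thesis by (simp add: n)
qed

lemma trace_direct_sum:
  assumes "\<forall>S\<in>set Rs. representation G S" and g: "g \<in> carrier G"
  shows "mtrace (fst (direct_sum_rep Rs)) (snd (direct_sum_rep Rs) g) = (\<Sum>R\<leftarrow>Rs. mtrace (fst R) (snd R g))"
  using assms(1)
proof (induction Rs)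
  case Nil
  then show ?case by (simp add: direct_sum_rep_def mtrace_def)
next
  case (Cons R Rs)
  have c: "snd R g \<in> carrier_mat (fst R) (fst R)"
    "snd (direct_sum_rep Rs) g \<in> carrier_mat (fst (direct_sum_rep Rs)) (fst (direct_sum_rep Rs))"
    using Cons.prems repD(1)[of R g] direct_sum_carrier[of Rs g] g by auto
  have "snd (direct_sum_rep (R # Rs)) g = block_diag (snd R g) (snd (direct_sum_rep Rs) g)"
    by (simp add: direct_sum_rep_def block_diag_def Let_def)
  moreover have "fst (direct_sum_rep (R # Rs)) = fst R + fst (direct_sum_rep Rs)"
    by (simp add: direct_sum_rep_def)
  ultimately show ?case using Cons mtrace_four_block[OF c] by (simp add: block_diag_def)
qed

lemma weighted_trace_irreducible:
  assumes U: "irreducible_rep G U" and S: "irreducible_rep G S"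
  shows "weighted_trace U S = (if equivalent_reps G U S then 1 else 0)"
proof -
  have repU: "representation G U" and u: "fst U > 0" and repS: "representation G S"
    using U S by (auto simp: irreducible_rep_def)
  have swap: "weighted_trace U T = of_nat (fst U) / of_nat (card (carrier G)) *
      (\<Sum>i<fst T. \<Sum>g\<in>carrier G. snd T g $$ (i, i) * snd U (inv g) $$ (0, 0))" for T
    unfolding weighted_trace_def mtrace_def
    by (subst sum.swap) (simp add: sum_distrib_left sum_distrib_right sum_divide_distrib mult_ac)
  show ?thesis
  proof (cases "equivalent_reps G U S")
    case True
    have "weighted_trace U S = weighted_trace U U"
      unfolding weighted_trace_def
      using trace_equivalent[OF repU repD(1)[OF repS] True] by (intro sum.cong) auto
    also have "\<dots> = of_nat (fst U) / of_nat (card (carrier G)) *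
        (\<Sum>i<fst U. if i = 0 then of_nat (card (carrier G)) / of_nat (fst U) else 0)"
      unfolding swap using u by (intro arg_cong2[where f = "(*)"] sum.cong refl) (simp add: orthogonality[OF U])
    also have "\<dots> = 1" using u card_pos by simp
    finally show ?thesis using True by simp
  next
    case False
    then show ?thesis unfolding swap using u by (simp add: orthogonality_inequivalent[OF S U])
  qed
qed

lemma weighted_trace_decomposition:
  assumes U: "irreducible_rep G U" and R: "representation G R" and dec: "irreducible_decomposition G R Rs"
  shows "weighted_trace U R = of_nat (length (filter (equivalent_reps G U) Rs))"
proof -
  have irr: "\<And>S. S \<in> set Rs \<Longrightarrow> irreducible_rep G S" and eq: "equivalent_reps G R (direct_sum_rep Rs)"
    using dec by (auto simp: irreducible_decomposition_def)
  have reps: "\<forall>S\<in>set Rs. representation G S" using irr by (auto simp: irreducible_rep_def)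
  have "weighted_trace U R = (\<Sum>g\<in>carrier G. of_nat (fst U) / of_nat (card (carrier G)) * snd U (inv g) $$ (0, 0)
     * (\<Sum>S\<leftarrow>Rs. mtrace (fst S) (snd S g)))"
    unfolding weighted_trace_def
    using trace_equivalent[OF R direct_sum_carrier[OF reps] eq] trace_direct_sum[OF reps]
    by (intro sum.cong refl) simp
  also have "\<dots> = (\<Sum>S\<leftarrow>Rs. weighted_trace U S)"
    by (induction Rs) (simp_all add: weighted_trace_def distrib_left sum.distrib)
  also have "\<dots> = of_nat (length (filter (equivalent_reps G U) Rs))"
    using irr by (induction Rs) (simp_all add: weighted_trace_irreducible[OF U])
  finally show ?thesis .
qed

text \<open>The weighted trace makes no reference to a decomposition. So all decompositions give the
  same count, and the description in \<open>multiplicity_in\<close> has a unique solution, existence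
  being \<open>maschke\<close>.\<close>

theorem multiplicity_weighted_trace:
  assumes U: "irreducible_rep G U" and R: "representation G R"
  shows "of_nat (multiplicity_in G U R) = weighted_trace U R"
proof -
  obtain Rs where Rs: "irreducible_decomposition G R Rs" using maschke[OF R] by blast
  have "multiplicity_in G U R = length (filter (equivalent_reps G U) Rs)"
    unfolding multiplicity_in_def
  proof (rule the_equality)
    fix k assume "\<exists>Rs. irreducible_decomposition G R Rs \<and> k = length (filter (equivalent_reps G U) Rs)"
    then have "of_nat k = weighted_trace U R" using weighted_trace_decomposition[OF U R] by auto
    then show "k = length (filter (equivalent_reps G U) Rs)"
      using weighted_trace_decomposition[OF U R Rs] by simp
  qed (use Rs in blast)
  then show ?thesis using weighted_trace_decomposition[OF U R Rs] by simp
qed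

end

section \<open>The matrix groups as kernels of \<open>omega\<close> in the abstract monomial
  groups\<close>

section \<open>The groups \<open>G(de,e,r)\<close> as matrix groups\<close>

definition mono_mat :: "nat \<Rightarrow> gmon \<Rightarrow> complex mat" where
  "mono_mat n g = mat n n (\<lambda>(i, j). if i = prm g j then cf g j else 0)"

lemma mono_mat_carrier [simp]: "mono_mat n g \<in> carrier_mat n n"
  by (simp add: mono_mat_def)

lemma mono_mat_add:
  assumes h: "prm h permutes {..<n}"
  shows "mono_mat n (g + h) = mono_mat n g * mono_mat n h"
proof (rule eq_matI)
  fix i j assume "i < dim_row (mono_mat n g * mono_mat n h)" "j < dim_col (mono_mat n g * mono_mat n h)"
  then have ij: "i < n" "j < n" by (simp_all add: mono_mat_def)
  then have hj: "prm h j < n" using permutes_in_image[OF h, of j] by simp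
  have "(mono_mat n g * mono_mat n h) $$ (i, j)
      = (\<Sum>k<n. if k = prm h j then (if i = prm g k then cf g k else 0) * cf h j else 0)"
    unfolding mult_entry[OF mono_mat_carrier mono_mat_carrier ij]
    using ij by (intro sum.cong) (auto simp: mono_mat_def)
  also have "\<dots> = mono_mat n (g + h) $$ (i, j)"
    using ij hj by (simp add: mono_mat_def mult.commute)
  finally show "mono_mat n (g + h) $$ (i, j) = (mono_mat n g * mono_mat n h) $$ (i, j)" by simp
qed (simp_all add: mono_mat_def)

lemma mono_mat_0: "mono_mat n 0 = 1\<^sub>m n"
  by (rule eq_matI) (auto simp: mono_mat_def)

lemma nonzero_positions_mono_mat:
  assumes "prm g permutes {..<n}"
  shows "nonzero_positions (mono_mat n g) = (\<lambda>j. (prm g j, j)) ` {..<n}"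
proof (intro equalityI subsetI)
  fix p assume p: "p \<in> nonzero_positions (mono_mat n g)"
  obtain i j where ij: "p = (i, j)" by fastforce
  have "i < n" "j < n" "mono_mat n g $$ (i, j) \<noteq> 0"
    using p by (simp_all add: nonzero_positions_def ij carrier_matD[OF mono_mat_carrier])
  then have "i = prm g j" by (simp add: mono_mat_def split: if_splits)
  then show "p \<in> (\<lambda>j. (prm g j, j)) ` {..<n}" using \<open>j < n\<close> ij by blast
next
  fix p assume "p \<in> (\<lambda>j. (prm g j, j)) ` {..<n}"
  then obtain j where j: "j < n" "p = (prm g j, j)" by blast
  then have "prm g j < n" using permutes_in_image[OF assms, of j] by simp
  then show "p \<in> nonzero_positions (mono_mat n g)"
    using j by (simp add: nonzero_positions_def mono_mat_def cf_nonzero)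
qed

lemma fix_last_mono_mat:
  assumes "prm g permutes {..<r}" "cf g r = 1"
  shows "fix_last r (mono_mat r g) = mono_mat (Suc r) g"
proof (rule eq_matI)
  fix i j assume "i < dim_row (mono_mat (Suc r) g)" "j < dim_col (mono_mat (Suc r) g)"
  then have ij: "i < Suc r" "j < Suc r" by (simp_all add: mono_mat_def)
  have gr: "prm g r = r" using permutes_not_in[OF assms(1), of r] by simp
  have gj: "prm g j < r \<longleftrightarrow> j < r" using permutes_in_image[OF assms(1), of j] by simp
  show "fix_last r (mono_mat r g) $$ (i, j) = mono_mat (Suc r) g $$ (i, j)"
    using ij gr gj assms(2)
    by (cases "i < r"; cases "j < r") (auto simp: fix_last_def mono_mat_def less_Suc_eq)
qed (simp_all add: fix_last_def mono_mat_def)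

context mu_group
begin

definition kernel_group :: "nat \<Rightarrow> nat \<Rightarrow> gmon set" where
  "kernel_group d n = {g\<in>full_group m n. omega d g = 1}"

lemma kernel_group:
  assumes "m = d * e"
  shows "finite_subgroup (kernel_group d n)"
  using graded_group.finH[OF graded_full_group[OF assms]] by (simp add: kernel_group_def)

lemma omega_full_group:
  assumes "g \<in> full_group m n"
  shows "omega d g = (\<Prod>j<n. cf g j) ^ d"
  using assms unfolding omega_def full_group_iff
  by (intro arg_cong[where f = "\<lambda>x. x ^ d"] Prod_any.expand_superset) (auto simp: diag_group_def)

lemma prod_nonzero_positions:
  assumes "prm g permutes {..<n}"
  shows "(\<Prod>p\<in>nonzero_positions (mono_mat n g). mono_mat n g $$ p) = (\<Prod>j<n. cf g j)"
  unfolding nonzero_positions_mono_mat[OF assms]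
  by (subst prod.reindex)
    (use permutes_in_image[OF assms] in \<open>auto simp: inj_on_def mono_mat_def intro!: prod.cong\<close>)

lemma inj_mono_mat: "inj_on (mono_mat n) (full_group m n)"
proof (rule inj_onI)
  fix g h assume g: "g \<in> full_group m n" and h: "h \<in> full_group m n" and eq: "mono_mat n g = mono_mat n h"
  have gp: "prm g permutes {..<n}" "cf g \<in> D {..<n}" and hp: "prm h permutes {..<n}" "cf h \<in> D {..<n}"
    using g h by (auto simp: full_group_iff)
  have entry: "prm g j = prm h j \<and> cf g j = cf h j" if j: "j < n" for j
  proof -
    have gj: "prm g j < n" using permutes_in_image[OF gp(1), of j] j by simp
    have "mono_mat n h $$ (prm g j, j) = cf g j"
      unfolding eq[symmetric] using gj j by (simp add: mono_mat_def)
    moreover have "mono_mat n h $$ (prm g j, j) = (if prm g j = prm h j then cf h j else 0)"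
      using gj j by (simp add: mono_mat_def)
    ultimately show ?thesis using cf_nonzero[of g j] by (cases "prm g j = prm h j") simp_all
  qed
  show "g = h"
  proof (rule gmon_eqI)
    show "prm g = prm h"
    proof
      fix j show "prm g j = prm h j"
        using entry permutes_not_in[OF gp(1), of j] permutes_not_in[OF hp(1), of j] by (cases "j < n") auto
    qed
    show "cf g = cf h"
    proof
      fix j show "cf g j = cf h j"
        using entry gp(2) hp(2) by (cases "j < n") (auto simp: diag_group_def)
    qed
  qed
qed

lemma carrier_G_group:
  assumes md: "m = d * e"
  shows "carrier (G_group d e n) = mono_mat n ` kernel_group d n"
proof (intro equalityI subsetI)
  fix A assume "A \<in> mono_mat n ` kernel_group d n"
  then obtain g where g: "g \<in> full_group m n" "omega d g = 1" "A = mono_mat n g"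
    by (auto simp: kernel_group_def)
  have gp: "prm g permutes {..<n}" "cf g \<in> D {..<n}" using g(1) by (auto simp: full_group_iff)
  have g': "- g \<in> full_group m n" using g(1) full_group by (auto simp: finite_subgroup_def)
  then have gp': "prm (- g) permutes {..<n}" by (auto simp: full_group_iff)
  have "mono_mat n (- g) * A = 1\<^sub>m n" "A * mono_mat n (- g) = 1\<^sub>m n"
    using mono_mat_add[OF gp(1), of "- g"] mono_mat_add[OF gp', of g] by (simp_all add: g(3) mono_mat_0)
  then have GL: "A \<in> carrier (GL n)"
    unfolding GL_carrier g(3) by (auto intro!: bexI[of _ "mono_mat n (- g)"])
  have mono: "monomial_mat A"
    unfolding monomial_mat_def
  proof (intro conjI allI impI)
    fix j assume "j < dim_col A"
    then have j: "j < n" by (simp add: g(3) mono_mat_def)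
    then have "prm g j < n" using permutes_in_image[OF gp(1), of j] by simp
    then show "\<exists>!i. i < dim_row A \<and> A $$ (i, j) \<noteq> 0"
      using j by (intro ex1I[of _ "prm g j"]) (auto simp: g(3) mono_mat_def cf_nonzero split: if_splits)
  next
    fix i assume "i < dim_row A"
    then have i: "i < n" by (simp add: g(3) mono_mat_def)
    obtain j where j: "prm g j = i" using permutes_surj[OF gp(1)] by (metis surjD)
    then have jn: "j < n" using permutes_in_image[OF gp(1), of j] i by simp
    show "\<exists>!j. j < dim_col A \<and> A $$ (i, j) \<noteq> 0"
    proof (rule ex1I[of _ j])
      show "j < dim_col A \<and> A $$ (i, j) \<noteq> 0" using i jn j by (simp add: g(3) mono_mat_def cf_nonzero)
      fix k assume "k < dim_col A \<and> A $$ (i, k) \<noteq> 0"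
      then have "prm g k = i" using i by (auto simp: g(3) mono_mat_def split: if_splits)
      then show "k = j" using j permutes_inj[OF gp(1)] by (auto dest: injD)
    qed
  qed
  have roots: "A $$ p \<in> root_group (d * e)" if "p \<in> nonzero_positions A" for p
    using that gp(2) permutes_in_image[OF gp(1)]
    unfolding g(3) nonzero_positions_mono_mat[OF gp(1)]
    by (auto simp: mono_mat_def root_group_def diag_group_def md[symmetric])
  have "(\<Prod>p\<in>nonzero_positions A. A $$ p) \<in> root_group d"
    using g(2) omega_full_group[OF g(1), of d] by (simp add: g(3) prod_nonzero_positions[OF gp(1)] root_group_def)
  then show "A \<in> carrier (G_group d e n)" using GL mono roots by (simp add: G_group_def)
next
  fix A assume A: "A \<in> carrier (G_group d e n)"
  then have Ac: "A \<in> carrier_mat n n" and mono: "monomial_mat A"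
    and roots: "\<And>p. p \<in> nonzero_positions A \<Longrightarrow> A $$ p \<in> root_group (d * e)"
    and det: "(\<Prod>p\<in>nonzero_positions A. A $$ p) \<in> root_group d"
    by (auto simp: G_group_def GL_carrier)
  have row: "\<exists>!j. j < n \<and> A $$ (i, j) \<noteq> 0" if "i < n" for i
    using mono that Ac by (auto simp: monomial_mat_def)
  have col: "\<exists>!i. i < n \<and> A $$ (i, j) \<noteq> 0" if "j < n" for j
    using mono that Ac by (auto simp: monomial_mat_def)
  \<comment> \<open>Beyond \<open>n\<close> the permutation is the identity, and the entries
    \<open>t\<close> below are 1 there, as membership in \<open>full_group\<close> demands.\<close>
  define w where "w j = (if j < n then THE i. i < n \<and> A $$ (i, j) \<noteq> 0 else j)" for j
  have w: "w j < n" "A $$ (w j, j) \<noteq> 0" if "j < n" for j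
    using theI'[OF col[OF that]] that by (simp_all add: w_def)
  have w_unique: "i = w j" if "i < n" "j < n" "A $$ (i, j) \<noteq> 0" for i j
    using col[OF that(2)] that w[OF that(2)] by blast
  have "inj_on w {..<n}"
  proof (rule inj_onI)
    fix j k assume jk: "j \<in> {..<n}" "k \<in> {..<n}" "w j = w k"
    then show "j = k" using row[of "w j"] w[of j] w[of k] by auto
  qed
  moreover have "w ` {..<n} \<subseteq> {..<n}" using w by auto
  ultimately have "bij_betw w {..<n} {..<n}"
    using endo_inj_surj[of "{..<n}" w] by (simp add: bij_betw_def)
  then have wp: "w permutes {..<n}" by (rule bij_imp_permutes) (simp add: w_def)
  define t where "t j = (if j < n then A $$ (w j, j) else 1)" for j
  have tD: "t \<in> D {..<n}"
    using roots w Ac by (auto simp: t_def diag_group_def root_group_def nonzero_positions_def md)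
  define g where "g = Pm w + Tm t"
  have dt: "diagonal t" using tD by (rule D_diagonal[rotated]) simp
  have pg: "prm g = w" "cf g = t" using dt permutes_bij[OF wp] by (simp_all add: g_def fun_eq_iff)
  have full: "g \<in> full_group m n" using wp tD by (simp add: full_group_iff pg)
  have gA: "mono_mat n g = A"
  proof (rule eq_matI)
    fix i j assume "i < dim_row A" "j < dim_col A"
    then have ij: "i < n" "j < n" using Ac by auto
    show "mono_mat n g $$ (i, j) = A $$ (i, j)"
      using ij w_unique[OF ij] by (auto simp: mono_mat_def pg t_def)
  qed (use Ac in \<open>simp_all add: carrier_matD[OF mono_mat_carrier]\<close>)
  have "omega d g = 1"
    using det prod_nonzero_positions[of g n] omega_full_group[OF full, of d] wp
    by (simp add: pg gA root_group_def)
  then show "A \<in> mono_mat n ` kernel_group d n" using full gA by (auto simp: kernel_group_def)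
qed

lemma kernel_group_permutes: "g \<in> kernel_group d n \<Longrightarrow> prm g permutes {..<n}"
  by (simp add: kernel_group_def full_group_iff)

lemma G_group_simps: "A \<otimes>\<^bsub>G_group d e n\<^esub> B = A * B" "\<one>\<^bsub>G_group d e n\<^esub> = 1\<^sub>m n"
  by (simp_all add: G_group_def GL_simps)

lemma finite_group_G_group:
  assumes md: "m = d * e"
  shows "finite_group (G_group d e n)"
    and "g \<in> kernel_group d n \<Longrightarrow> m_inv (G_group d e n) (mono_mat n g) = mono_mat n (- g)"
proof -
  let ?H = "mono_mat n ` kernel_group d n"
  note K = kernel_group[OF md, of n, unfolded finite_subgroup_def]
  interpret GL: group "GL n" by (rule group_GL)
  have sub: "?H \<subseteq> carrier (GL n)" unfolding carrier_G_group[OF md, symmetric] by (auto simp: G_group_def)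
  have inv: "mono_mat n (- g) * mono_mat n g = 1\<^sub>m n" if "g \<in> kernel_group d n" for g
    using mono_mat_add[OF kernel_group_permutes[OF that], of "- g"] by (simp add: mono_mat_0)
  have "subgroup ?H (GL n)"
  proof
    show "?H \<subseteq> carrier (GL n)" by (rule sub)
    show "\<one>\<^bsub>GL n\<^esub> \<in> ?H" using K by (auto simp: GL_simps mono_mat_0[symmetric])
    fix A assume "A \<in> ?H"
    then obtain g where g: "g \<in> kernel_group d n" "A = mono_mat n g" by blast
    have "m_inv (GL n) A = mono_mat n (- g)"
    proof (rule GL.inv_equality)
      show "mono_mat n (- g) \<otimes>\<^bsub>GL n\<^esub> A = \<one>\<^bsub>GL n\<^esub>" using inv[OF g(1)] by (simp add: GL_simps g(2))
    qed (use sub g K in auto)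
    then show "m_inv (GL n) A \<in> ?H" using K g by auto
    fix B assume "B \<in> ?H"
    then obtain h where h: "h \<in> kernel_group d n" "B = mono_mat n h" by blast
    have "A * B = mono_mat n (g + h)" by (simp add: mono_mat_add[OF kernel_group_permutes[OF h(1)]] g h)
    then show "A \<otimes>\<^bsub>GL n\<^esub> B \<in> ?H" using K g h by (auto simp: GL_simps)
  qed
  then have "group ((GL n)\<lparr>carrier := ?H\<rparr>)" by (rule GL.subgroup_imp_group)
  moreover have "(GL n)\<lparr>carrier := ?H\<rparr> = G_group d e n"
    using carrier_G_group[OF md, of n] by (simp add: G_group_def)
  ultimately have grp: "group (G_group d e n)" by simp
  interpret G: group "G_group d e n" by (rule grp)
  show "finite_group (G_group d e n)"
    by unfold_locales (use K in \<open>simp add: carrier_G_group[OF md]\<close>)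
  show "m_inv (G_group d e n) (mono_mat n g) = mono_mat n (- g)" if "g \<in> kernel_group d n"
    by (rule G.inv_equality) (use inv[OF that] that K in \<open>auto simp: G_group_simps carrier_G_group[OF md]\<close>)
qed

lemma sum_G_group:
  assumes md: "m = d * e"
  shows "(\<Sum>A\<in>carrier (G_group d e n). f A) = (\<Sum>g\<in>kernel_group d n. f (mono_mat n g))"
    and "card (carrier (G_group d e n)) = card (kernel_group d n)"
proof -
  have inj: "inj_on (mono_mat n) (kernel_group d n)"
    by (rule inj_on_subset[OF inj_mono_mat]) (auto simp: kernel_group_def)
  show "(\<Sum>A\<in>carrier (G_group d e n). f A) = (\<Sum>g\<in>kernel_group d n. f (mono_mat n g))"
    unfolding carrier_G_group[OF md] by (simp add: sum.reindex[OF inj])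
  show "card (carrier (G_group d e n)) = card (kernel_group d n)"
    unfolding carrier_G_group[OF md] by (rule card_image[OF inj])
qed

lemma coefficients_irreducible:
  assumes md: "m = d * e" and U: "irreducible_rep (G_group d e n) U"
  shows "coefficients (kernel_group d n) (\<lambda>g i j. snd U (mono_mat n g) $$ (i, j)) (fst U)"
proof -
  let ?G = "G_group d e n"
  interpret finite_group ?G by (rule finite_group_G_group(1)[OF md])
  have rep: "representation ?G U" and u: "fst U > 0" using U by (auto simp: irreducible_rep_def)
  have mem: "mono_mat n g \<in> carrier ?G" if "g \<in> kernel_group d n" for g
    using that by (simp add: carrier_G_group[OF md])
  show ?thesis
  proof
    show "finite_subgroup (kernel_group d n)" by (rule kernel_group[OF md])
    show "fst U > 0" by (rule u)
    show "snd U (mono_mat n (g + h)) $$ (i, j) = (\<Sum>k<fst U. snd U (mono_mat n g) $$ (i, k) * snd U (mono_mat n h) $$ (k, j))"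
      if "g \<in> kernel_group d n" "h \<in> kernel_group d n" "i < fst U" "j < fst U" for g h i j
      using repD(2)[OF rep mem[OF that(1)] mem[OF that(2)]]
        mult_entry[OF repD(1)[OF rep mem[OF that(1)]] repD(1)[OF rep mem[OF that(2)]] that(3,4)]
      by (simp add: G_group_simps mono_mat_add[OF kernel_group_permutes[OF that(2)]])
    show "(\<Sum>g\<in>kernel_group d n. snd U (mono_mat n g) $$ (i, j) * snd U (mono_mat n (- g)) $$ (k, l))
        = (if i = l \<and> j = k then of_nat (card (kernel_group d n)) / of_nat (fst U) else 0)"
      if "i < fst U" "j < fst U" "k < fst U" "l < fst U" for i j k l
    proof -
      have "(\<Sum>g\<in>kernel_group d n. snd U (mono_mat n g) $$ (i, j) * snd U (mono_mat n (- g)) $$ (k, l))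
          = (\<Sum>A\<in>carrier ?G. snd U A $$ (i, j) * snd U (m_inv ?G A) $$ (k, l))"
        unfolding sum_G_group(1)[OF md] by (intro sum.cong refl) (simp add: finite_group_G_group(2)[OF md])
      then show ?thesis using orthogonality[OF U that] by (simp add: sum_G_group(2)[OF md])
    qed
  qed
qed

lemma representation_restrict:
  assumes md: "m = d * e" and R: "representation (G_group d e (Suc r)) R"
  shows "representation (G_group d e r) (restrict_rep r R)"
proof -
  interpret big: finite_group "G_group d e (Suc r)" by (rule finite_group_G_group(1)[OF md])
  interpret small: finite_group "G_group d e r" by (rule finite_group_G_group(1)[OF md])
  note K = kernel_group[OF md, unfolded finite_subgroup_def]
  have sub: "g \<in> kernel_group d (Suc r)" if "g \<in> kernel_group d r" for g
    using that permutes_subset[of "prm g" "{..<r}" "{..<Suc r}"] D_mono[of "{..<r}" "{..<Suc r}" "cf g"]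
    by (auto simp: kernel_group_def full_group_iff)
  have fix_last: "fix_last r (mono_mat r g) = mono_mat (Suc r) g" if "g \<in> kernel_group d r" for g
    using that by (intro fix_last_mono_mat) (auto simp: kernel_group_def full_group_iff diag_group_def)
  have mem: "mono_mat (Suc r) g \<in> carrier (G_group d e (Suc r))" if "g \<in> kernel_group d r" for g
    using sub[OF that] by (simp add: carrier_G_group[OF md])
  show ?thesis unfolding restrict_rep_def
  proof (rule small.repI)
    fix A assume "A \<in> carrier (G_group d e r)"
    then obtain g where g: "g \<in> kernel_group d r" "A = mono_mat r g" by (auto simp: carrier_G_group[OF md])
    show "snd R (fix_last r A) \<in> carrier_mat (fst R) (fst R)"
      using big.repD(1)[OF R mem[OF g(1)]] by (simp add: g(2) fix_last[OF g(1)])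
    fix B assume "B \<in> carrier (G_group d e r)"
    then obtain h where h: "h \<in> kernel_group d r" "B = mono_mat r h" by (auto simp: carrier_G_group[OF md])
    have gh: "g + h \<in> kernel_group d r" using K g h by auto
    have "A \<otimes>\<^bsub>G_group d e r\<^esub> B = mono_mat r (g + h)"
      by (simp add: G_group_simps g h mono_mat_add[OF kernel_group_permutes[OF h(1)]])
    then have "fix_last r (A \<otimes>\<^bsub>G_group d e r\<^esub> B) = mono_mat (Suc r) g \<otimes>\<^bsub>G_group d e (Suc r)\<^esub> mono_mat (Suc r) h"
      using fix_last[OF gh] mono_mat_add[OF kernel_group_permutes[OF sub[OF h(1)]], of g] by (simp add: G_group_simps)
    then show "snd R (fix_last r (A \<otimes>\<^bsub>G_group d e r\<^esub> B)) = snd R (fix_last r A) * snd R (fix_last r B)"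
      using big.repD(2)[OF R mem[OF g(1)] mem[OF h(1)]] by (simp add: g h fix_last[OF g(1)] fix_last[OF h(1)])
  next
    have 0: "0 \<in> kernel_group d r" using K by auto
    have "fix_last r \<one>\<^bsub>G_group d e r\<^esub> = \<one>\<^bsub>G_group d e (Suc r)\<^esub>"
      using fix_last[OF 0] by (simp add: G_group_simps mono_mat_0)
    then show "snd R (fix_last r \<one>\<^bsub>G_group d e r\<^esub>) = 1\<^sub>m (fst R)" using big.repD(3)[OF R] by simp
  qed
qed

text \<open>Transported along \<open>mono_mat\<close>, restriction to the parabolic subgroup becomes
  evaluation on the smaller kernel, and the weighted trace becomes literally the sum in
  \<open>trace_le_2\<close>.\<close>

lemma multiplicity_le_2:
  assumes md: "m = d * e"
    and R: "irreducible_rep (G_group d e (Suc r)) R" and U: "irreducible_rep (G_group d e r) U"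
  shows "multiplicity_in (G_group d e r) U (restrict_rep r R) \<le> 2"
proof -
  let ?L = "kernel_group d r"
  interpret small: finite_group "G_group d e r" by (rule finite_group_G_group(1)[OF md])
  have rep: "representation (G_group d e (Suc r)) R" using R by (simp add: irreducible_rep_def)
  have "of_nat (multiplicity_in (G_group d e r) U (restrict_rep r R))
      = (\<Sum>A\<in>carrier (G_group d e r). of_nat (fst U) / of_nat (card ?L) * snd U (m_inv (G_group d e r) A) $$ (0, 0)
          * mtrace (fst R) (snd R (fix_last r A)))"
    using small.multiplicity_weighted_trace[OF U representation_restrict[OF md rep]]
    by (simp add: small.weighted_trace_def restrict_rep_def sum_G_group(2)[OF md])
  also have "\<dots> = (\<Sum>g\<in>?L. of_nat (fst U) / of_nat (card ?L) * snd U (mono_mat r (- g)) $$ (0, 0)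
          * (\<Sum>i<fst R. snd R (mono_mat (Suc r) g) $$ (i, i)))"
    unfolding sum_G_group(1)[OF md]
  proof (intro sum.cong refl)
    fix g assume g: "g \<in> ?L"
    then have "fix_last r (mono_mat r g) = mono_mat (Suc r) g"
      by (intro fix_last_mono_mat) (auto simp: kernel_group_def full_group_iff diag_group_def)
    then show "of_nat (fst U) / of_nat (card ?L) * snd U (m_inv (G_group d e r) (mono_mat r g)) $$ (0, 0)
          * mtrace (fst R) (snd R (fix_last r (mono_mat r g)))
        = of_nat (fst U) / of_nat (card ?L) * snd U (mono_mat r (- g)) $$ (0, 0)
          * (\<Sum>i<fst R. snd R (mono_mat (Suc r) g) $$ (i, i))"
      by (simp add: finite_group_G_group(2)[OF md g] mtrace_def)
  qed
  finally have "of_nat (multiplicity_in (G_group d e r) U (restrict_rep r R)) = \<dots>" .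
  moreover have "\<exists>t\<le>2. \<dots> = of_nat t"
    using branching.trace_le_2[OF branching_full_group[OF md, of r],
        OF coefficients_irreducible[OF md R, unfolded kernel_group_def]
          coefficients_irreducible[OF md U, unfolded kernel_group_def]]
    by (simp only: kernel_group_def)
  ultimately obtain t where "t \<le> 2"
    "(of_nat (multiplicity_in (G_group d e r) U (restrict_rep r R)) :: complex) = of_nat t" by auto
  then show ?thesis by (simp only: of_nat_eq_iff)
qed

end

theorem theorem1:
  fixes d e r :: nat and rho1 rho2 :: "complex mat rep"
  assumes "d \<ge> 1" and "e \<ge> 1" and "r \<ge> 1"
    and "irreducible_rep (G_group d e (r + 1)) rho1"
    and "irreducible_rep (G_group d e r) rho2"
  shows "multiplicity_in (G_group d e r) rho2 (restrict_rep r rho1) \<le> 2"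
proof -
  interpret mu_group "d * e" using assms by unfold_locales simp
  show ?thesis using assms(4,5) by (intro multiplicity_le_2) simp_all
qed

end
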